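(* Let $L>0$ and $\mu>0$, and let $\mathcal{A}_s^{\mu}$ be the symmetric part of the weighted Kirchhoff Laplacian on the ladder graph $\mathcal{G}$ (defined in the context). If $\mu\geq 1$, the discrete spectrum of $\mathcal{A}_s^{\mu}$ is empty. If $0<\mu<1$, let $(\omega_b^2,\omega_t^2)$, with $0\le\omega_b<\omega_t$, be a gap of $\mathcal{A}_s^{\mu}$. Then: (a) if $(\omega_b^2,\omega_t^2)$ is a gap of type (i), $\mathcal{A}_s^\mu$ has exactly two simple eigenvalues $\lambda_1=\omega_1^2$ and $\lambda_2=\omega_2^2$ that satisfy $\omega_b<\omega_1<\omega_2<\omega_t$; (b) if $(\omega_b^2,\omega_t^2)$ is a gap of type (ii) or (iii), $\mathcal{A}_s^\mu$ has exactly one simple eigenvalue $\lambda_1=\omega_1^2$ such that $\omega_b<\omega_1<\omega_t$.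
   Context: Graph. Let $L>0$. $\mathcal{G}\subset\mathbb{R}^2$ is the infinite ladder graph with vertices $M_j^{\pm}=(j,\pm L/2)$, $j\in\mathbb{Z}$ (set of vertices $\mathcal{M}$), vertical edges $e_j=\{j\}\times(-L/2,L/2)$ and horizontal edges $e_{j+1/2}^{\pm}=(j,j+1)\times\{\pm L/2\}$, $j\in\mathbb{Z}$ (set of edges $\mathcal{E}$). $\mathcal{E}(M)$ is the set of edges having $M$ as an endpoint. For $\mu>0$ the weight $w^\mu:\mathcal{E}\to\mathbb{R}^+$ is $w^\mu(e_0)=\mu$ and $w^\mu(e)=1$ for $e\neq e_0$. Operators. $L_2^\mu(\mathcal{G})$ is the space of functions $u$ with $u\in L_2(e)$ for all $e\in\mathcal{E}$ and $\|u\|^2=\sum_{e}w^\mu(e)\|u\|^2_{L_2(e)}<\infty$. $H^2(\mathcal{G})$ is the space of $u\in L_2^\mu(\mathcal{G})$ continuous on $\mathcal{G}$ with $u\in H^2(e)$ for all $e$ and $\sum_e\|u\|^2_{H^2(e)}<\infty$. Writing $u_e=u|_e$, the self-adjoint operator $\mathcal{A}^\mu$ on $L_2^\mu(\mathcal{G})$ is $(\mathcal{A}^\mu u)_e=-u_e''$ for all $e\in\mathcal{E}$, with domain $\{u\in H^2(\mathcal{G}) : \sum_{e\in\mathcal{E}(M)}w^\mu(e)u_e'(M)=0\ \forall M\in\mathcal{M}\}$, where $u_e'(M)$ is the derivative at $M$ in the outgoing direction. $\mathcal{A}_s^\mu$ is the restriction of $\mathcal{A}^\mu$ to the invariant subspace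 of functions with $u(x,y)=u(x,-y)$. $\mathcal{A}_s:=\mathcal{A}_s^1$. Gaps. A gap of $\mathcal{A}_s^\mu$ is a maximal open interval of $(0,\infty)$ not intersecting its essential spectrum. The discrete spectrum consists of the isolated eigenvalues of finite multiplicity. Types of gaps. Let $\phi_L(\omega)=2/\tan(\omega L/2)$, and let $f^+,f^-$ be the $\pi$-periodic functions given for $\omega\in(0,\pi)$ by $f^+(\omega)=\tan(\omega/2)$, $f^-(\omega)=-1/\tan(\omega/2)$. A gap $(\omega_b^2,\omega_t^2)$ such that $[\omega_b,\omega_t]\cap\frac{2\pi}{L}\mathbb{Z}=\emptyset$ is said to be of type (i) if there is $n\in\mathbb{Z}$ with $\pi n<\omega_b<\omega_t<\pi(n+1)$, $\phi_L(\omega_b)=f^+(\omega_b)$ and $\phi_L(\omega_t)=f^-(\omega_t)$; type (ii) if there is $n\in\mathbb{Z}$ with $\pi n=\omega_b<\omega_t<\pi(n+1)$, $\phi_L(\omega_b)\leq 0$ and $\phi_L(\omega_t)=f^-(\omega_t)$; type (iii) if there is $n\in\mathbb{Z}$ with $\pi n<\omega_b<\omega_t=\pi(n+1)$, $\phi_L(\omega_b)=f^+(\omega_b)$ and $\phi_L(\omega_t)\geq 0$. *)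

theory Defs
  imports "HOL-Analysis.Analysis" "HOL-Library.Function_Algebras"
begin

section \<open>Sobolev functions on an interval\<close>

text \<open>Membership in \<open>L\<^sub>2(0,l)\<close>, for a function representing its class modulo null sets.\<close>

definition L2_fun :: "real \<Rightarrow> (real \<Rightarrow> complex) \<Rightarrow> bool" where
  "L2_fun l g \<longleftrightarrow> g \<in> borel_measurable (lebesgue_on {0<..<l})
     \<and> integrable (lebesgue_on {0<..<l}) (\<lambda>t. (norm (g t))\<^sup>2)"

definition L2_sqnorm :: "real \<Rightarrow> (real \<Rightarrow> complex) \<Rightarrow> real" where
  "L2_sqnorm l g = (\<integral>t. (norm (g t))\<^sup>2 \<partial>lebesgue_on {0<..<l})"

definition test_fun :: "real \<Rightarrow> (real \<Rightarrow> real) \<Rightarrow> bool" where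
  "test_fun l \<phi> \<longleftrightarrow> \<phi> C1_differentiable_on UNIV
     \<and> (\<exists>K. compact K \<and> K \<subseteq> {0<..<l} \<and> (\<forall>t. t \<notin> K \<longrightarrow> \<phi> t = 0))"

text \<open>\<open>h\<close> is the weak (distributional) derivative of \<open>g\<close> on \<open>(0,l)\<close>. It is only used for
  \<open>g\<close> and \<open>h\<close> in \<open>L\<^sub>2(0,l)\<close>, so that both integrals below exist.\<close>

definition weak_deriv :: "real \<Rightarrow> (real \<Rightarrow> complex) \<Rightarrow> (real \<Rightarrow> complex) \<Rightarrow> bool" where
  "weak_deriv l g h \<longleftrightarrow> (\<forall>\<phi>. test_fun l \<phi> \<longrightarrow>
     (\<integral>t. deriv \<phi> t *\<^sub>R g t \<partial>lebesgue_on {0<..<l}) = - (\<integral>t. \<phi> t *\<^sub>R h t \<partial>lebesgue_on {0<..<l}))"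

text \<open>\<open>g \<in> H\<^sup>2(0,l)\<close> with first and second weak derivatives \<open>g1\<close> and \<open>g2\<close>.\<close>

definition H2_derivs ::
  "real \<Rightarrow> (real \<Rightarrow> complex) \<Rightarrow> (real \<Rightarrow> complex) \<Rightarrow> (real \<Rightarrow> complex) \<Rightarrow> bool" where
  "H2_derivs l g g1 g2 \<longleftrightarrow> L2_fun l g \<and> L2_fun l g1 \<and> L2_fun l g2
     \<and> weak_deriv l g g1 \<and> weak_deriv l g1 g2"


section \<open>The ladder graph\<close>

datatype side = Lower | Upper

fun height :: "real \<Rightarrow> side \<Rightarrow> real" where
  "height L Lower = - L / 2"
| "height L Upper = L / 2"

text \<open>\<open>Rung j\<close> is the vertical edge at abscissa \<open>j\<close>; \<open>Rail j s\<close> is the horizontal edge over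
  \<open>(j, j + 1)\<close> on the side \<open>s\<close>. The map \<open>edge_pt L e\<close> parametrises the closed edge by
  arc length over \<open>[0, edge_len L e]\<close>.\<close>

datatype edge = Rung int | Rail int side

fun edge_len :: "real \<Rightarrow> edge \<Rightarrow> real" where
  "edge_len L (Rung j) = L"
| "edge_len L (Rail j s) = 1"

fun edge_pt :: "real \<Rightarrow> edge \<Rightarrow> real \<Rightarrow> real \<times> real" where
  "edge_pt L (Rung j) t = (of_int j, t - L / 2)"
| "edge_pt L (Rail j s) t = (of_int j + t, height L s)"

definition ladder :: "real \<Rightarrow> (real \<times> real) set" where
  "ladder L = (\<Union>e. edge_pt L e ` {0..edge_len L e})"

definition vertices :: "real \<Rightarrow> (real \<times> real) set" where
  "vertices L = {(of_int j, height L s) | j s. True}"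

definition incident_edges :: "real \<Rightarrow> real \<times> real \<Rightarrow> edge set" where
  "incident_edges L M = {e. M = edge_pt L e 0 \<or> M = edge_pt L e (edge_len L e)}"

definition weight :: "real \<Rightarrow> edge \<Rightarrow> real" where
  "weight \<mu> e = (if e = Rung 0 then \<mu> else 1)"

definition restr :: "real \<Rightarrow> (real \<times> real \<Rightarrow> complex) \<Rightarrow> edge \<Rightarrow> real \<Rightarrow> complex" where
  "restr L u e = u \<circ> edge_pt L e"

definition outgoing_deriv ::
  "real \<Rightarrow> (real \<times> real \<Rightarrow> complex) \<Rightarrow> edge \<Rightarrow> real \<times> real \<Rightarrow> complex" where
  "outgoing_deriv L u e M =
     (if M = edge_pt L e 0
      then vector_derivative (restr L u e) (at 0 within {0..edge_len L e})
      else - vector_derivative (restr L u e) (at (edge_len L e) within {0..edge_len L e}))"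


section \<open>Function spaces and the weighted Kirchhoff Laplacian\<close>

text \<open>A function on the graph is a function on the plane that is 0 off the graph.
  Elements of the \<open>L\<^sub>2\<close> spaces are represented by functions, not by classes modulo null sets.\<close>

definition L2_space :: "real \<Rightarrow> real \<Rightarrow> (real \<times> real \<Rightarrow> complex) set" where
  "L2_space L \<mu> = {u. (\<forall>p. p \<notin> ladder L \<longrightarrow> u p = 0)
     \<and> (\<forall>e. L2_fun (edge_len L e) (restr L u e))
     \<and> (\<lambda>e. weight \<mu> e * L2_sqnorm (edge_len L e) (restr L u e)) summable_on UNIV}"

definition L2_norm :: "real \<Rightarrow> real \<Rightarrow> (real \<times> real \<Rightarrow> complex) \<Rightarrow> real" where
  "L2_norm L \<mu> u = sqrt (\<Sum>\<^sub>\<infinity>e. weight \<mu> e * L2_sqnorm (edge_len L e) (restr L u e))"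

definition H2_space :: "real \<Rightarrow> real \<Rightarrow> (real \<times> real \<Rightarrow> complex) set" where
  "H2_space L \<mu> = {u \<in> L2_space L \<mu>. continuous_on (ladder L) u
     \<and> (\<exists>u1 u2. (\<forall>e. H2_derivs (edge_len L e) (restr L u e) (u1 e) (u2 e))
          \<and> (\<lambda>e. L2_sqnorm (edge_len L e) (restr L u e) + L2_sqnorm (edge_len L e) (u1 e)
                 + L2_sqnorm (edge_len L e) (u2 e)) summable_on UNIV)}"

definition ladder_domain :: "real \<Rightarrow> real \<Rightarrow> (real \<times> real \<Rightarrow> complex) set" where
  "ladder_domain L \<mu> = {u \<in> H2_space L \<mu>. \<forall>M \<in> vertices L.
     (\<Sum>e \<in> incident_edges L M. complex_of_real (weight \<mu> e) * outgoing_deriv L u e M) = 0}"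

text \<open>The operator as the set of pairs \<open>(u, f)\<close> with \<open>u\<close> in the domain and \<open>f\<close> any representative
  of the image of \<open>u\<close>, i.e.\ \<open>- f\<close> is the second weak derivative of \<open>u\<close> on every edge. The
  component \<open>u\<close> is a genuine function (the continuous representative), while \<open>f\<close> is
  determined by \<open>u\<close> only up to null sets.\<close>

definition ladder_op ::
  "real \<Rightarrow> real \<Rightarrow> ((real \<times> real \<Rightarrow> complex) \<times> (real \<times> real \<Rightarrow> complex)) set" where
  "ladder_op L \<mu> = {(u, f). u \<in> ladder_domain L \<mu> \<and> f \<in> L2_space L \<mu>
     \<and> (\<forall>e. \<exists>v. H2_derivs (edge_len L e) (restr L u e) v (\<lambda>t. - restr L f e t))}"

definition L2_sym :: "real \<Rightarrow> real \<Rightarrow> (real \<times> real \<Rightarrow> complex) set" where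
  "L2_sym L \<mu> = {u \<in> L2_space L \<mu>. \<forall>e. AE t in lebesgue_on {0<..<edge_len L e}.
     (case edge_pt L e t of (x, y) \<Rightarrow> u (x, y) = u (x, - y))}"

definition ladder_op_sym ::
  "real \<Rightarrow> real \<Rightarrow> ((real \<times> real \<Rightarrow> complex) \<times> (real \<times> real \<Rightarrow> complex)) set" where
  "ladder_op_sym L \<mu> = {(u, f) \<in> ladder_op L \<mu>. u \<in> L2_sym L \<mu> \<and> f \<in> L2_sym L \<mu>}"


section \<open>Spectral notions\<close>

text \<open>Here \<open>T\<close> is an operator given by its graph, acting in the space \<open>H\<close> of functions with
  seminorm \<open>N\<close>. The unique solvability below is pointwise uniqueness of the first component,
  which is appropriate for operators whose domain consists of genuine functions. The pair
  \<open>(u, f + z u)\<close> lies in \<open>T\<close> iff \<open>(T - z) u = f\<close>.\<close>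

definition resolvent_set ::
  "('p \<Rightarrow> complex) set \<Rightarrow> (('p \<Rightarrow> complex) \<Rightarrow> real)
     \<Rightarrow> (('p \<Rightarrow> complex) \<times> ('p \<Rightarrow> complex)) set \<Rightarrow> complex set" where
  "resolvent_set H N T = {z.
     (\<forall>f \<in> H. \<exists>!u. (u, \<lambda>p. f p + z * u p) \<in> T)
     \<and> (\<exists>C. \<forall>f \<in> H. \<forall>u. (u, \<lambda>p. f p + z * u p) \<in> T \<longrightarrow> N u \<le> C * N f)}"

definition op_spectrum ::
  "('p \<Rightarrow> complex) set \<Rightarrow> (('p \<Rightarrow> complex) \<Rightarrow> real)
     \<Rightarrow> (('p \<Rightarrow> complex) \<times> ('p \<Rightarrow> complex)) set \<Rightarrow> complex set" where
  "op_spectrum H N T = - resolvent_set H N T"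

interpretation cfun: vector_space "\<lambda>(c::complex) (u :: 'p \<Rightarrow> complex) p. c * u p"
  by unfold_locales (auto simp: fun_eq_iff algebra_simps)

definition eigenspace ::
  "(('p \<Rightarrow> complex) \<times> ('p \<Rightarrow> complex)) set \<Rightarrow> complex \<Rightarrow> ('p \<Rightarrow> complex) set" where
  "eigenspace T z = {u. (u, \<lambda>p. z * u p) \<in> T}"

definition is_eigenvalue ::
  "(('p \<Rightarrow> complex) \<times> ('p \<Rightarrow> complex)) set \<Rightarrow> complex \<Rightarrow> bool" where
  "is_eigenvalue T z \<longleftrightarrow> (\<exists>u \<in> eigenspace T z. u \<noteq> (\<lambda>p. 0))"

definition finite_multiplicity ::
  "(('p \<Rightarrow> complex) \<times> ('p \<Rightarrow> complex)) set \<Rightarrow> complex \<Rightarrow> bool" where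
  "finite_multiplicity T z \<longleftrightarrow> (\<exists>B. finite B \<and> eigenspace T z \<subseteq> cfun.span B)"

definition simple_eigenvalue ::
  "(('p \<Rightarrow> complex) \<times> ('p \<Rightarrow> complex)) set \<Rightarrow> complex \<Rightarrow> bool" where
  "simple_eigenvalue T z \<longleftrightarrow> is_eigenvalue T z \<and> cfun.dim (eigenspace T z) = 1"

definition discrete_spectrum ::
  "('p \<Rightarrow> complex) set \<Rightarrow> (('p \<Rightarrow> complex) \<Rightarrow> real)
     \<Rightarrow> (('p \<Rightarrow> complex) \<times> ('p \<Rightarrow> complex)) set \<Rightarrow> complex set" where
  "discrete_spectrum H N T = {z. z isolated_in op_spectrum H N T
     \<and> is_eigenvalue T z \<and> finite_multiplicity T z}"

text \<open>For self-adjoint operators the essential spectrum is the complement of the discrete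
  spectrum in the spectrum.\<close>

definition essential_spectrum ::
  "('p \<Rightarrow> complex) set \<Rightarrow> (('p \<Rightarrow> complex) \<Rightarrow> real)
     \<Rightarrow> (('p \<Rightarrow> complex) \<times> ('p \<Rightarrow> complex)) set \<Rightarrow> complex set" where
  "essential_spectrum H N T = op_spectrum H N T - discrete_spectrum H N T"

definition disc_spec_sym :: "real \<Rightarrow> real \<Rightarrow> complex set" where
  "disc_spec_sym L \<mu> = discrete_spectrum (L2_sym L \<mu>) (L2_norm L \<mu>) (ladder_op_sym L \<mu>)"

definition ess_spec_sym :: "real \<Rightarrow> real \<Rightarrow> complex set" where
  "ess_spec_sym L \<mu> = essential_spectrum (L2_sym L \<mu>) (L2_norm L \<mu>) (ladder_op_sym L \<mu>)"

definition spec_free_interval :: "complex set \<Rightarrow> real set \<Rightarrow> bool" where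
  "spec_free_interval S I \<longleftrightarrow> open I \<and> is_interval I \<and> I \<noteq> {} \<and> I \<subseteq> {0<..}
     \<and> complex_of_real ` I \<inter> S = {}"

definition is_gap :: "real \<Rightarrow> real \<Rightarrow> real set \<Rightarrow> bool" where
  "is_gap L \<mu> I \<longleftrightarrow> spec_free_interval (ess_spec_sym L \<mu>) I
     \<and> (\<forall>J. spec_free_interval (ess_spec_sym L \<mu>) J \<and> I \<subseteq> J \<longrightarrow> J = I)"


section \<open>Types of gaps\<close>

text \<open>At a pole of \<open>tan\<close>, HOL has \<open>tan = 0\<close> and hence \<open>phi L \<omega> = 0\<close>, which is the
  correct value of \<open>2 cot (\<omega> L / 2)\<close>. The poles of \<open>phi L\<close> itself are excluded by
  \<open>avoids_poles\<close>.\<close>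

definition phi :: "real \<Rightarrow> real \<Rightarrow> real" where
  "phi L \<omega> = 2 / tan (\<omega> * L / 2)"

text \<open>The argument is shifted into \<open>[0, pi)\<close> by a multiple of \<open>pi\<close>. The types of
  gaps below only evaluate these functions off the multiples of \<open>pi\<close>.\<close>

definition f_plus :: "real \<Rightarrow> real" where
  "f_plus \<omega> = tan ((\<omega> - pi * of_int \<lfloor>\<omega> / pi\<rfloor>) / 2)"

definition f_minus :: "real \<Rightarrow> real" where
  "f_minus \<omega> = - 1 / tan ((\<omega> - pi * of_int \<lfloor>\<omega> / pi\<rfloor>) / 2)"

definition avoids_poles :: "real \<Rightarrow> real \<Rightarrow> real \<Rightarrow> bool" where
  "avoids_poles L a b \<longleftrightarrow> {a..b} \<inter> {2 * pi / L * of_int k | k. True} = {}"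

definition gap_type_i :: "real \<Rightarrow> real \<Rightarrow> real \<Rightarrow> bool" where
  "gap_type_i L a b \<longleftrightarrow> avoids_poles L a b
     \<and> (\<exists>n::int. pi * n < a \<and> a < b \<and> b < pi * (n + 1)
          \<and> phi L a = f_plus a \<and> phi L b = f_minus b)"

definition gap_type_ii :: "real \<Rightarrow> real \<Rightarrow> real \<Rightarrow> bool" where
  "gap_type_ii L a b \<longleftrightarrow> avoids_poles L a b
     \<and> (\<exists>n::int. pi * n = a \<and> a < b \<and> b < pi * (n + 1)
          \<and> phi L a \<le> 0 \<and> phi L b = f_minus b)"

definition gap_type_iii :: "real \<Rightarrow> real \<Rightarrow> real \<Rightarrow> bool" where
  "gap_type_iii L a b \<longleftrightarrow> avoids_poles L a b
     \<and> (\<exists>n::int. pi * n < a \<and> a < b \<and> b = pi * (n + 1)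
          \<and> phi L a = f_plus a \<and> phi L b \<ge> 0)"

end

theory Submission
  imports Defs
begin

text \<open>
  On every edge an eigenfunction solves \<open>- u'' = z u\<close>, so it is fixed there by its value and its slope at
  one end. A symmetric eigenfunction is thus three sequences indexed by the abscissa \<open>j\<close>: the common value
  \<open>a j\<close> at the two vertices, and the slopes \<open>b j\<close>, \<open>r j\<close> with which the rail and the rung leave the lower
  vertex. Continuity, the symmetry of the rung and the Kirchhoff condition are linear relations between
  these numbers, and square integrability is square summability. This dictionary is
  \<open>eigenfunction_of_bound_state\<close> and \<open>bound_state_of_eigenfunction\<close>; its analytic content is that
  weak solutions are classical (\<open>weak_solution_is_wave\<close>) and that the \<open>L\<^sub>2\<close> norm on an edge controls value
  and slope (\<open>wave_coefficients_le\<close>).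

  A Green formula excludes energies off \<open>[0,\<infinity>)\<close>, and the energy 0 is immediate. Let \<open>z = \<omega>\<^sup>2\<close> with
  \<open>\<omega> > 0\<close>. If \<open>sin \<omega>\<close> and \<open>cos (\<omega> L / 2)\<close> are both nonzero, eliminating the slopes leaves
  \<open>a (j + 1) + a (j - 1) = G a j\<close> for \<open>j \<noteq> 0\<close>, where \<open>G = 2 cos \<omega> - k\<close> and
  \<open>k = sin \<omega> tan (\<omega> L / 2)\<close>. Decay at both ends forces \<open>a j = \<rho>\<^bsup>|j|\<^esup> a 0\<close> with \<open>\<rho> + 1/\<rho> = G\<close> and
  \<open>|\<rho>| < 1\<close>, and the relation at the perturbed rung becomes \<open>\<rho> - 1/\<rho> = (1 - \<mu>) k\<close>. Because
  \<open>|cos \<omega>| \<le> 1\<close>, the number \<open>\<rho> - 1/\<rho>\<close> always has the strict sign of \<open>k\<close> (\<open>root_difference_sign\<close>), so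
  \<open>\<mu> \<ge> 1\<close> is impossible. If exactly one of \<open>sin \<omega>\<close>, \<open>cos (\<omega> L / 2)\<close> vanishes there is no eigenfunction
  at all, and if both vanish every cell of the ladder carries one, supported on its boundary, so that the
  multiplicity is infinite. Hence the discrete spectrum is empty for \<open>\<mu> \<ge> 1\<close>.

  For \<open>\<mu> < 1\<close> the sign of \<open>\<rho> - 1/\<rho>\<close> is automatic, so the eigenvalue equation may be squared. It turns into
  \<open>\<phi>\<^sup>2 + 2 \<phi> cot \<omega> = c\<close> for \<open>\<phi> = phi L \<omega>\<close> and \<open>c = 1 - (1 - \<mu>)\<^sup>2 \<in> (0,1)\<close>, that is, \<open>\<phi>\<close> meets one of the two
  curves \<open>- cot \<omega> \<plusminus> sqrt (cot\<^sup>2 \<omega> + c)\<close>. For \<open>c = 1\<close> these curves are \<open>f_plus\<close> and \<open>f_minus\<close>, the edges of the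
  essential spectrum. Between consecutive multiples of \<open>pi\<close> both curves increase, and \<open>\<phi>\<close> decreases between its poles, so each
  curve is met at most once in a gap, and the type of the gap decides, through the signs at its ends, which
  curves are met: both for type (i), the lower one for type (ii), the upper one for type (iii).
\<close>

section \<open>The fundamental solutions of \<open>- u'' = z u\<close>\<close>

text \<open>The solutions with Cauchy data \<open>(1, 0)\<close> and \<open>(0, 1)\<close> at 0. They are entire in \<open>z\<close>, being power series
in the square of the root, so that the choice of the branch of \<open>csqrt\<close> is immaterial; the case \<open>z = 0\<close>
of \<open>fsin\<close> is the limit.\<close>

definition fcos :: "complex \<Rightarrow> real \<Rightarrow> complex" where
  "fcos z t = cos (csqrt z * of_real t)"

definition fsin :: "complex \<Rightarrow> real \<Rightarrow> complex" where
  "fsin z t = (if z = 0 then of_real t else sin (csqrt z * of_real t) / csqrt z)"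

definition wave :: "complex \<Rightarrow> complex \<Rightarrow> complex \<Rightarrow> real \<Rightarrow> complex" where
  "wave z A B t = A * fcos z t + B * fsin z t"

lemma csqrt_sq: "csqrt z * csqrt z = z"
  using power2_csqrt[of z] by (simp add: power2_eq_square)

lemma csqrt_div: "z / csqrt z = csqrt z"
  by (metis csqrt_sq nonzero_mult_div_cancel_left div_0 mult_zero_left)

lemma fcos_0 [simp]: "fcos z 0 = 1"
  by (simp add: fcos_def)

lemma fsin_0 [simp]: "fsin z 0 = 0"
  by (simp add: fsin_def)

lemma fcos_minus: "fcos z (- t) = fcos z t"
  by (simp add: fcos_def)

lemma fsin_minus: "fsin z (- t) = - fsin z t"
  by (simp add: fsin_def)

lemma fcos_add: "fcos z (s + t) = fcos z s * fcos z t - z * fsin z s * fsin z t"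
proof (cases "z = 0")
  case False
  then have "csqrt z \<noteq> 0" by simp
  then show ?thesis using False csqrt_sq[of z]
    by (simp add: fcos_def fsin_def distrib_left cos_add field_simps)
qed (simp add: fcos_def fsin_def)

lemma fsin_add: "fsin z (s + t) = fsin z s * fcos z t + fcos z s * fsin z t"
  by (cases "z = 0") (simp_all add: fcos_def fsin_def distrib_left sin_add add_divide_distrib)

lemma fcos_fsin_square: "fcos z t * fcos z t + z * (fsin z t * fsin z t) = 1"
  using fcos_add[of z t "- t"] by (simp add: fcos_minus fsin_minus mult.assoc)

lemma fsin_diff: "fsin z (s - t) = fsin z s * fcos z t - fcos z s * fsin z t"
  using fsin_add[of z s "- t"] by (simp add: fcos_minus fsin_minus)

lemma fcos_deriv: "(fcos z has_vector_derivative - (z * fsin z t)) (at t within S)"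
proof (cases "z = 0")
  case True
  then have "fcos z = (\<lambda>t. 1)" by (auto simp: fcos_def)
  then show ?thesis using True by simp
next
  case False
  have *: "((\<lambda>w. cos (csqrt z * w)) has_field_derivative - (csqrt z * sin (csqrt z * of_real t)))
    (at (of_real t))"
    by (auto intro!: derivative_eq_intros)
  have "(fcos z has_vector_derivative - (csqrt z * sin (csqrt z * of_real t))) (at t within S)"
    using has_vector_derivative_real_field[OF *] by (simp add: fcos_def[abs_def])
  moreover have "z * fsin z t = csqrt z * sin (csqrt z * of_real t)"
    using False csqrt_div[of z] by (simp add: fsin_def) (metis times_divide_eq_left)
  ultimately show ?thesis by simp
qed

lemma fsin_deriv: "(fsin z has_vector_derivative fcos z t) (at t within S)"
proof (cases "z = 0")
  case True
  then have "fsin z = of_real" by (auto simp: fsin_def)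
  moreover have "((of_real :: real \<Rightarrow> complex) has_vector_derivative of_real 1) (at t within S)"
    by (rule has_vector_derivative_of_real[OF DERIV_ident])
  ultimately show ?thesis using True by (simp add: fcos_def)
next
  case False
  have *: "((\<lambda>w. sin (csqrt z * w) / csqrt z) has_field_derivative cos (csqrt z * of_real t))
    (at (of_real t))"
    using False by (auto intro!: derivative_eq_intros)
  show ?thesis
    using has_vector_derivative_real_field[OF *] False by (simp add: fcos_def fsin_def[abs_def])
qed

lemma wave_deriv: "(wave z A B has_vector_derivative wave z B (- (z * A)) t) (at t within S)"
  unfolding wave_def[abs_def]
  by (rule derivative_eq_intros fcos_deriv fsin_deriv refl)+ (simp add: algebra_simps)

lemma continuous_on_wave [continuous_intros]: "continuous_on S (wave z A B)"
  by (rule continuous_on_vector_derivative) (rule wave_deriv)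

lemma wave_0 [simp]: "wave z A B 0 = A"
  by (simp add: wave_def)

lemma wave_zero [simp]: "wave z 0 0 t = 0"
  by (simp add: wave_def)

lemma wave_scale: "wave z (c * A) (c * B) t = c * wave z A B t"
  by (simp add: wave_def algebra_simps)

text \<open>With \<open>C\<close>, \<open>S\<close> the two fundamental solutions, \<open>C g - S g'\<close> and \<open>z S g + C g'\<close> have derivative zero
along any solution \<open>g\<close>. They are therefore the Cauchy data at 0, and \<open>C\<^sup>2 + z S\<^sup>2 = 1\<close> solves for \<open>g\<close>.\<close>

lemma classical_solution_is_wave:
  fixes g g1 :: "real \<Rightarrow> complex"
  assumes g: "\<And>t. t \<in> {0..l} \<Longrightarrow> (g has_vector_derivative g1 t) (at t within {0..l})"
    and g1: "\<And>t. t \<in> {0..l} \<Longrightarrow> (g1 has_vector_derivative - (z * g t)) (at t within {0..l})"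
    and t: "t \<in> {0..l}"
  shows "g t = wave z (g 0) (g1 0) t"
proof -
  have l: "0 \<le> l" using t by simp
  define p where "p s = g s * fcos z s - g1 s * fsin z s" for s
  define q where "q s = z * (g s * fsin z s) + g1 s * fcos z s" for s
  have "(p has_vector_derivative 0) (at s within {0..l})" if "s \<in> {0..l}" for s
    unfolding p_def[abs_def]
    by (rule derivative_eq_intros g g1 that fcos_deriv fsin_deriv refl)+ (simp add: algebra_simps)
  then obtain c where c: "\<And>s. s \<in> {0..l} \<Longrightarrow> p s = c"
    using has_vector_derivative_zero_constant[of "{0..l}" p] by auto
  have "(q has_vector_derivative 0) (at s within {0..l})" if "s \<in> {0..l}" for s
    unfolding q_def[abs_def]
    by (rule derivative_eq_intros g g1 that fcos_deriv fsin_deriv refl)+ (simp add: algebra_simps)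
  then obtain d where d: "\<And>s. s \<in> {0..l} \<Longrightarrow> q s = d"
    using has_vector_derivative_zero_constant[of "{0..l}" q] by auto
  have "p t = g 0" using c[OF t] c[of 0] l by (simp add: p_def)
  moreover have "q t = g1 0" using d[OF t] d[of 0] l by (simp add: q_def)
  moreover have "g t = p t * fcos z t + q t * fsin z t"
  proof -
    have "p t * fcos z t + q t * fsin z t = g t * (fcos z t * fcos z t + z * (fsin z t * fsin z t))"
      by (simp add: p_def q_def algebra_simps)
    then show ?thesis by (simp add: fcos_fsin_square)
  qed
  ultimately show ?thesis by (simp add: wave_def)
qed

section \<open>The function spaces on an edge\<close>

text \<open>Passage from the integral over the open interval, in which the function spaces are phrased, to the
gauge integral over the closed interval, for which the fundamental theorem of calculus is available.\<close>

lemma integral_open_interval_continuous: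
  fixes f :: "real \<Rightarrow> 'b::euclidean_space"
  assumes f: "continuous_on {0..l} f"
  shows "integrable (lebesgue_on {0<..<l}) f"
    and "(\<integral>t. f t \<partial>lebesgue_on {0<..<l}) = integral {0..l} f"
proof -
  have "set_integrable lebesgue {0..l} f"
    using absolutely_integrable_continuous_real[OF f] .
  then have "set_integrable lebesgue {0<..<l} f"
    by (rule set_integrable_subset) auto
  then show i: "integrable (lebesgue_on {0<..<l}) f"
    by (simp add: set_integrable_def integrable_restrict_space)
  show "(\<integral>t. f t \<partial>lebesgue_on {0<..<l}) = integral {0..l} f"
    using lebesgue_integral_eq_integral[OF i] by (simp add: integral_open_interval_real)
qed

lemma continuous_AE_zero:
  fixes f :: "real \<Rightarrow> complex"
  assumes f: "continuous_on {0..l} f" and l: "0 < l"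
    and ae: "AE t in lebesgue_on {0<..<l}. f t = 0" and t: "t \<in> {0..l}"
  shows "f t = 0"
proof -
  have c: "continuous_on {0..l} (\<lambda>t. norm (f t))" by (intro continuous_intros f)
  have "integral {0..l} (\<lambda>t. norm (f t)) = (\<integral>t. norm (f t) \<partial>lebesgue_on {0<..<l})"
    using integral_open_interval_continuous(2)[OF c] by simp
  also have "\<dots> = 0"
    by (rule integral_eq_zero_AE) (use ae in auto)
  finally have "((\<lambda>t. norm (f t)) has_integral 0) (cbox 0 l)"
    using integrable_integral[OF integrable_continuous_real[OF c]] by simp
  then have "norm (f t) = 0"
    using has_integral_0_cbox_imp_0[of 0 l "\<lambda>t. norm (f t)" t] c l t by auto
  then show ?thesis by simp
qed

lemma L2_fun_continuous:
  assumes "continuous_on {0..l} g"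
  shows "L2_fun l g"
proof -
  have "continuous_on {0<..<l} g"
    by (rule continuous_on_subset[OF assms]) auto
  then have "g \<in> borel_measurable (lebesgue_on {0<..<l})"
    by (rule continuous_imp_measurable_on_sets_lebesgue) auto
  moreover have "continuous_on {0..l} (\<lambda>t. (norm (g t))\<^sup>2)"
    by (intro continuous_intros assms)
  ultimately show ?thesis
    using integral_open_interval_continuous(1) by (auto simp: L2_fun_def)
qed

lemma L2_sqnorm_continuous:
  assumes "continuous_on {0..l} g"
  shows "L2_sqnorm l g = integral {0..l} (\<lambda>t. (norm (g t))\<^sup>2)"
  unfolding L2_sqnorm_def
  by (rule integral_open_interval_continuous) (intro continuous_intros assms)

lemma L2_sqnorm_nonneg [simp]: "0 \<le> L2_sqnorm l g"
  by (simp add: L2_sqnorm_def)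

lemma test_fun_facts:
  assumes "test_fun l \<phi>" "0 < l"
  shows "(\<phi> has_vector_derivative deriv \<phi> t) (at t within S)" "continuous_on S (deriv \<phi>)"
    "\<phi> 0 = 0" "\<phi> l = 0"
proof -
  obtain D where D: "\<And>x. (\<phi> has_vector_derivative D x) (at x)" "continuous_on UNIV D"
    using assms(1) by (auto simp: test_fun_def C1_differentiable_on_def)
  have "deriv \<phi> = D"
    using D(1) by (intro ext DERIV_imp_deriv)
      (simp add: has_real_derivative_iff_has_vector_derivative)
  then show "(\<phi> has_vector_derivative deriv \<phi> t) (at t within S)" "continuous_on S (deriv \<phi>)"
    using D by (auto intro: has_vector_derivative_at_within continuous_on_subset)
  show "\<phi> 0 = 0" "\<phi> l = 0"
    using assms(1) by (force simp: test_fun_def)+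
qed

lemma weak_deriv_of_vector_derivative:
  fixes g h :: "real \<Rightarrow> complex"
  assumes g: "\<And>t. t \<in> {0..l} \<Longrightarrow> (g has_vector_derivative h t) (at t within {0..l})"
    and h: "continuous_on {0..l} h" and l: "0 < l"
  shows "weak_deriv l g h"
  unfolding weak_deriv_def
proof (intro allI impI)
  fix \<phi> assume "test_fun l \<phi>"
  note \<phi> = test_fun_facts[OF this l]
  have cg: "continuous_on {0..l} g" by (rule continuous_on_vector_derivative) (rule g)
  have c\<phi>: "continuous_on {0..l} \<phi>" by (rule continuous_on_vector_derivative) (rule \<phi>(1))
  have c1: "continuous_on {0..l} (\<lambda>t. deriv \<phi> t *\<^sub>R g t)"
    and c2: "continuous_on {0..l} (\<lambda>t. \<phi> t *\<^sub>R h t)"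
    by (intro continuous_intros cg c\<phi> h \<phi>(2))+
  have "((\<lambda>t. \<phi> t *\<^sub>R h t + deriv \<phi> t *\<^sub>R g t) has_integral (\<phi> l *\<^sub>R g l - \<phi> 0 *\<^sub>R g 0)) {0..l}"
  proof (rule fundamental_theorem_of_calculus)
    show "((\<lambda>t. \<phi> t *\<^sub>R g t) has_vector_derivative \<phi> t *\<^sub>R h t + deriv \<phi> t *\<^sub>R g t) (at t within {0..l})"
      if "t \<in> {0..l}" for t
      using has_vector_derivative_scaleR[OF \<phi>(1)[THEN has_real_derivative_iff_has_vector_derivative[THEN iffD2]] g[OF that]]
      by simp
  qed (use l in simp)
  then have "integral {0..l} (\<lambda>t. \<phi> t *\<^sub>R h t + deriv \<phi> t *\<^sub>R g t) = 0"
    using \<phi>(3,4) by (simp add: integral_unique)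
  then have "integral {0..l} (\<lambda>t. \<phi> t *\<^sub>R h t) + integral {0..l} (\<lambda>t. deriv \<phi> t *\<^sub>R g t) = 0"
    by (simp add: integral_add integrable_continuous_real c1 c2)
  then show "(\<integral>t. deriv \<phi> t *\<^sub>R g t \<partial>lebesgue_on {0<..<l}) = - (\<integral>t. \<phi> t *\<^sub>R h t \<partial>lebesgue_on {0<..<l})"
    using integral_open_interval_continuous(2)[OF c1] integral_open_interval_continuous(2)[OF c2]
    by (simp add: eq_neg_iff_add_eq_0 add.commute)
qed

lemma H2_derivs_wave:
  assumes g: "\<And>t. t \<in> {0..l} \<Longrightarrow> g t = wave z A B t" and l: "0 < l"
    and h: "\<And>t. t \<in> {0..l} \<Longrightarrow> h t = - (z * g t)"
  shows "H2_derivs l g (wave z B (- (z * A))) h"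
proof -
  have d1: "(g has_vector_derivative wave z B (- (z * A)) t) (at t within {0..l})" if "t \<in> {0..l}" for t
    by (rule has_vector_derivative_transform[OF that _ wave_deriv]) (simp add: g)
  have d2: "(wave z B (- (z * A)) has_vector_derivative h t) (at t within {0..l})" if "t \<in> {0..l}" for t
  proof -
    have "wave z (- (z * A)) (- (z * B)) t = h t"
      using that by (simp add: h g wave_def algebra_simps)
    then show ?thesis using wave_deriv[of z B "- (z * A)" t "{0..l}"] by simp
  qed
  have cg: "continuous_on {0..l} g" by (rule continuous_on_vector_derivative) (rule d1)
  have "continuous_on {0..l} (\<lambda>t. - (z * g t))" by (intro continuous_intros cg)
  then have ch: "continuous_on {0..l} h" by (rule continuous_on_eq) (simp add: h)
  show ?thesis
    unfolding H2_derivs_def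
    using weak_deriv_of_vector_derivative[OF d1 continuous_on_wave l]
      weak_deriv_of_vector_derivative[OF d2 ch l]
      L2_fun_continuous[OF cg] L2_fun_continuous[OF ch] L2_fun_continuous[OF continuous_on_wave]
    by simp
qed

section \<open>Weak solutions are classical\<close>

lemma antiderivative_vanishing_left:
  fixes f :: "real \<Rightarrow> real"
  assumes f: "continuous_on UNIV f" and z: "\<And>t. t \<le> a \<Longrightarrow> f t = 0"
  obtains F where "\<And>t. (F has_real_derivative f t) (at t)" "\<And>t. t \<le> a \<Longrightarrow> F t = 0"
proof (rule that[of "\<lambda>t. integral {a - 1..t} f"])
  show F0: "integral {a - 1..t} f = 0" if "t \<le> a" for t
    using integral_cong[of "{a - 1..t}" f "\<lambda>_. 0"] z that by simp
  show "((\<lambda>t. integral {a - 1..t} f) has_real_derivative f t) (at t)" for t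
  proof (cases "t < a")
    case True
    have "((\<lambda>t. 0) has_real_derivative f t) (at t)"
      using True z[of t] by simp
    then show ?thesis
      by (rule has_field_derivative_transform_within[where d = "a - t"]) (use True F0 in \<open>auto simp: dist_real_def\<close>)
  next
    case False
    have "((\<lambda>t. integral {a - 1..t} f) has_real_derivative f t) (at t within {a - 1..t + 1})"
      by (rule integral_has_real_derivative) (use False f in \<open>auto intro: continuous_on_subset\<close>)
    then show ?thesis
      using False by (simp add: at_within_Icc_at)
  qed
qed

lemma integral_zero_imp_zero_pointwise:
  fixes f :: "real \<Rightarrow> real"
  assumes "continuous_on {a..b} f" "\<And>t. t \<in> {a..b} \<Longrightarrow> 0 \<le> f t" "integral {a..b} f = 0" "a < b"
    "t \<in> {a..b}"
  shows "f t = 0"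
proof (rule has_integral_0_cbox_imp_0[of a b f t])
  show "(f has_integral 0) (cbox a b)"
    using integrable_integral[OF integrable_continuous_real[OF assms(1)]] assms(3) by simp
qed (use assms in auto)

lemma integral_linear_combination:
  fixes f g h :: "real \<Rightarrow> real"
  assumes "continuous_on {a..b} f" "continuous_on {a..b} g" "continuous_on {a..b} h"
  shows "integral {a..b} (\<lambda>t. f t - (\<alpha> * g t + \<beta> * h t)) =
    integral {a..b} f - (\<alpha> * integral {a..b} g + \<beta> * integral {a..b} h)"
proof -
  have i: "(u has_integral integral {a..b} u) {a..b}" if "continuous_on {a..b} u" for u :: "real \<Rightarrow> real"
    using integrable_integral[OF integrable_continuous_real[OF that]] .
  show ?thesis
    by (rule integral_unique)
      (rule has_integral_diff[OF i has_integral_add[OF has_integral_mult_right[OF i] has_integral_mult_right[OF i]]],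
       use assms in auto)
qed

text \<open>The second-order lemma of du Bois-Reymond on a compact subinterval, by means of a single test function
adapted to \<open>D\<close>. Let \<open>p\<close> be the
orthogonal projection of \<open>D\<close> on the affine functions for the weight \<open>q(t) = (t - a)(b - t)\<close>, and integrate
\<open>q (D - p)\<close> twice from \<open>a\<close>. Orthogonality to \<open>1\<close> and \<open>t\<close> makes both primitives vanish beyond \<open>b\<close>, while
the zeros of the weight at \<open>a\<close> and \<open>b\<close> make the second derivative continuous, so the result is an
admissible test function. Testing with it gives \<open>\<integral> q (D - p)\<^sup>2 = 0\<close>.\<close>

lemma locally_affine_of_orthogonal:
  fixes D :: "real \<Rightarrow> real"
  assumes D: "continuous_on {0..l} D"
    and orth: "\<And>\<phi>. test_fun l \<phi> \<Longrightarrow> test_fun l (deriv \<phi>) \<Longrightarrow>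
      integral {0..l} (\<lambda>t. deriv (deriv \<phi>) t * D t) = 0"
    and ab: "0 < a" "a < b" "b < l"
  shows "\<exists>\<alpha> \<beta>. \<forall>t\<in>{a<..<b}. D t = \<alpha> + \<beta> * t"
proof -
  define m where "m = (a + b) / 2"
  define q where "q t = (t - a) * (b - t)" for t
  \<comment> \<open>a continuous extension of \<open>D\<close> to the line, so that the test function is defined everywhere\<close>
  define E where "E t = D (max a (min b t))" for t
  have ED: "E t = D t" if "t \<in> {a..b}" for t using that by (auto simp: E_def max_def min_def)
  have cE: "continuous_on S E" for S
    unfolding E_def
    by (rule continuous_on_compose2[OF D]) (use ab in \<open>auto intro!: continuous_intros\<close>)
  have cq: "continuous_on S q" for S unfolding q_def by (intro continuous_intros)
  have q0: "0 \<le> q t" if "t \<in> {a..b}" for t using that by (simp add: q_def)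
  have int: "f integrable_on {a..b}" if "continuous_on {a..b} f" for f :: "real \<Rightarrow> real"
    using that by (rule integrable_continuous_real)
  note cs = continuous_intros cE cq
  define Q0 where "Q0 = integral {a..b} q"
  define Q2 where "Q2 = integral {a..b} (\<lambda>t. q t * (t - m)\<^sup>2)"
  have Q0: "Q0 \<noteq> 0"
  proof
    assume "Q0 = 0"
    then have "q m = 0" unfolding Q0_def
      by (intro integral_zero_imp_zero_pointwise[of a b q m]) (use ab q0 cq in \<open>auto simp: m_def\<close>)
    moreover have "0 < q m" using ab by (simp add: q_def m_def)
    ultimately show False by simp
  qed
  have Q2: "Q2 \<noteq> 0"
  proof
    define n where "n = (3 * a + b) / 4"
    assume "Q2 = 0"
    then have "q n * (n - m)\<^sup>2 = 0" unfolding Q2_def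
      by (intro integral_zero_imp_zero_pointwise[of a b "\<lambda>t. q t * (t - m)\<^sup>2"])
        (use ab q0 in \<open>auto simp: n_def intro!: cs\<close>)
    moreover have "0 < q n" "n \<noteq> m" using ab by (simp_all add: q_def m_def n_def)
    ultimately show False by simp
  qed
  \<comment> \<open>centring at the midpoint makes \<open>1\<close> and \<open>t - m\<close> orthogonal for the weight, so the projection is explicit\<close>
  have Q1: "integral {a..b} (\<lambda>t. q t * (t - m)) = 0"
  proof -
    have "((\<lambda>t. q t * (t - m)) has_integral (- (q b)\<^sup>2 / 4 - - (q a)\<^sup>2 / 4)) {a..b}"
      by (rule fundamental_theorem_of_calculus)
        (use ab in \<open>auto simp: q_def m_def has_real_derivative_iff_has_vector_derivative[symmetric]
          field_simps power2_eq_square intro!: derivative_eq_intros\<close>)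
    then show ?thesis by (simp add: q_def integral_unique)
  qed
  define \<alpha> where "\<alpha> = integral {a..b} (\<lambda>t. q t * E t) / Q0"
  define \<beta> where "\<beta> = integral {a..b} (\<lambda>t. q t * (t - m) * E t) / Q2"
  define p where "p t = \<alpha> + \<beta> * (t - m)" for t
  have cp: "continuous_on S p" for S unfolding p_def by (intro continuous_intros)
  note cs = cs cp
  have o0: "integral {a..b} (\<lambda>t. q t * (E t - p t)) = 0"
  proof -
    have "integral {a..b} (\<lambda>t. q t * (E t - p t)) =
      integral {a..b} (\<lambda>t. q t * E t - (\<alpha> * q t + \<beta> * (q t * (t - m))))"
      by (simp add: p_def algebra_simps)
    also have "\<dots> = integral {a..b} (\<lambda>t. q t * E t) - (\<alpha> * Q0 + \<beta> * 0)"
      unfolding Q0_def Q1[symmetric]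
      by (intro integral_linear_combination cs)
    finally show ?thesis using Q0 by (simp add: \<alpha>_def)
  qed
  have o1: "integral {a..b} (\<lambda>t. q t * (t - m) * (E t - p t)) = 0"
  proof -
    have "integral {a..b} (\<lambda>t. q t * (t - m) * (E t - p t)) =
      integral {a..b} (\<lambda>t. q t * (t - m) * E t - (\<alpha> * (q t * (t - m)) + \<beta> * (q t * (t - m)\<^sup>2)))"
      by (simp add: p_def algebra_simps power2_eq_square)
    also have "\<dots> = integral {a..b} (\<lambda>t. q t * (t - m) * E t) - (\<alpha> * 0 + \<beta> * Q2)"
      unfolding Q2_def Q1[symmetric]
      by (intro integral_linear_combination cs)
    finally show ?thesis using Q2 by (simp add: \<beta>_def)
  qed
  define \<psi> where "\<psi> t = max 0 (q t) * (E t - p t)" for t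
  have qneg: "q t \<le> 0" if "t \<le> a \<or> b \<le> t" for t
    using that ab by (auto simp: q_def mult_nonneg_nonpos mult_nonpos_nonneg)
  have \<psi>0: "\<psi> t = 0" if "t \<le> a \<or> b \<le> t" for t
    using qneg[OF that] by (simp add: \<psi>_def)
  have \<psi>ab: "\<psi> t = q t * (E t - p t)" if "t \<in> {a..b}" for t
    using q0[OF that] by (simp add: \<psi>_def)
  have c\<psi>: "continuous_on S \<psi>" for S unfolding \<psi>_def by (intro cs)
  obtain F where F: "\<And>t. (F has_real_derivative \<psi> t) (at t)" and F0: "\<And>t. t \<le> a \<Longrightarrow> F t = 0"
    by (rule antiderivative_vanishing_left[OF c\<psi>, of a]) (use \<psi>0 in auto)
  have cF: "continuous_on S F" for S
    by (rule DERIV_continuous_on) (rule has_field_derivative_at_within[OF F])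
  obtain G where G: "\<And>t. (G has_real_derivative F t) (at t)" and G0: "\<And>t. t \<le> a \<Longrightarrow> G t = 0"
    by (rule antiderivative_vanishing_left[OF cF, of a]) (use F0 in auto)
  have cG: "continuous_on S G" for S
    by (rule DERIV_continuous_on) (rule has_field_derivative_at_within[OF G])
  have dF: "(F has_vector_derivative \<psi> t) (at t within S)"
    and dG: "(G has_vector_derivative F t) (at t within S)" for t S
    using has_field_derivative_at_within[OF F] has_field_derivative_at_within[OF G]
    by (simp_all add: has_real_derivative_iff_has_vector_derivative)
  have dtF: "((\<lambda>t. G t - (t - m) * F t) has_vector_derivative - ((t - m) * \<psi> t)) (at t within S)" for t S
    unfolding has_real_derivative_iff_has_vector_derivative[symmetric]
  proof (rule has_field_derivative_at_within)
    have "((\<lambda>t. t - m) has_real_derivative 1 - 0) (at t)"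
      by (rule DERIV_diff[OF DERIV_ident DERIV_const])
    from DERIV_diff[OF G DERIV_mult[OF this F]]
    show "((\<lambda>t. G t - (t - m) * F t) has_real_derivative - ((t - m) * \<psi> t)) (at t)"
      by (simp add: mult.commute)
  qed
  have ic: "integral {a..b} \<psi> = 0"
    using o0 integral_cong[of "{a..b}" \<psi>, OF \<psi>ab] by simp
  have ic': "integral {a..b} (\<lambda>t. (t - m) * \<psi> t) = 0"
  proof -
    have "integral {a..b} (\<lambda>t. (t - m) * \<psi> t) = integral {a..b} (\<lambda>t. q t * (t - m) * (E t - p t))"
      by (rule integral_cong) (simp add: \<psi>ab)
    then show ?thesis using o1 by simp
  qed
  have "(\<psi> has_integral F b - F a) {a..b}"
    by (rule fundamental_theorem_of_calculus) (use ab dF in auto)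
  then have Fb: "F b = 0" using ic F0[of a] by (simp add: integral_unique)
  have "((\<lambda>t. - ((t - m) * \<psi> t)) has_integral (G b - (b - m) * F b) - (G a - (a - m) * F a)) {a..b}"
    by (rule fundamental_theorem_of_calculus) (use ab dtF in auto)
  from integral_unique[OF this] have Gb: "G b = 0" using ic' F0[of a] G0[of a] Fb by simp
  have F1: "F t = 0" if "b \<le> t" for t
  proof -
    have "\<exists>c. \<forall>x\<in>{b..}. F x = c"
    proof (rule has_field_derivative_zero_constant)
      show "(F has_real_derivative 0) (at x within {b..})" if "x \<in> {b..}" for x
        using has_field_derivative_at_within[OF F, of x "{b..}"] \<psi>0[of x] that by simp
    qed simp
    then show ?thesis using that Fb by auto
  qed
  have G1: "G t = 0" if "b \<le> t" for t
  proof -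
    have "\<exists>c. \<forall>x\<in>{b..}. G x = c"
    proof (rule has_field_derivative_zero_constant)
      show "(G has_real_derivative 0) (at x within {b..})" if "x \<in> {b..}" for x
        using has_field_derivative_at_within[OF G, of x "{b..}"] F1[of x] that by simp
    qed simp
    then show ?thesis using that Gb by auto
  qed
  have deriv: "deriv F = \<psi>" "deriv G = F"
    using F G by (auto intro!: ext DERIV_imp_deriv)
  have supp: "compact {a..b}" "{a..b} \<subseteq> {0<..<l}" using ab by auto
  have "\<exists>K. compact K \<and> K \<subseteq> {0<..<l} \<and> (\<forall>t. t \<notin> K \<longrightarrow> G t = 0)"
    "\<exists>K. compact K \<and> K \<subseteq> {0<..<l} \<and> (\<forall>t. t \<notin> K \<longrightarrow> F t = 0)"
    using F0 F1 G0 G1 by (intro exI[of _ "{a..b}"] conjI supp allI impI; force)+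
  moreover have "G C1_differentiable_on UNIV" "F C1_differentiable_on UNIV"
    unfolding C1_differentiable_on_def using dF dG cF c\<psi> by blast+
  ultimately have "test_fun l G" "test_fun l (deriv G)"
    unfolding deriv test_fun_def by blast+
  from orth[OF this] have "integral {0..l} (\<lambda>t. \<psi> t * D t) = 0"
    by (simp add: deriv)
  moreover have "integral {0..l} (\<lambda>t. \<psi> t * D t) = integral {a..b} (\<lambda>t. \<psi> t * E t)"
  proof -
    have "((\<lambda>t. \<psi> t * E t) has_integral integral {a..b} (\<lambda>t. \<psi> t * E t)) {a..b}"
      by (intro integrable_integral int continuous_intros c\<psi> cE)
    then have "((\<lambda>t. \<psi> t * D t) has_integral integral {a..b} (\<lambda>t. \<psi> t * E t)) {a..b}"
      by (rule has_integral_eq[rotated]) (simp add: ED)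
    then have "((\<lambda>t. \<psi> t * D t) has_integral integral {a..b} (\<lambda>t. \<psi> t * E t)) {0..l}"
      by (rule has_integral_on_superset) (use ab \<psi>0 in auto)
    then show ?thesis by (rule integral_unique)
  qed
  ultimately have i1: "integral {a..b} (\<lambda>t. \<psi> t * E t) = 0" by simp
  have "integral {a..b} (\<lambda>t. q t * (E t - p t)\<^sup>2) = integral {a..b} (\<lambda>t. \<psi> t * E t - (\<alpha> * \<psi> t + \<beta> * ((t - m) * \<psi> t)))"
    by (rule integral_cong) (simp add: \<psi>ab p_def algebra_simps power2_eq_square)
  also have "\<dots> = integral {a..b} (\<lambda>t. \<psi> t * E t) - (\<alpha> * integral {a..b} \<psi> + \<beta> * integral {a..b} (\<lambda>t. (t - m) * \<psi> t))"
    by (intro integral_linear_combination continuous_intros c\<psi> cE)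
  finally have z: "integral {a..b} (\<lambda>t. q t * (E t - p t)\<^sup>2) = 0" using i1 ic ic' by simp
  have "D t = (\<alpha> - \<beta> * m) + \<beta> * t" if t: "t \<in> {a<..<b}" for t
  proof -
    have "q t * (E t - p t)\<^sup>2 = 0"
      by (rule integral_zero_imp_zero_pointwise[OF _ _ z]) (use ab t q0 in \<open>auto intro!: cs\<close>)
    moreover have "0 < q t" using t by (simp add: q_def)
    ultimately have "E t = p t" by simp
    then show ?thesis using t ED[of t] by (simp add: p_def algebra_simps)
  qed
  then show ?thesis by blast
qed

text \<open>The local statement gives the three-point identity for \<open>\<epsilon> < t < l - \<epsilon>\<close>. It survives \<open>\<epsilon> \<rightarrow> 0\<close> by continuity,
which reaches the end points that no test function sees.\<close>

lemma affine_of_orthogonal: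
  fixes D :: "real \<Rightarrow> real"
  assumes D: "continuous_on {0..l} D"
    and orth: "\<And>\<phi>. test_fun l \<phi> \<Longrightarrow> test_fun l (deriv \<phi>) \<Longrightarrow>
      integral {0..l} (\<lambda>t. deriv (deriv \<phi>) t * D t) = 0"
    and t: "0 < t" "t < l"
  shows "D t * l = D 0 * (l - t) + D l * t"
proof -
  define \<delta> where "\<delta> = min t (l - t)"
  have \<delta>: "0 < \<delta>" "\<delta> \<le> t" "\<delta> \<le> l - t" using t by (auto simp: \<delta>_def)
  define h where "h \<epsilon> = D t * (l - 2 * \<epsilon>) - D \<epsilon> * (l - \<epsilon> - t) - D (l - \<epsilon>) * (t - \<epsilon>)" for \<epsilon>
  have "h \<epsilon> = 0" if e: "\<epsilon> \<in> {0<..<\<delta>}" for \<epsilon>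
  proof -
    obtain \<alpha> \<beta> where "\<forall>t\<in>{\<epsilon>/2<..<l - \<epsilon>/2}. D t = \<alpha> + \<beta> * t"
      using locally_affine_of_orthogonal[OF D orth, of "\<epsilon>/2" "l - \<epsilon>/2"] e \<delta> by auto
    then have aff: "D t = \<alpha> + \<beta> * t" "D \<epsilon> = \<alpha> + \<beta> * \<epsilon>" "D (l - \<epsilon>) = \<alpha> + \<beta> * (l - \<epsilon>)"
      using e \<delta> by auto
    show ?thesis unfolding h_def aff by (simp add: algebra_simps)
  qed
  moreover have "continuous_on {0..\<delta>} h"
    unfolding h_def
    by (intro continuous_intros continuous_on_subset[OF D] continuous_on_compose2[OF D])
      (use \<delta> t in auto)
  ultimately have "h 0 = 0"
    using continuous_constant_on_closure[of "{0<..<\<delta>}" h 0 0] \<delta> by simp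
  then show ?thesis by (simp add: h_def)
qed

text \<open>Let \<open>W\<close> be the second primitive of \<open>- z g\<close>. Both \<open>g\<close> and \<open>W\<close> have \<open>- z g\<close> as second weak derivative, so
their difference annihilates second derivatives of test functions and is affine. Hence \<open>g\<close> is twice
continuously differentiable up to the boundary. The intermediate derivative \<open>v\<close> is merely in \<open>L\<^sub>2\<close>; it
is eliminated, which avoids any argument with almost everywhere representatives.\<close>

lemma weak_solution_is_wave:
  fixes g :: "real \<Rightarrow> complex"
  assumes l: "0 < l" and g: "continuous_on {0..l} g" and H: "H2_derivs l g v (\<lambda>t. - (z * g t))"
  shows "\<exists>B. \<forall>t\<in>{0..l}. g t = wave z (g 0) B t"
proof -
  define h where "h t = - (z * g t)" for t
  define W1 where "W1 t = integral {0..t} h" for t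
  define W where "W t = integral {0..t} W1" for t
  have ch: "continuous_on {0..l} h" unfolding h_def by (intro continuous_intros g)
  have dW1: "(W1 has_vector_derivative h t) (at t within {0..l})" if "t \<in> {0..l}" for t
    unfolding W1_def by (rule integral_has_vector_derivative[OF ch that])
  have cW1: "continuous_on {0..l} W1" by (rule continuous_on_vector_derivative) (rule dW1)
  have dW: "(W has_vector_derivative W1 t) (at t within {0..l})" if "t \<in> {0..l}" for t
    unfolding W_def by (rule integral_has_vector_derivative[OF cW1 that])
  have cW: "continuous_on {0..l} W" by (rule continuous_on_vector_derivative) (rule dW)
  have wW: "weak_deriv l W W1" "weak_deriv l W1 h"
    using weak_deriv_of_vector_derivative[OF dW cW1 l] weak_deriv_of_vector_derivative[OF dW1 ch l] by auto
  have wg: "weak_deriv l g v" "weak_deriv l v h" using H by (auto simp: H2_derivs_def h_def[abs_def])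
  define D where "D t = g t - W t" for t
  have cD: "continuous_on {0..l} D" unfolding D_def by (intro continuous_intros g cW)
  have orth: "integral {0..l} (\<lambda>t. deriv (deriv \<phi>) t *\<^sub>R D t) = 0"
    if \<phi>: "test_fun l \<phi>" "test_fun l (deriv \<phi>)" for \<phi>
  proof -
    have c: "continuous_on {0..l} (deriv (deriv \<phi>))" using test_fun_facts[OF \<phi>(2) l] by simp
    have cc: "continuous_on {0..l} (\<lambda>t. deriv (deriv \<phi>) t *\<^sub>R g t)"
      "continuous_on {0..l} (\<lambda>t. deriv (deriv \<phi>) t *\<^sub>R W t)"
      by (intro continuous_intros c g cW)+
    have "(\<integral>t. deriv (deriv \<phi>) t *\<^sub>R g t \<partial>lebesgue_on {0<..<l}) =
      (\<integral>t. deriv (deriv \<phi>) t *\<^sub>R W t \<partial>lebesgue_on {0<..<l})"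
      using wW wg \<phi> by (simp add: weak_deriv_def)
    then have "integral {0..l} (\<lambda>t. deriv (deriv \<phi>) t *\<^sub>R g t) = integral {0..l} (\<lambda>t. deriv (deriv \<phi>) t *\<^sub>R W t)"
      by (simp add: integral_open_interval_continuous(2) cc)
    then show ?thesis
      by (simp add: D_def scaleR_diff_right integral_diff integrable_continuous_real cc)
  qed
  have lin: "D t * of_real l = D 0 * of_real (l - t) + D l * of_real t" if "t \<in> {0..l}" for t
  proof (cases "0 < t \<and> t < l")
    case True
    have c: "continuous_on {0..l} (\<lambda>t. deriv (deriv \<phi>) t *\<^sub>R D t)" if "test_fun l (deriv \<phi>)" for \<phi>
      using test_fun_facts[OF that l] by (intro continuous_intros cD) auto
    have "Re (D t) * l = Re (D 0) * (l - t) + Re (D l) * t"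
    proof (rule affine_of_orthogonal[of l "\<lambda>t. Re (D t)"])
      fix \<phi> assume \<phi>: "test_fun l \<phi>" "test_fun l (deriv \<phi>)"
      show "integral {0..l} (\<lambda>t. deriv (deriv \<phi>) t * Re (D t)) = 0"
        using integral_linear[OF integrable_continuous_real[OF c[OF \<phi>(2)]] bounded_linear_Re] orth[OF \<phi>]
        by (simp add: o_def)
    qed (use True cD in \<open>auto intro!: continuous_intros\<close>)
    moreover have "Im (D t) * l = Im (D 0) * (l - t) + Im (D l) * t"
    proof (rule affine_of_orthogonal[of l "\<lambda>t. Im (D t)"])
      fix \<phi> assume \<phi>: "test_fun l \<phi>" "test_fun l (deriv \<phi>)"
      show "integral {0..l} (\<lambda>t. deriv (deriv \<phi>) t * Im (D t)) = 0"
        using integral_linear[OF integrable_continuous_real[OF c[OF \<phi>(2)]] bounded_linear_Im] orth[OF \<phi>]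
        by (simp add: o_def)
    qed (use True cD in \<open>auto intro!: continuous_intros\<close>)
    ultimately show ?thesis by (simp add: complex_eq_iff)
  qed (use that in auto)
  define \<kappa> where "\<kappa> = (D l - D 0) / of_real l"
  have gW: "g t = W t + (D 0 + of_real t * \<kappa>)" if "t \<in> {0..l}" for t
  proof -
    have "D t = D 0 + of_real t * \<kappa>"
      using lin[OF that] l by (simp add: \<kappa>_def field_simps)
    then show ?thesis by (simp add: D_def algebra_simps)
  qed
  have "g t = wave z (g 0) (W1 0 + \<kappa>) t" if t: "t \<in> {0..l}" for t
  proof (rule classical_solution_is_wave[OF _ _ t])
    fix s assume s: "s \<in> {0..l}"
    have "((\<lambda>s. W s + (D 0 + of_real s * \<kappa>)) has_vector_derivative W1 s + \<kappa>) (at s within {0..l})"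
      using s by (auto intro!: derivative_eq_intros dW)
    then show "(g has_vector_derivative W1 s + \<kappa>) (at s within {0..l})"
      by (rule has_vector_derivative_transform[OF s, rotated]) (rule gW)
    show "((\<lambda>a. W1 a + \<kappa>) has_vector_derivative - (z * g s)) (at s within {0..l})"
      using dW1[OF s] by (auto intro!: derivative_eq_intros simp: h_def)
  qed
  then show ?thesis by blast
qed

section \<open>The square norm of a wave and its coefficients\<close>

lemma fsin_nonzero_somewhere:
  assumes "0 < l"
  shows "\<exists>\<delta>. 0 < \<delta> \<and> \<delta> < l \<and> fsin z \<delta> \<noteq> 0"
proof (rule ccontr)
  assume "\<not> ?thesis"
  then have z: "fsin z \<delta> = 0" if "0 < \<delta>" "\<delta> < l" for \<delta> using that by blast
  have "(fsin z has_vector_derivative fcos z (l / 2)) (at (l / 2))" by (rule fsin_deriv)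
  moreover have "(fsin z has_vector_derivative 0) (at (l / 2))"
    by (rule has_vector_derivative_transform_within_open[of "\<lambda>_. 0" _ _ "{0<..<l}"]) (use z assms in auto)
  ultimately have "fcos z (l / 2) = 0"
    by (rule vector_derivative_unique_at)
  then show False using fcos_fsin_square[of z "l / 2"] z[of "l / 2"] assms by simp
qed

lemma norm_square_sum_le: "(norm (x + y))\<^sup>2 \<le> 2 * ((norm x)\<^sup>2 + (norm y)\<^sup>2)" for x y :: complex
proof -
  have "(norm (x + y))\<^sup>2 \<le> (norm x + norm y)\<^sup>2"
    by (simp add: norm_triangle_ineq power_mono)
  also have "\<dots> \<le> 2 * ((norm x)\<^sup>2 + (norm y)\<^sup>2)"
    using sum_squares_bound[of "norm x" "norm y"] by (simp add: power2_sum)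
  finally show ?thesis .
qed

lemma norm_square_combination_le:
  fixes x y p q :: complex
  assumes "norm x \<le> M" "norm y \<le> M"
  shows "(norm (x * p + y * q))\<^sup>2 \<le> 2 * M\<^sup>2 * ((norm p)\<^sup>2 + (norm q)\<^sup>2)"
proof -
  have "(norm (w * v))\<^sup>2 \<le> M\<^sup>2 * (norm v)\<^sup>2" if "norm w \<le> M" for w v :: complex
    using that by (simp add: norm_mult power_mult_distrib mult_right_mono power_mono)
  from this[OF assms(1), of p] this[OF assms(2), of q] norm_square_sum_le[of "x * p" "y * q"]
  show ?thesis by (simp add: algebra_simps)
qed

lemma fundamental_bound:
  obtains M where "0 < M" "\<And>t. t \<in> {0..l} \<Longrightarrow> norm (fcos z t) \<le> M" "\<And>t. t \<in> {0..l} \<Longrightarrow> norm (fsin z t) \<le> M"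
proof -
  have "compact (fcos z ` {0..l})" "compact (fsin z ` {0..l})"
    by (auto intro!: compact_continuous_image continuous_on_vector_derivative[OF fcos_deriv]
        continuous_on_vector_derivative[OF fsin_deriv])
  then obtain M1 M2 where "\<forall>x\<in>fcos z ` {0..l}. norm x \<le> M1" "\<forall>x\<in>fsin z ` {0..l}. norm x \<le> M2"
    by (meson bounded_iff compact_imp_bounded)
  then show ?thesis
    by (intro that[of "max 1 (max M1 M2)"]) (auto simp: le_max_iff_disj)
qed

lemma L2_sqnorm_cong:
  assumes "\<And>t. t \<in> {0..l} \<Longrightarrow> g t = h t"
  shows "L2_sqnorm l g = L2_sqnorm l h"
  unfolding L2_sqnorm_def
  by (rule Bochner_Integration.integral_cong) (use assms in auto)

lemma L2_sqnorm_wave_le: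
  assumes "0 < l"
  shows "\<exists>K>0. \<forall>A B. L2_sqnorm l (wave z A B) \<le> K * ((norm A)\<^sup>2 + (norm B)\<^sup>2)"
proof -
  obtain M where M: "0 < M" "\<And>t. t \<in> {0..l} \<Longrightarrow> norm (fcos z t) \<le> M" "\<And>t. t \<in> {0..l} \<Longrightarrow> norm (fsin z t) \<le> M"
    using fundamental_bound[of l z] by metis
  have "L2_sqnorm l (wave z A B) \<le> (2 * M\<^sup>2 * l) * ((norm A)\<^sup>2 + (norm B)\<^sup>2)" for A B
  proof -
    have "integral {0..l} (\<lambda>t. (norm (wave z A B t))\<^sup>2) \<le> integral {0..l} (\<lambda>t. 2 * M\<^sup>2 * ((norm A)\<^sup>2 + (norm B)\<^sup>2))"
    proof (rule integral_le)
      show "(\<lambda>t. (norm (wave z A B t))\<^sup>2) integrable_on {0..l}"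
        by (intro integrable_continuous_real continuous_intros)
      show "(norm (wave z A B t))\<^sup>2 \<le> 2 * M\<^sup>2 * ((norm A)\<^sup>2 + (norm B)\<^sup>2)" if "t \<in> {0..l}" for t
        using norm_square_combination_le[OF M(2,3)[OF that], of A B] by (simp add: wave_def mult.commute)
    qed (rule integrable_const_ivl)
    then show ?thesis using assms by (simp add: L2_sqnorm_continuous continuous_on_wave mult_ac)
  qed
  then show ?thesis using M assms by (intro exI[of _ "2 * M\<^sup>2 * l"]) auto
qed

text \<open>A quantitative form of the equivalence of norms on the two-dimensional space of solutions. Value and
slope at 0 are recovered from two nearby values of the wave \<open>u\<close>, since
\<open>S(\<delta>) u(0) = S(s + \<delta>) u(s) - S(s) u(s + \<delta>)\<close> and \<open>S(\<delta>) u'(0) = C(s) u(s + \<delta>) - C(s + \<delta>) u(s)\<close>; the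
squares of these identities are integrated over \<open>s\<close>.\<close>

lemma wave_coefficients_le:
  assumes l: "0 < l"
  shows "\<exists>K>0. \<forall>A B. (norm A)\<^sup>2 + (norm B)\<^sup>2 \<le> K * L2_sqnorm l (wave z A B)"
proof -
  obtain M where M: "0 < M" "\<And>t. t \<in> {0..l} \<Longrightarrow> norm (fcos z t) \<le> M" "\<And>t. t \<in> {0..l} \<Longrightarrow> norm (fsin z t) \<le> M"
    using fundamental_bound[of l z] by metis
  obtain \<delta> where \<delta>: "0 < \<delta>" "\<delta> < l" "fsin z \<delta> \<noteq> 0" using fsin_nonzero_somewhere[OF l] by blast
  define c where "c = (norm (fsin z \<delta>))\<^sup>2 * (l - \<delta>)"
  have c: "0 < c" using \<delta> by (simp add: c_def)
  have "c * ((norm A)\<^sup>2 + (norm B)\<^sup>2) \<le> 8 * M\<^sup>2 * L2_sqnorm l (wave z A B)" for A B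
  proof -
    define u where "u = wave z A B"
    define N where "N = integral {0..l} (\<lambda>t. (norm (u t))\<^sup>2)"
    have cu: "continuous_on S (\<lambda>t. (norm (u t))\<^sup>2)" for S unfolding u_def by (intro continuous_intros)
    have ptw: "(norm (fsin z \<delta>))\<^sup>2 * ((norm A)\<^sup>2 + (norm B)\<^sup>2) \<le> 4 * M\<^sup>2 * ((norm (u s))\<^sup>2 + (norm (u (s + \<delta>)))\<^sup>2)"
      if s: "s \<in> {0..l - \<delta>}" for s
    proof -
      have in1: "s \<in> {0..l}" "s + \<delta> \<in> {0..l}" using s \<delta> by auto
      have S: "fsin z \<delta> = fsin z (s + \<delta>) * fcos z s - fcos z (s + \<delta>) * fsin z s"
        using fsin_diff[of z "s + \<delta>" s] by simp
      have "fsin z \<delta> * A = fsin z (s + \<delta>) * u s + (- fsin z s) * u (s + \<delta>)"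
        unfolding S by (simp add: u_def wave_def algebra_simps)
      then have 1: "(norm (fsin z \<delta> * A))\<^sup>2 \<le> 2 * M\<^sup>2 * ((norm (u s))\<^sup>2 + (norm (u (s + \<delta>)))\<^sup>2)"
        using norm_square_combination_le[of "fsin z (s + \<delta>)" M "- fsin z s" "u s" "u (s + \<delta>)"] M in1 by simp
      have "fsin z \<delta> * B = (- fcos z (s + \<delta>)) * u s + fcos z s * u (s + \<delta>)"
        unfolding S by (simp add: u_def wave_def algebra_simps)
      then have 2: "(norm (fsin z \<delta> * B))\<^sup>2 \<le> 2 * M\<^sup>2 * ((norm (u s))\<^sup>2 + (norm (u (s + \<delta>)))\<^sup>2)"
        using norm_square_combination_le[of "- fcos z (s + \<delta>)" M "fcos z s" "u s" "u (s + \<delta>)"] M in1 by simp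
      from 1 2 show ?thesis by (simp add: norm_mult power_mult_distrib algebra_simps)
    qed
    have i1: "integral {0..l - \<delta>} (\<lambda>s. (norm (u s))\<^sup>2) \<le> N"
      unfolding N_def
      by (rule integral_subset_le) (use \<delta> in \<open>auto intro!: integrable_continuous_real cu\<close>)
    have i2: "integral {0..l - \<delta>} (\<lambda>s. (norm (u (s + \<delta>)))\<^sup>2) \<le> N"
    proof -
      have "integral {0..l - \<delta>} (\<lambda>s. (norm (u (s + \<delta>)))\<^sup>2) = integral {\<delta>..l} (\<lambda>t. (norm (u t))\<^sup>2)"
        using integral_shift_real_ivl[of \<delta> \<delta> l "\<lambda>t. (norm (u t))\<^sup>2"] by simp
      also have "\<dots> \<le> N" unfolding N_def
        by (rule integral_subset_le) (use \<delta> in \<open>auto intro!: integrable_continuous_real cu\<close>)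
      finally show ?thesis .
    qed
    have cu': "continuous_on S (\<lambda>s. (norm (u (s + \<delta>)))\<^sup>2)" for S
      by (rule continuous_on_compose2[OF cu[of UNIV]]) (auto intro: continuous_intros)
    have "c * ((norm A)\<^sup>2 + (norm B)\<^sup>2) = integral {0..l - \<delta>} (\<lambda>s. (norm (fsin z \<delta>))\<^sup>2 * ((norm A)\<^sup>2 + (norm B)\<^sup>2))"
      using \<delta> by (simp add: c_def algebra_simps)
    also have "\<dots> \<le> integral {0..l - \<delta>} (\<lambda>s. 4 * M\<^sup>2 * ((norm (u s))\<^sup>2 + (norm (u (s + \<delta>)))\<^sup>2))"
      by (rule integral_le[OF integrable_const_ivl _ ptw])
        (intro integrable_continuous_real continuous_intros cu cu')
    also have "\<dots> = 4 * M\<^sup>2 * (integral {0..l - \<delta>} (\<lambda>s. (norm (u s))\<^sup>2) + integral {0..l - \<delta>} (\<lambda>s. (norm (u (s + \<delta>)))\<^sup>2))"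
      using integral_add[OF integrable_continuous_real[OF cu] integrable_continuous_real[OF cu'], of 0 "l - \<delta>"] by simp
    also have "\<dots> \<le> 4 * M\<^sup>2 * (N + N)"
      using i1 i2 by (intro mult_left_mono add_mono) auto
    finally show ?thesis by (simp add: N_def u_def L2_sqnorm_continuous continuous_on_wave)
  qed
  then have "(norm A)\<^sup>2 + (norm B)\<^sup>2 \<le> 8 * M\<^sup>2 / c * L2_sqnorm l (wave z A B)" for A B
    using c by (simp add: field_simps)
  then show ?thesis using M c by (intro exI[of _ "8 * M\<^sup>2 / c"]) auto
qed

section \<open>Symmetric solutions on the ladder as bound states of a recurrence\<close>

text \<open>The sequences \<open>a\<close>, \<open>b\<close>, \<open>r\<close> are the values at the vertices and the slopes of rail and rung at the lower
vertex. The relations express, in this order: continuity along the rails, the symmetry of the rung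
(its slope vanishes in the middle), the Kirchhoff condition, and square integrability.\<close>

definition bound_state ::
  "real \<Rightarrow> real \<Rightarrow> complex \<Rightarrow> (int \<Rightarrow> complex) \<Rightarrow> (int \<Rightarrow> complex) \<Rightarrow> (int \<Rightarrow> complex) \<Rightarrow> bool" where
  "bound_state L \<mu> z a b r \<longleftrightarrow>
     (\<forall>j. a (j + 1) = wave z (a j) (b j) 1)
     \<and> (\<forall>j. r j * fcos z (L / 2) = z * a j * fsin z (L / 2))
     \<and> (\<forall>j. complex_of_real (weight \<mu> (Rung j)) * r j + b j = wave z (b (j - 1)) (- (z * a (j - 1))) 1)
     \<and> (\<lambda>j. (norm (a j))\<^sup>2 + (norm (b j))\<^sup>2 + (norm (r j))\<^sup>2) summable_on UNIV"

definition ladder_wave ::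
  "real \<Rightarrow> complex \<Rightarrow> (int \<Rightarrow> complex) \<Rightarrow> (int \<Rightarrow> complex) \<Rightarrow> (int \<Rightarrow> complex) \<Rightarrow> real \<times> real \<Rightarrow> complex" where
  "ladder_wave L z a b r = (\<lambda>(x :: real, y :: real).
     if \<bar>y\<bar> = L / 2 then wave z (a \<lfloor>x\<rfloor>) (b \<lfloor>x\<rfloor>) (x - of_int \<lfloor>x\<rfloor>)
     else if \<bar>y\<bar> < L / 2 \<and> x \<in> \<int> then wave z (a \<lfloor>x\<rfloor>) (r \<lfloor>x\<rfloor>) (y + L / 2)
     else 0)"

fun edge_value :: "(int \<Rightarrow> complex) \<Rightarrow> edge \<Rightarrow> complex" where
  "edge_value a (Rung j) = a j"
| "edge_value a (Rail j s) = a j"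

fun edge_slope :: "(int \<Rightarrow> complex) \<Rightarrow> (int \<Rightarrow> complex) \<Rightarrow> edge \<Rightarrow> complex" where
  "edge_slope b r (Rung j) = r j"
| "edge_slope b r (Rail j s) = b j"

subsection \<open>Geometry\<close>

lemma edge_len_pos: "0 < L \<Longrightarrow> 0 < edge_len L e"
  by (cases e) auto

lemma height_eq_iff: "0 < L \<Longrightarrow> height L s = height L s' \<longleftrightarrow> s = s'"
  by (cases s; cases s') auto

lemma weight_pos: "0 < \<mu> \<Longrightarrow> 0 < weight \<mu> e"
  by (simp add: weight_def)

lemma incident_edges_vertex:
  assumes "0 < L"
  shows "incident_edges L (of_int j, height L s) = {Rung j, Rail j s, Rail (j - 1) s}"
proof (rule set_eqI)
  fix e
  show "e \<in> incident_edges L (of_int j, height L s) \<longleftrightarrow> e \<in> {Rung j, Rail j s, Rail (j - 1) s}"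
  proof (cases e)
    case (Rung i)
    have "(of_int j :: real) = of_int i \<longleftrightarrow> i = j" by auto
    moreover have "height L s = - (L / 2) \<or> height L s = L / 2" by (cases s) auto
    ultimately show ?thesis using Rung by (auto simp: incident_edges_def)
  next
    case (Rail i t)
    have "(of_int j :: real) = of_int i + 1 \<longleftrightarrow> i = j - 1"
      by (metis add_diff_cancel_right' diff_add_cancel of_int_1 of_int_add of_int_eq_iff)
    then show ?thesis
      using Rail by (auto simp: incident_edges_def height_eq_iff[OF assms])
  qed
qed

lemma edge_pt_in_ladder: "t \<in> {0..edge_len L e} \<Longrightarrow> edge_pt L e t \<in> ladder L"
  unfolding ladder_def by blast

lemma continuous_on_edge_pt: "continuous_on S (edge_pt L e)"
  by (cases e) (simp_all, (intro continuous_intros)+)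

lemma continuous_on_restr:
  assumes "continuous_on (ladder L) u"
  shows "continuous_on {0..edge_len L e} (restr L u e)"
  unfolding restr_def
  by (rule continuous_on_compose[OF continuous_on_edge_pt], rule continuous_on_subset[OF assms])
    (auto simp: edge_pt_in_ladder)

fun edge_coord :: "real \<Rightarrow> edge \<Rightarrow> real \<times> real \<Rightarrow> real" where
  "edge_coord L (Rung j) p = snd p + L / 2"
| "edge_coord L (Rail j s) p = fst p - of_int j"

lemma edge_coord_edge_pt: "edge_coord L e (edge_pt L e t) = t"
  by (cases e) auto

lemma continuous_on_edge_coord: "continuous_on S (edge_coord L e)"
  by (cases e) (simp_all, (intro continuous_intros)+)

lemma closed_edge: "closed (edge_pt L e ` {0..edge_len L e})"
  by (intro compact_imp_closed compact_continuous_image continuous_on_edge_pt) auto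

text \<open>The closed edges form a locally finite cover of the ladder, so continuity can be checked edge by edge.
Only the five edges listed in \<open>I\<close> meet the vertical strip of half-width 1 about the abscissa
\<open>n = \<lfloor>x\<rfloor>\<close>.\<close>

lemma continuous_on_ladder:
  fixes u :: "real \<times> real \<Rightarrow> complex"
  assumes "\<And>e. continuous_on {0..edge_len L e} (restr L u e)"
  shows "continuous_on (ladder L) u"
proof -
  define E where "E e = edge_pt L e ` {0..edge_len L e}" for e
  have cE: "continuous_on (E e) u" for e
  proof -
    have "continuous_on (E e) (\<lambda>p. restr L u e (edge_coord L e p))"
      by (rule continuous_on_compose2[OF assms continuous_on_edge_coord])
        (auto simp: E_def edge_coord_edge_pt)
    then show ?thesis
      by (rule continuous_on_eq) (auto simp: E_def edge_coord_edge_pt restr_def)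
  qed
  have "continuous (at p within ladder L) u" if p: "p \<in> ladder L" for p
  proof -
    define n where "n = \<lfloor>fst p\<rfloor>"
    define I where "I = {Rung n, Rail n Lower, Rail n Upper, Rail (n - 1) Lower, Rail (n - 1) Upper}"
    define V where "V = {real_of_int n - 1<..<real_of_int n + 1} \<times> (UNIV :: real set)"
    have near: "e \<in> I" if q: "q \<in> E e" "q \<in> V" for q e
    proof (cases e)
      case (Rung j)
      then have "real_of_int n - 1 < of_int j" "real_of_int j < of_int n + 1"
        using q by (auto simp: E_def V_def)
      then have "j = n" by linarith
      then show ?thesis using Rung by (simp add: I_def)
    next
      case (Rail j s)
      then obtain t where t: "0 \<le> t" "t \<le> 1" "real_of_int n - 1 < of_int j + t" "real_of_int j + t < of_int n + 1"
        using q by (auto simp: E_def V_def)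
      then have "j = n \<or> j = n - 1" by linarith
      then show ?thesis using Rail by (cases s) (auto simp: I_def)
    qed
    have LV: "ladder L \<inter> V - {p} = (\<Union>e\<in>I. E e) \<inter> V - {p}"
      using near by (auto simp: ladder_def E_def[symmetric])
    have pV: "p \<in> V" by (cases p) (simp add: V_def n_def, linarith)
    have "open V" unfolding V_def by (intro open_Times) auto
    from at_within_nhd[OF pV this LV]
    have "at p within ladder L = at p within (\<Union>e\<in>I. E e)" .
    moreover have "continuous_on (\<Union>e\<in>I. E e) u"
      by (rule continuous_on_closed_Union[OF _ _ cE]) (simp_all add: I_def closed_edge E_def)
    moreover have "p \<in> (\<Union>e\<in>I. E e)"
    proof -
      obtain e where "p \<in> E e" using p unfolding ladder_def E_def by blast
      then show ?thesis using near pV by blast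
    qed
    ultimately show ?thesis unfolding continuous_on_eq_continuous_within by metis
  qed
  then show ?thesis by (simp add: continuous_on_eq_continuous_within)
qed

subsection \<open>Sums over edges\<close>

lemma summable_on_edges:
  fixes f :: "edge \<Rightarrow> real"
  shows "f summable_on UNIV \<longleftrightarrow> (\<lambda>j. f (Rung j)) summable_on UNIV \<and> (\<forall>s. (\<lambda>j. f (Rail j s)) summable_on UNIV)"
proof -
  have i: "inj Rung" "inj (\<lambda>j. Rail j s)" for s by (auto intro: injI)
  have r: "f summable_on range Rung \<longleftrightarrow> (\<lambda>j. f (Rung j)) summable_on UNIV"
    "f summable_on range (\<lambda>j. Rail j s) \<longleftrightarrow> (\<lambda>j. f (Rail j s)) summable_on UNIV" for s
    using summable_on_reindex[OF i(1), of f] summable_on_reindex[OF i(2), of f s] by (simp_all add: o_def)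
  have U: "(UNIV :: edge set) = range Rung \<union> (range (\<lambda>j. Rail j Lower) \<union> range (\<lambda>j. Rail j Upper))"
  proof -
    have "e \<in> range Rung \<union> (range (\<lambda>j. Rail j Lower) \<union> range (\<lambda>j. Rail j Upper))" for e
    proof (cases e)
      case (Rail j s) then show ?thesis by (cases s) auto
    qed auto
    then show ?thesis by blast
  qed
  show ?thesis
  proof safe
    assume f: "f summable_on UNIV"
    then show "(\<lambda>j. f (Rung j)) summable_on UNIV" and "\<And>s. (\<lambda>j. f (Rail j s)) summable_on UNIV"
      by (auto simp flip: r intro: summable_on_subset)
  next
    assume "(\<lambda>j. f (Rung j)) summable_on UNIV" "\<forall>s. (\<lambda>j. f (Rail j s)) summable_on UNIV"
    then show "f summable_on UNIV"
      unfolding U by (intro summable_on_union) (simp_all add: r)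
  qed
qed

subsection \<open>The symmetric rung\<close>

lemma wave_centred:
  "wave z A B (m + x) = (A * fcos z m + B * fsin z m) * fcos z x + (B * fcos z m - z * A * fsin z m) * fsin z x"
  by (simp add: wave_def fcos_add fsin_add algebra_simps)

text \<open>In coordinates centred at the middle of the rung a wave splits into a multiple of \<open>fcos\<close>, which is even,
and a multiple of \<open>fsin\<close>, which is odd. The condition on the right kills the odd part.\<close>

lemma rung_symmetric_iff:
  assumes L: "0 < L"
  shows "(\<forall>t\<in>{0..L}. wave z A B (L - t) = wave z A B t) \<longleftrightarrow> B * fcos z (L / 2) = z * A * fsin z (L / 2)"
proof -
  let ?o = "B * fcos z (L / 2) - z * A * fsin z (L / 2)"
  have d: "wave z A B (L / 2 + - x) = wave z A B (L / 2 + x) \<longleftrightarrow> ?o * fsin z x = 0" for x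
    unfolding wave_centred by (auto simp: fcos_minus fsin_minus)
  show ?thesis
  proof
    assume sym: "\<forall>t\<in>{0..L}. wave z A B (L - t) = wave z A B t"
    obtain x where x: "0 < x" "x < L / 2" "fsin z x \<noteq> 0"
      using fsin_nonzero_somewhere[of "L / 2" z] L by auto
    have "wave z A B (L - (L / 2 + x)) = wave z A B (L / 2 + x)"
      using x by (intro bspec[OF sym]) auto
    moreover have "L - (L / 2 + x) = L / 2 + - x" by (simp add: field_simps)
    ultimately show "B * fcos z (L / 2) = z * A * fsin z (L / 2)"
      using d[of x] x by simp
  next
    assume "B * fcos z (L / 2) = z * A * fsin z (L / 2)"
    then have "wave z A B (L / 2 + - (t - L / 2)) = wave z A B (L / 2 + (t - L / 2))" for t
      by (subst d) simp
    moreover have "L / 2 + - (t - L / 2) = L - t" "L / 2 + (t - L / 2) = t" for t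
      by (simp_all add: field_simps)
    ultimately show "\<forall>t\<in>{0..L}. wave z A B (L - t) = wave z A B t" by simp
  qed
qed

text \<open>A symmetric rung looks the same from its two ends, so that the conditions at the upper vertices repeat
those at the lower ones.\<close>

lemma rung_end:
  assumes "B * fcos z (L / 2) = z * A * fsin z (L / 2)"
  shows "wave z A B L = A" "wave z B (- (z * A)) L = - B"
proof -
  have o: "B * fcos z (L / 2) - z * A * fsin z (L / 2) = 0" using assms by simp
  let ?e = "A * fcos z (L / 2) + B * fsin z (L / 2)"
  have "wave z A B (L / 2 + x) = ?e * fcos z x" for x
    unfolding wave_centred o by simp
  from this[of "L / 2"] this[of "- (L / 2)"] show "wave z A B L = A"
    by (simp add: fcos_minus)
  have "wave z B (- (z * A)) (L / 2 + x) = - (z * ?e) * fsin z x" for x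
    unfolding wave_centred using o by (simp add: algebra_simps)
  from this[of "L / 2"] this[of "- (L / 2)"] show "wave z B (- (z * A)) L = - B"
    by (simp add: fsin_minus)
qed

subsection \<open>Functions that are waves on every edge\<close>

text \<open>Common ground of the two directions of the dictionary: an eigenfunction is shown to have this form, and
the construction from a bound state has it.\<close>

definition wave_on_edges ::
  "real \<Rightarrow> complex \<Rightarrow> (edge \<Rightarrow> complex) \<Rightarrow> (edge \<Rightarrow> complex) \<Rightarrow> (real \<times> real \<Rightarrow> complex) \<Rightarrow> bool" where
  "wave_on_edges L z A B u \<longleftrightarrow> (\<forall>p. p \<notin> ladder L \<longrightarrow> u p = 0)
     \<and> (\<forall>e. \<forall>t\<in>{0..edge_len L e}. restr L u e t = wave z (A e) (B e) t)"

lemma wave_on_edgesD: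
  assumes "wave_on_edges L z A B u"
  shows "p \<notin> ladder L \<Longrightarrow> u p = 0"
    "t \<in> {0..edge_len L e} \<Longrightarrow> restr L u e t = wave z (A e) (B e) t"
  using assms unfolding wave_on_edges_def by blast+

lemma wave_on_edges_unique:
  assumes u: "wave_on_edges L z A B u" and v: "wave_on_edges L z A B v"
  shows "u = v"
proof
  fix p
  show "u p = v p"
  proof (cases "p \<in> ladder L")
    case True
    then obtain e t where "t \<in> {0..edge_len L e}" "p = edge_pt L e t" by (auto simp: ladder_def)
    then show ?thesis
      using wave_on_edgesD(2)[OF u, of t e] wave_on_edgesD(2)[OF v, of t e] by (simp add: restr_def)
  qed (use wave_on_edgesD(1)[OF u] wave_on_edgesD(1)[OF v] in simp)
qed

lemma wave_on_edges_scale: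
  assumes "wave_on_edges L z A B u"
  shows "wave_on_edges L z (\<lambda>e. c * A e) (\<lambda>e. c * B e) (\<lambda>p. c * u p)"
  using assms by (simp add: wave_on_edges_def restr_def wave_scale)

lemma L2_sqnorm_edges_le:
  assumes "0 < L"
  shows "\<exists>K>0. \<forall>e A B. L2_sqnorm (edge_len L e) (wave z A B) \<le> K * ((norm A)\<^sup>2 + (norm B)\<^sup>2)"
proof -
  obtain K1 K2 where K: "0 < K1" "0 < K2"
    "\<And>A B. L2_sqnorm L (wave z A B) \<le> K1 * ((norm A)\<^sup>2 + (norm B)\<^sup>2)"
    "\<And>A B. L2_sqnorm 1 (wave z A B) \<le> K2 * ((norm A)\<^sup>2 + (norm B)\<^sup>2)"
    using L2_sqnorm_wave_le[OF assms, of z] L2_sqnorm_wave_le[of 1 z] by auto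
  have "L2_sqnorm (edge_len L e) (wave z A B) \<le> max K1 K2 * ((norm A)\<^sup>2 + (norm B)\<^sup>2)" for e A B
  proof (cases e)
    case (Rung j)
    have "K1 * ((norm A)\<^sup>2 + (norm B)\<^sup>2) \<le> max K1 K2 * ((norm A)\<^sup>2 + (norm B)\<^sup>2)"
      by (intro mult_right_mono) auto
    with K(3)[of A B] Rung show ?thesis by simp
  next
    case (Rail j s)
    have "K2 * ((norm A)\<^sup>2 + (norm B)\<^sup>2) \<le> max K1 K2 * ((norm A)\<^sup>2 + (norm B)\<^sup>2)"
      by (intro mult_right_mono) auto
    with K(4)[of A B] Rail show ?thesis by simp
  qed
  with K(1) show ?thesis by (intro exI[of _ "max K1 K2"]) auto
qed

lemma summable_sqnorm_waves:
  assumes L: "0 < L" and s: "(\<lambda>e. (norm (A e))\<^sup>2 + (norm (B e))\<^sup>2) summable_on (UNIV :: edge set)"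
  shows "(\<lambda>e. L2_sqnorm (edge_len L e) (wave z (A e) (B e))) summable_on UNIV"
proof -
  obtain K where "0 < K" "\<And>e A B. L2_sqnorm (edge_len L e) (wave z A B) \<le> K * ((norm A)\<^sup>2 + (norm B)\<^sup>2)"
    using L2_sqnorm_edges_le[OF L, of z] by auto
  then show ?thesis
    by (intro summable_on_comparison_test[OF summable_on_cmult_right[OF s, of K]]) auto
qed

lemma wave_on_edges_L2:
  assumes L: "0 < L" "0 < \<mu>" and u: "wave_on_edges L z A B u"
    and s: "(\<lambda>e. (norm (A e))\<^sup>2 + (norm (B e))\<^sup>2) summable_on UNIV"
  shows "u \<in> L2_space L \<mu>"
proof -
  have n: "L2_sqnorm (edge_len L e) (restr L u e) = L2_sqnorm (edge_len L e) (wave z (A e) (B e))" for e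
    by (rule L2_sqnorm_cong) (rule wave_on_edgesD[OF u])
  have "(\<lambda>e. weight \<mu> e * L2_sqnorm (edge_len L e) (wave z (A e) (B e))) summable_on UNIV"
  proof (rule summable_on_comparison_test)
    show "(\<lambda>e. max 1 \<mu> * L2_sqnorm (edge_len L e) (wave z (A e) (B e))) summable_on UNIV"
      by (intro summable_on_cmult_right summable_sqnorm_waves L s)
    show "weight \<mu> e * L2_sqnorm (edge_len L e) (wave z (A e) (B e))
      \<le> max 1 \<mu> * L2_sqnorm (edge_len L e) (wave z (A e) (B e))" for e
      by (intro mult_right_mono) (auto simp: weight_def)
  qed (use L in \<open>auto simp: weight_def\<close>)
  moreover have "L2_fun (edge_len L e) (restr L u e)" for e
    by (rule L2_fun_continuous, rule continuous_on_eq[OF continuous_on_wave])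
      (simp add: wave_on_edgesD[OF u])
  ultimately show ?thesis
    using wave_on_edgesD(1)[OF u] by (simp add: L2_space_def n)
qed

lemma wave_on_edges_outgoing:
  assumes L: "0 < L" and u: "wave_on_edges L z A B u"
  shows "outgoing_deriv L u e M =
    (if M = edge_pt L e 0 then B e else - wave z (B e) (- (z * A e)) (edge_len L e))"
proof -
  have "vector_derivative (restr L u e) (at t within {0..edge_len L e}) = wave z (B e) (- (z * A e)) t"
    if t: "t \<in> {0..edge_len L e}" for t
  proof (rule vector_derivative_within_closed_interval[OF edge_len_pos[OF L] t])
    show "(restr L u e has_vector_derivative wave z (B e) (- (z * A e)) t) (at t within {0..edge_len L e})"
      by (rule has_vector_derivative_transform[OF t _ wave_deriv]) (rule wave_on_edgesD[OF u])
  qed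
  then show ?thesis
    using edge_len_pos[OF L, of e] by (simp add: outgoing_deriv_def)
qed

lemma wave_on_edges_H2:
  assumes L: "0 < L" "0 < \<mu>" and u: "wave_on_edges L z A B u"
    and s: "(\<lambda>e. (norm (A e))\<^sup>2 + (norm (B e))\<^sup>2) summable_on UNIV"
  shows "u \<in> H2_space L \<mu>"
    "\<exists>v. H2_derivs (edge_len L e) (restr L u e) v (\<lambda>t. - restr L (\<lambda>p. z * u p) e t)"
proof -
  have H: "H2_derivs (edge_len L e) (restr L u e) (wave z (B e) (- (z * A e))) (\<lambda>t. - (z * restr L u e t))" for e
    by (rule H2_derivs_wave[OF wave_on_edgesD(2)[OF u]]) (auto simp: edge_len_pos L)
  then show "\<exists>v. H2_derivs (edge_len L e) (restr L u e) v (\<lambda>t. - restr L (\<lambda>p. z * u p) e t)"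
    by (auto simp: restr_def)
  have "continuous_on {0..edge_len L e} (restr L u e)" for e
    by (rule continuous_on_eq[OF continuous_on_wave]) (simp add: wave_on_edgesD[OF u])
  then have c: "continuous_on (ladder L) u" by (rule continuous_on_ladder)
  have sA: "(\<lambda>e. (norm (A e))\<^sup>2) summable_on UNIV" and sB: "(\<lambda>e. (norm (B e))\<^sup>2) summable_on UNIV"
    by (rule summable_on_comparison_test[OF s]; simp)+
  have sc: "(\<lambda>e. (norm (c * F e))\<^sup>2) summable_on UNIV" if "(\<lambda>e. (norm (F e))\<^sup>2) summable_on UNIV" for c :: complex and F :: "edge \<Rightarrow> complex"
    using summable_on_cmult_right[OF that, of "(norm c)\<^sup>2"] by (simp add: norm_mult power_mult_distrib)
  have "(\<lambda>e. L2_sqnorm (edge_len L e) (wave z (A e) (B e))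
      + L2_sqnorm (edge_len L e) (wave z (B e) (- z * A e))
      + L2_sqnorm (edge_len L e) (wave z (- z * A e) (- z * B e))) summable_on UNIV"
    by (intro summable_on_add summable_sqnorm_waves L sA sB sc)
  moreover have "L2_sqnorm (edge_len L e) (restr L u e) = L2_sqnorm (edge_len L e) (wave z (A e) (B e))"
    "L2_sqnorm (edge_len L e) (\<lambda>t. - (z * restr L u e t)) = L2_sqnorm (edge_len L e) (wave z (- z * A e) (- z * B e))" for e
    by (rule L2_sqnorm_cong; simp add: wave_on_edgesD[OF u] wave_def algebra_simps)+
  ultimately have "(\<lambda>e. L2_sqnorm (edge_len L e) (restr L u e)
      + L2_sqnorm (edge_len L e) (wave z (B e) (- (z * A e)))
      + L2_sqnorm (edge_len L e) (\<lambda>t. - (z * restr L u e t))) summable_on UNIV"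
    by simp
  with H c wave_on_edges_L2[OF L u s] show "u \<in> H2_space L \<mu>"
    unfolding H2_space_def mem_Collect_eq
    by (intro conjI exI[of _ "\<lambda>e. wave z (B e) (- (z * A e))"] exI[of _ "\<lambda>e t. - (z * restr L u e t)"])
      blast+
qed

subsection \<open>Eigenfunctions and bound states\<close>

lemma bound_state_summable:
  assumes "bound_state L \<mu> z a b r"
  shows "(\<lambda>j. (norm (a j))\<^sup>2) summable_on UNIV" "(\<lambda>j. (norm (b j))\<^sup>2) summable_on UNIV"
    "(\<lambda>j. (norm (r j))\<^sup>2) summable_on UNIV"
proof -
  have s: "(\<lambda>j. (norm (a j))\<^sup>2 + (norm (b j))\<^sup>2 + (norm (r j))\<^sup>2) summable_on UNIV"
    using assms by (simp add: bound_state_def)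
  show "(\<lambda>j. (norm (a j))\<^sup>2) summable_on UNIV" "(\<lambda>j. (norm (b j))\<^sup>2) summable_on UNIV"
    "(\<lambda>j. (norm (r j))\<^sup>2) summable_on UNIV"
    by (rule summable_on_comparison_test[OF s]; simp)+
qed

lemma bound_state_summable_edges:
  assumes "bound_state L \<mu> z a b r"
  shows "(\<lambda>e. (norm (edge_value a e))\<^sup>2 + (norm (edge_slope b r e))\<^sup>2) summable_on UNIV"
  using bound_state_summable[OF assms] by (simp add: summable_on_edges summable_on_add)

text \<open>The formula for \<open>ladder_wave\<close> uses \<open>\<lfloor>x\<rfloor>\<close> and prefers the rail at a vertex. It agrees with the wave on each
closed edge because the bound state is continuous along the rails and takes the same value at both ends
of a rung.\<close>

lemma ladder_wave_on_edges:
  assumes L: "0 < L" and bs: "bound_state L \<mu> z a b r"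
  shows "wave_on_edges L z (edge_value a) (edge_slope b r) (ladder_wave L z a b r)"
  unfolding wave_on_edges_def
proof (intro conjI allI impI ballI)
  fix p assume p: "p \<notin> ladder L"
  obtain x y where xy: "p = (x, y)" by (cases p)
  have "\<bar>y\<bar> \<noteq> L / 2"
  proof
    assume "\<bar>y\<bar> = L / 2"
    then obtain s where "y = height L s"
      by (cases "y < 0") (metis abs_if height.simps minus_divide_left minus_equation_iff)+
    then have "p = edge_pt L (Rail \<lfloor>x\<rfloor> s) (x - of_int \<lfloor>x\<rfloor>)" by (simp add: xy)
    moreover have "x - of_int \<lfloor>x\<rfloor> \<in> {0..edge_len L (Rail \<lfloor>x\<rfloor> s)}" by (simp, linarith)
    ultimately show False using p edge_pt_in_ladder by metis
  qed
  moreover have "\<not> (\<bar>y\<bar> < L / 2 \<and> x \<in> \<int>)"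
  proof
    assume *: "\<bar>y\<bar> < L / 2 \<and> x \<in> \<int>"
    then obtain j where "x = of_int j" by (auto elim: Ints_cases)
    then have "p = edge_pt L (Rung j) (y + L / 2)" by (simp add: xy)
    moreover have "y + L / 2 \<in> {0..edge_len L (Rung j)}" using * by (auto simp: abs_less_iff)
    ultimately show False using p edge_pt_in_ladder by metis
  qed
  ultimately show "ladder_wave L z a b r p = 0" unfolding ladder_wave_def xy by auto
next
  fix e t assume t: "t \<in> {0..edge_len L e}"
  show "restr L (ladder_wave L z a b r) e t = wave z (edge_value a e) (edge_slope b r e) t"
  proof (cases e)
    case (Rung j)
    have end_L: "wave z (a j) (r j) L = a j"
      by (rule rung_end(1)) (use bs in \<open>simp add: bound_state_def\<close>)
    consider "t = 0" | "t = L" | "0 < t" "t < L" using t Rung by fastforce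
    then show ?thesis
    proof cases
      case 3
      then have "\<bar>t - L / 2\<bar> < L / 2" unfolding abs_less_iff by linarith
      then show ?thesis using Rung by (simp add: restr_def ladder_wave_def)
    qed (use Rung L end_L in \<open>simp_all add: restr_def ladder_wave_def\<close>)
  next
    case (Rail j s)
    have h: "\<bar>height L s\<bar> = L / 2" using L by (cases s) auto
    show ?thesis
    proof (cases "t = 1")
      case True
      have "a (j + 1) = wave z (a j) (b j) 1" using bs by (simp add: bound_state_def)
      moreover have "\<lfloor>real_of_int j + 1\<rfloor> = j + 1" by linarith
      ultimately show ?thesis using Rail True h by (simp add: restr_def ladder_wave_def)
    next
      case False
      then have "\<lfloor>real_of_int j + t\<rfloor> = j" using t Rail by (simp add: floor_eq_iff)
      then show ?thesis using Rail h by (simp add: restr_def ladder_wave_def)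
    qed
  qed
qed

text \<open>The reflection permutes the edges: it reverses each rung and exchanges the two rails over the same
interval without reversing them.\<close>

lemma edge_reflect:
  assumes "t \<in> {0..edge_len L e}"
  shows "\<exists>e' t'. t' \<in> {0..edge_len L e'} \<and> edge_pt L e' t' = (fst (edge_pt L e t), - snd (edge_pt L e t))
    \<and> (e' = e \<and> t' = L - t \<and> (\<exists>j. e = Rung j) \<or> t' = t \<and> (\<exists>j s s'. e = Rail j s \<and> e' = Rail j s'))"
proof (cases e)
  case (Rung j)
  then show ?thesis using assms by (intro exI[of _ e] exI[of _ "L - t"]) auto
next
  case (Rail j s)
  then show ?thesis using assms
    by (intro exI[of _ "Rail j (case s of Lower \<Rightarrow> Upper | Upper \<Rightarrow> Lower)"] exI[of _ t]) (cases s; auto)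
qed

lemma wave_on_edges_symmetric:
  assumes L: "0 < L" and bs: "bound_state L \<mu> z a b r"
    and u: "wave_on_edges L z (edge_value a) (edge_slope b r) u"
    and t: "t \<in> {0..edge_len L e}"
  shows "case edge_pt L e t of (x, y) \<Rightarrow> u (x, y) = u (x, - y)"
proof -
  obtain e' t' where e': "t' \<in> {0..edge_len L e'}"
    "edge_pt L e' t' = (fst (edge_pt L e t), - snd (edge_pt L e t))"
    "e' = e \<and> t' = L - t \<and> (\<exists>j. e = Rung j) \<or> t' = t \<and> (\<exists>j s s'. e = Rail j s \<and> e' = Rail j s')"
    using edge_reflect[OF t] by blast
  have "wave z (edge_value a e') (edge_slope b r e') t' = wave z (edge_value a e) (edge_slope b r e) t"
    using e'(3)
  proof
    assume *: "e' = e \<and> t' = L - t \<and> (\<exists>j. e = Rung j)"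
    then obtain j where j: "e = Rung j" by blast
    have "r j * fcos z (L / 2) = z * a j * fsin z (L / 2)" using bs by (simp add: bound_state_def)
    then show ?thesis using rung_symmetric_iff[OF L, of z "a j" "r j"] * t j by auto
  qed auto
  then have "restr L u e' t' = restr L u e t"
    using wave_on_edgesD(2)[OF u e'(1)] wave_on_edgesD(2)[OF u t] by simp
  then show ?thesis using e'(2) by (simp add: restr_def case_prod_unfold)
qed

lemma eigenfunction_of_bound_state:
  assumes L: "0 < L" and \<mu>: "0 < \<mu>" and bs: "bound_state L \<mu> z a b r"
  shows "ladder_wave L z a b r \<in> eigenspace (ladder_op_sym L \<mu>) z"
proof -
  define u where "u = ladder_wave L z a b r"
  note s = bound_state_summable_edges[OF bs]
  have u: "wave_on_edges L z (edge_value a) (edge_slope b r) u"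
    unfolding u_def by (rule ladder_wave_on_edges[OF L bs])
  have zs: "wave_on_edges L z (\<lambda>e. z * edge_value a e) (\<lambda>e. z * edge_slope b r e) (\<lambda>p. z * u p)"
    by (rule wave_on_edges_scale[OF u])
  have s': "(\<lambda>e. (norm (z * edge_value a e))\<^sup>2 + (norm (z * edge_slope b r e))\<^sup>2) summable_on UNIV"
    using summable_on_cmult_right[OF s, of "(norm z)\<^sup>2"]
    by (simp add: norm_mult power_mult_distrib distrib_left)
  have L2: "u \<in> L2_space L \<mu>" "(\<lambda>p. z * u p) \<in> L2_space L \<mu>"
    by (rule wave_on_edges_L2[OF L \<mu> u s], rule wave_on_edges_L2[OF L \<mu> zs s'])
  have sym: "case edge_pt L e t of (x, y) \<Rightarrow> u (x, y) = u (x, - y)" if "t \<in> {0..edge_len L e}" for e t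
    by (rule wave_on_edges_symmetric[OF L bs u that])
  have "AE t in lebesgue_on {0<..<edge_len L e}. case edge_pt L e t of (x, y) \<Rightarrow> u (x, y) = u (x, - y)" for e
    by (rule AE_I2) (rule sym, simp)
  then have "u \<in> L2_sym L \<mu>"
    using L2(1) by (simp add: L2_sym_def)
  moreover have "AE t in lebesgue_on {0<..<edge_len L e}. case edge_pt L e t of (x, y) \<Rightarrow> z * u (x, y) = z * u (x, - y)" for e
    by (rule AE_I2) (use sym in \<open>simp add: case_prod_unfold\<close>)
  then have "(\<lambda>p. z * u p) \<in> L2_sym L \<mu>"
    using L2(2) by (simp add: L2_sym_def)
  moreover have "u \<in> ladder_domain L \<mu>"
    unfolding ladder_domain_def mem_Collect_eq
  proof (intro conjI ballI)
    fix M assume "M \<in> vertices L"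
    then obtain j \<sigma> where M: "M = (of_int j, height L \<sigma>)" by (auto simp: vertices_def)
    have rung: "r j * fcos z (L / 2) = z * a j * fsin z (L / 2)"
      and kirchhoff: "complex_of_real (weight \<mu> (Rung j)) * r j + b j = wave z (b (j - 1)) (- (z * a (j - 1))) 1"
      using bs by (simp_all add: bound_state_def)
    have out: "outgoing_deriv L u (Rung j) M = r j" "outgoing_deriv L u (Rail j \<sigma>) M = b j"
      "outgoing_deriv L u (Rail (j - 1) \<sigma>) M = - wave z (b (j - 1)) (- (z * a (j - 1))) 1"
      using rung_end(2)[OF rung] L
      by (simp_all add: wave_on_edges_outgoing[OF L u] M)
    have "weight \<mu> (Rail i \<sigma>) = 1" for i by (simp add: weight_def)
    then show "(\<Sum>e\<in>incident_edges L M. complex_of_real (weight \<mu> e) * outgoing_deriv L u e M) = 0"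
      using kirchhoff by (simp add: M incident_edges_vertex[OF L] out[unfolded M] algebra_simps)
  qed (rule wave_on_edges_H2[OF L \<mu> u s])
  ultimately show ?thesis
    using L2 wave_on_edges_H2(2)[OF L \<mu> u s]
    unfolding eigenspace_def ladder_op_sym_def ladder_op_def u_def[symmetric] by simp
qed

text \<open>Reflection symmetry is assumed almost everywhere only, and becomes pointwise by continuity. The weak
equation makes the function a wave on each edge, and the conditions at the lower vertices give the
relations of a bound state. Summability of the coefficients follows from that of the square norms by the
comparison of norms on an edge.\<close>

lemma bound_state_of_eigenfunction:
  assumes L: "0 < L" and \<mu>: "0 < \<mu>" and u: "u \<in> eigenspace (ladder_op_sym L \<mu>) z"
  shows "\<exists>a b r. bound_state L \<mu> z a b r \<and> u = ladder_wave L z a b r"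
proof -
  have dom: "u \<in> ladder_domain L \<mu>" and sym: "u \<in> L2_sym L \<mu>"
    and eq: "\<exists>v. H2_derivs (edge_len L e) (restr L u e) v (\<lambda>t. - restr L (\<lambda>p. z * u p) e t)" for e
    using u by (auto simp: eigenspace_def ladder_op_sym_def ladder_op_def)
  have cont: "continuous_on (ladder L) u" and L2: "u \<in> L2_space L \<mu>"
    using dom by (auto simp: ladder_domain_def H2_space_def)
  note cr = continuous_on_restr[OF cont]
  have "\<exists>B. \<forall>t\<in>{0..edge_len L e}. restr L u e t = wave z (restr L u e 0) B t" for e
  proof -
    obtain v where "H2_derivs (edge_len L e) (restr L u e) v (\<lambda>t. - (z * restr L u e t))"
      using eq[of e] by (auto simp: restr_def o_def)
    then show ?thesis by (rule weak_solution_is_wave[OF edge_len_pos[OF L] cr])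
  qed
  then obtain B where B: "\<And>e t. t \<in> {0..edge_len L e} \<Longrightarrow> restr L u e t = wave z (restr L u e 0) (B e) t"
    by metis
  have refl: "u (fst (edge_pt L e t), snd (edge_pt L e t)) = u (fst (edge_pt L e t), - snd (edge_pt L e t))"
    if t: "t \<in> {0..edge_len L e}" for e t
  proof -
    define g where "g t = u (fst (edge_pt L e t), - snd (edge_pt L e t))" for t
    have "continuous_on {0..edge_len L e} g"
      unfolding g_def
    proof (rule continuous_on_compose2[OF cont])
      show "continuous_on {0..edge_len L e} (\<lambda>t. (fst (edge_pt L e t), - snd (edge_pt L e t)))"
        by (intro continuous_intros continuous_on_edge_pt)
      show "(\<lambda>t. (fst (edge_pt L e t), - snd (edge_pt L e t))) ` {0..edge_len L e} \<subseteq> ladder L"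
      proof clarify
        fix t assume t: "t \<in> {0..edge_len L e}"
        obtain e' t' where "t' \<in> {0..edge_len L e'}"
          "edge_pt L e' t' = (fst (edge_pt L e t), - snd (edge_pt L e t))"
          using edge_reflect[OF t] by blast
        then show "(fst (edge_pt L e t), - snd (edge_pt L e t)) \<in> ladder L"
          by (metis edge_pt_in_ladder)
      qed
    qed
    then have "continuous_on {0..edge_len L e} (\<lambda>t. restr L u e t - g t)"
      by (intro continuous_intros cr)
    moreover have "AE t in lebesgue_on {0<..<edge_len L e}. restr L u e t - g t = 0"
    proof -
      have "AE t in lebesgue_on {0<..<edge_len L e}. case edge_pt L e t of (x, y) \<Rightarrow> u (x, y) = u (x, - y)"
        using sym by (simp add: L2_sym_def)
      then show ?thesis by (rule AE_mp) (auto intro!: AE_I2 simp: restr_def g_def case_prod_unfold)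
    qed
    ultimately have "restr L u e t - g t = 0"
      using continuous_AE_zero[OF _ edge_len_pos[OF L] _ t] by blast
    then show ?thesis by (simp add: restr_def g_def)
  qed
  define a where "a j = restr L u (Rung j) 0" for j
  define b where "b j = B (Rail j Lower)" for j
  define r where "r j = B (Rung j)" for j
  have a_Lower: "restr L u (Rail j Lower) 0 = a j" for j by (simp add: a_def restr_def)
  have lower: "restr L u (Rail j Lower) t = wave z (a j) (b j) t" if "t \<in> {0..1}" for j t
    using B[of t "Rail j Lower"] that by (simp add: a_Lower b_def)
  have rail: "restr L u (Rail j s) t = wave z (a j) (b j) t" if t: "t \<in> {0..1}" for j s t
  proof (cases s)
    case Upper
    have "restr L u (Rail j Upper) t = restr L u (Rail j Lower) t"
      using refl[of t "Rail j Lower"] t by (simp add: restr_def)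
    then show ?thesis using lower[OF t] Upper by simp
  qed (simp add: lower[OF t])
  have rung: "restr L u (Rung j) t = wave z (a j) (r j) t" if "t \<in> {0..L}" for j t
    using B[of t "Rung j"] that by (simp add: a_def r_def)
  have w: "wave_on_edges L z (edge_value a) (edge_slope b r) u"
    unfolding wave_on_edges_def
  proof (intro conjI allI impI ballI)
    show "u p = 0" if "p \<notin> ladder L" for p using L2 that by (cases p) (simp add: L2_space_def)
    show "restr L u e t = wave z (edge_value a e) (edge_slope b r e) t" if "t \<in> {0..edge_len L e}" for e t
      using that rail rung by (cases e) simp_all
  qed
  have rung_sym: "r j * fcos z (L / 2) = z * a j * fsin z (L / 2)" for j
  proof (subst rung_symmetric_iff[OF L, symmetric], intro ballI)
    fix t assume t: "t \<in> {0..L}"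
    have "restr L u (Rung j) (L - t) = restr L u (Rung j) t"
      using refl[of t "Rung j"] t by (simp add: restr_def)
    then show "wave z (a j) (r j) (L - t) = wave z (a j) (r j) t"
      using rung[of t j] rung[of "L - t" j] t by simp
  qed
  have next_value: "a (j + 1) = wave z (a j) (b j) 1" for j
    using lower[of 1 j] a_Lower[of "j + 1"] by (simp add: restr_def)
  have kirchhoff: "complex_of_real (weight \<mu> (Rung j)) * r j + b j = wave z (b (j - 1)) (- (z * a (j - 1))) 1" for j
  proof -
    define M where "M = (real_of_int j, height L Lower)"
    have "M \<in> vertices L" unfolding M_def vertices_def by blast
    then have "(\<Sum>e\<in>incident_edges L M. complex_of_real (weight \<mu> e) * outgoing_deriv L u e M) = 0"
      using dom by (simp add: ladder_domain_def)
    moreover have "outgoing_deriv L u (Rung j) M = r j" "outgoing_deriv L u (Rail j Lower) M = b j"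
      "outgoing_deriv L u (Rail (j - 1) Lower) M = - wave z (b (j - 1)) (- (z * a (j - 1))) 1"
      using L by (simp_all add: wave_on_edges_outgoing[OF L w] M_def)
    moreover have "weight \<mu> (Rail i Lower) = 1" for i by (simp add: weight_def)
    moreover have "incident_edges L M = {Rung j, Rail j Lower, Rail (j - 1) Lower}"
      unfolding M_def by (rule incident_edges_vertex[OF L])
    ultimately show ?thesis by (simp add: algebra_simps)
  qed
  have summ: "(\<lambda>j. (norm (a j))\<^sup>2 + (norm (b j))\<^sup>2 + (norm (r j))\<^sup>2) summable_on UNIV"
  proof -
    have sq: "(\<lambda>e. weight \<mu> e * L2_sqnorm (edge_len L e) (restr L u e)) summable_on UNIV"
      using L2 by (simp add: L2_space_def)
    have sq': "(\<lambda>e. L2_sqnorm (edge_len L e) (restr L u e)) summable_on UNIV"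
    proof (rule summable_on_comparison_test[OF summable_on_cmult_right[OF sq, of "max 1 (1 / \<mu>)"]])
      show "L2_sqnorm (edge_len L e) (restr L u e)
          \<le> max 1 (1 / \<mu>) * (weight \<mu> e * L2_sqnorm (edge_len L e) (restr L u e))" for e
      proof -
        have "1 \<le> max 1 (1 / \<mu>) * weight \<mu> e"
          using \<mu> by (auto simp: weight_def max_def field_simps)
        from mult_right_mono[OF this, of "L2_sqnorm (edge_len L e) (restr L u e)"]
        show ?thesis by (simp add: mult.assoc)
      qed
    qed simp
    have s1: "(\<lambda>j. L2_sqnorm L (wave z (a j) (r j))) summable_on UNIV"
      and s2: "(\<lambda>j. L2_sqnorm 1 (wave z (a j) (b j))) summable_on UNIV"
    proof -
      have "L2_sqnorm L (restr L u (Rung j)) = L2_sqnorm L (wave z (a j) (r j))"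
        "L2_sqnorm 1 (restr L u (Rail j Lower)) = L2_sqnorm 1 (wave z (a j) (b j))" for j
        by (rule L2_sqnorm_cong; simp add: rung lower)+
      then show "(\<lambda>j. L2_sqnorm L (wave z (a j) (r j))) summable_on UNIV"
        "(\<lambda>j. L2_sqnorm 1 (wave z (a j) (b j))) summable_on UNIV"
        using sq' unfolding summable_on_edges by (auto dest: spec[of _ Lower])
    qed
    obtain K1 K2 where K: "\<And>A B. (norm A)\<^sup>2 + (norm B)\<^sup>2 \<le> K1 * L2_sqnorm L (wave z A B)"
      "\<And>A B. (norm A)\<^sup>2 + (norm B)\<^sup>2 \<le> K2 * L2_sqnorm 1 (wave z A B)"
      using wave_coefficients_le[OF L, of z] wave_coefficients_le[of 1 z] by auto
    show ?thesis
    proof (rule summable_on_comparison_test)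
      show "(\<lambda>j. K1 * L2_sqnorm L (wave z (a j) (r j)) + K2 * L2_sqnorm 1 (wave z (a j) (b j))) summable_on UNIV"
        by (intro summable_on_add summable_on_cmult_right s1 s2)
      show "(norm (a j))\<^sup>2 + (norm (b j))\<^sup>2 + (norm (r j))\<^sup>2
        \<le> K1 * L2_sqnorm L (wave z (a j) (r j)) + K2 * L2_sqnorm 1 (wave z (a j) (b j))" for j
        using K(1)[of "a j" "r j"] K(2)[of "a j" "b j"] zero_le_power2[of "norm (a j)"] by linarith
    qed simp
  qed
  have bs: "bound_state L \<mu> z a b r"
    using next_value rung_sym kirchhoff summ by (simp add: bound_state_def)
  have "u = ladder_wave L z a b r"
    by (rule wave_on_edges_unique[OF w ladder_wave_on_edges[OF L bs]])
  with bs show ?thesis by blast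
qed

section \<open>Which energies carry a bound state\<close>

subsection \<open>Decay and reality\<close>

lemma summable_int_tendsto_0:
  fixes f :: "int \<Rightarrow> complex"
  assumes "(\<lambda>j. (norm (f j))\<^sup>2) summable_on UNIV"
  shows "(\<lambda>n. f (int n)) \<longlonglongrightarrow> 0" "(\<lambda>n. f (- int n)) \<longlonglongrightarrow> 0"
proof -
  have "(\<lambda>n. f (h n)) \<longlonglongrightarrow> 0" if h: "inj h" for h :: "nat \<Rightarrow> int"
  proof -
    have "(\<lambda>j. (norm (f j))\<^sup>2) summable_on range h"
      using assms by (rule summable_on_subset) simp
    then have "(\<lambda>n. (norm (f (h n)))\<^sup>2) summable_on UNIV"
      by (simp add: summable_on_reindex[OF h] o_def)
    then have "(\<lambda>n. (norm (f (h n)))\<^sup>2) \<longlonglongrightarrow> 0"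
      by (intro summable_LIMSEQ_zero summable_on_imp_summable)
    then have "(\<lambda>n. sqrt ((norm (f (h n)))\<^sup>2)) \<longlonglongrightarrow> sqrt 0"
      by (rule tendsto_real_sqrt)
    then show ?thesis by (simp add: tendsto_norm_zero_iff)
  qed
  from this[of int] this[of "\<lambda>n. - int n"]
  show "(\<lambda>n. f (int n)) \<longlonglongrightarrow> 0" "(\<lambda>n. f (- int n)) \<longlonglongrightarrow> 0" by (simp_all add: inj_def)
qed

lemma monotone_int_zero:
  fixes f :: "int \<Rightarrow> real"
  assumes step: "\<And>j. f j \<le> f (j + 1)"
    and lim: "(\<lambda>n. f (int n)) \<longlonglongrightarrow> 0" "(\<lambda>n. f (- int n)) \<longlonglongrightarrow> 0"
  shows "f j = 0"
proof -
  have mono: "f i \<le> f (i + int n)" for i n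
  proof (induction n)
    case (Suc n)
    then show ?case using step[of "i + int n"] by (simp add: add_ac)
  qed simp
  have "f j \<le> 0"
  proof (rule tendsto_lowerbound[OF lim(1)])
    have "f j \<le> f (int n)" if "nat \<bar>j\<bar> \<le> n" for n
    proof -
      have "j \<le> int n" using that by linarith
      then show ?thesis using mono[of j "nat (int n - j)"] by simp
    qed
    then show "\<forall>\<^sub>F n in sequentially. f j \<le> f (int n)" by (auto simp: eventually_sequentially)
  qed simp
  moreover have "0 \<le> f j"
  proof (rule tendsto_upperbound[OF lim(2)])
    have "f (- int n) \<le> f j" if "nat \<bar>j\<bar> \<le> n" for n
    proof -
      have "- int n \<le> j" using that by linarith
      then show ?thesis using mono[of "- int n" "nat (j + int n)"] by simp
    qed
    then show "\<forall>\<^sub>F n in sequentially. f (- int n) \<le> f j" by (auto simp: eventually_sequentially)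
  qed simp
  ultimately show ?thesis by simp
qed

text \<open>Green's formula, from \<open>(u' \<cdot> cnj u)' = |u'|\<^sup>2 - z |u|\<^sup>2\<close>.\<close>

lemma wave_energy:
  assumes l: "0 < l"
  shows "wave z B (- (z * A)) l * cnj (wave z A B l) - B * cnj A
    = of_real (L2_sqnorm l (wave z B (- (z * A)))) - z * of_real (L2_sqnorm l (wave z A B))"
proof -
  let ?u = "wave z A B" and ?v = "wave z B (- (z * A))"
  have dv: "(?v has_vector_derivative - (z * ?u t)) (at t within S)" for t S
    using wave_deriv[of z B "- (z * A)" t S] by (simp add: wave_def algebra_simps)
  have du: "((\<lambda>t. cnj (?u t)) has_vector_derivative cnj (?v t)) (at t within S)" for t S
    by (rule bounded_linear.has_vector_derivative[OF bounded_linear_cnj wave_deriv])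
  have "((\<lambda>t. ?v t * cnj (?v t) + (- (z * ?u t)) * cnj (?u t)) has_integral ?v l * cnj (?u l) - ?v 0 * cnj (?u 0)) {0..l}"
    using l by (intro fundamental_theorem_of_calculus has_vector_derivative_mult[OF dv du]) simp
  moreover have "((\<lambda>t. complex_of_real ((norm (?v t))\<^sup>2) - z * complex_of_real ((norm (?u t))\<^sup>2)) has_integral
      of_real (L2_sqnorm l ?v) - z * of_real (L2_sqnorm l ?u)) {0..l}"
  proof (intro has_integral_diff has_integral_mult_right)
    have i: "((\<lambda>t. complex_of_real ((norm (w t))\<^sup>2)) has_integral of_real (L2_sqnorm l w)) {0..l}"
      if "continuous_on {0..l} w" for w
      unfolding L2_sqnorm_continuous[OF that]
      by (intro has_integral_of_real integrable_integral integrable_continuous_real continuous_intros that)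
    show "((\<lambda>t. complex_of_real ((norm (?v t))\<^sup>2)) has_integral of_real (L2_sqnorm l ?v)) {0..l}"
      "((\<lambda>t. complex_of_real ((norm (?u t))\<^sup>2)) has_integral of_real (L2_sqnorm l ?u)) {0..l}"
      by (rule i[OF continuous_on_wave])+
  qed
  moreover have "?v t * cnj (?v t) + (- (z * ?u t)) * cnj (?u t)
      = complex_of_real ((norm (?v t))\<^sup>2) - z * complex_of_real ((norm (?u t))\<^sup>2)" for t
    by (simp only: complex_norm_square) simp
  ultimately show ?thesis
    by (simp add: has_integral_unique)
qed

lemma bound_state_tendsto_0:
  assumes "bound_state L \<mu> z a b r"
  shows "(\<lambda>n. a (int n)) \<longlonglongrightarrow> 0" "(\<lambda>n. a (- int n)) \<longlonglongrightarrow> 0"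
    "(\<lambda>n. b (int n)) \<longlonglongrightarrow> 0" "(\<lambda>n. b (- int n)) \<longlonglongrightarrow> 0"
    "(\<lambda>n. r (int n)) \<longlonglongrightarrow> 0" "(\<lambda>n. r (- int n)) \<longlonglongrightarrow> 0"
  using bound_state_summable[OF assms] by (simp_all add: summable_int_tendsto_0)

text \<open>This takes the place of the nonnegativity of the operator. Let \<open>J j\<close> be the incoming flux \<open>u' \<cdot> cnj u\<close> at the vertex
\<open>j\<close>. Green's formula on the rail following it and on half a rung, together with the Kirchhoff condition,
gives \<open>J (j + 1) - J j = D j - z S j\<close> with \<open>S j\<close>, \<open>D j\<close> the weighted square norms of \<open>u\<close> and \<open>u'\<close>. For \<open>z\<close>
off the half-line the imaginary or the real part of \<open>J\<close> is monotone, and it tends to 0 at both ends; hence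
it vanishes, and so does \<open>S\<close>.\<close>

lemma no_bound_state_off_half_line:
  assumes L: "0 < L" and \<mu>: "0 < \<mu>" and bs: "bound_state L \<mu> z a b r"
    and z: "\<not> (Im z = 0 \<and> 0 \<le> Re z)"
  shows "a j = 0" "b j = 0" "r j = 0"
proof -
  define w where "w j = weight \<mu> (Rung j)" for j
  have w: "0 < w j" for j using \<mu> by (simp add: w_def weight_pos)
  have rung: "r j * fcos z (L / 2) = z * a j * fsin z (L / 2)"
    and nxt: "a (j + 1) = wave z (a j) (b j) 1" for j
    using bs by (simp_all add: bound_state_def)
  have kir: "b j + of_real (w j) * r j = wave z (b (j - 1)) (- (z * a (j - 1))) 1" for j
    using bs by (simp add: bound_state_def w_def add.commute)
  define J where "J j = (b j + of_real (w j) * r j) * cnj (a j)" for j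
  define S where "S j = L2_sqnorm 1 (wave z (a j) (b j)) + w j / 2 * L2_sqnorm L (wave z (a j) (r j))" for j
  define D where "D j = L2_sqnorm 1 (wave z (b j) (- (z * a j))) + w j / 2 * L2_sqnorm L (wave z (r j) (- (z * a j)))" for j
  have S0: "0 \<le> S j" and D0: "0 \<le> D j" for j using w[of j] by (simp_all add: S_def D_def)
  have step: "J (j + 1) - J j = of_real (D j) - z * of_real (S j)" for j
  proof -
    have rail: "wave z (b j) (- (z * a j)) 1 * cnj (a (j + 1)) - b j * cnj (a j)
        = of_real (L2_sqnorm 1 (wave z (b j) (- (z * a j)))) - z * of_real (L2_sqnorm 1 (wave z (a j) (b j)))"
      using wave_energy[of 1 z "b j" "a j"] by (simp add: nxt)
    have "- r j * cnj (a j) - r j * cnj (a j)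
        = of_real (L2_sqnorm L (wave z (r j) (- (z * a j)))) - z * of_real (L2_sqnorm L (wave z (a j) (r j)))"
      using wave_energy[OF L, of z "r j" "a j"] rung_end[OF rung] by simp
    then have rg: "- (2 * (r j * cnj (a j)))
        = of_real (L2_sqnorm L (wave z (r j) (- (z * a j)))) - z * of_real (L2_sqnorm L (wave z (a j) (r j)))"
      by simp
    have "J (j + 1) - J j = wave z (b j) (- (z * a j)) 1 * cnj (a (j + 1)) - b j * cnj (a j)
        + of_real (w j) / 2 * (- (2 * (r j * cnj (a j))))"
      using kir[of "j + 1"] by (simp add: J_def algebra_simps)
    also have "\<dots> = of_real (D j) - z * of_real (S j)"
      unfolding rail rg D_def S_def by (simp add: algebra_simps)
    finally show ?thesis .
  qed
  have w_le: "w j \<le> max 1 \<mu>" for j by (simp add: w_def weight_def)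
  have lim: "(\<lambda>n. J (h n)) \<longlonglongrightarrow> 0"
    if h: "(\<lambda>n. a (h n)) \<longlonglongrightarrow> 0" "(\<lambda>n. b (h n)) \<longlonglongrightarrow> 0" "(\<lambda>n. r (h n)) \<longlonglongrightarrow> 0" for h :: "nat \<Rightarrow> int"
  proof -
    have "(\<lambda>n. of_real (w (h n)) * r (h n)) \<longlonglongrightarrow> 0"
    proof (rule Lim_null_comparison)
      show "\<forall>\<^sub>F n in sequentially. norm (of_real (w (h n)) * r (h n)) \<le> max 1 \<mu> * norm (r (h n))"
        using w w_le by (auto intro!: always_eventually mult_right_mono simp: norm_mult less_imp_le)
      show "(\<lambda>n. max 1 \<mu> * norm (r (h n))) \<longlonglongrightarrow> 0"
        using tendsto_mult_right_zero[OF tendsto_norm_zero[OF h(3)]] .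
    qed
    from tendsto_mult[OF tendsto_add[OF h(2) this] tendsto_cnj[OF h(1)]]
    show ?thesis by (simp add: J_def)
  qed
  note t = bound_state_tendsto_0[OF bs]
  note limits = lim[of int, OF t(1,3,5)] lim[of "\<lambda>n. - int n", OF t(2,4,6)]
  have S: "S j = 0" for j
  proof (cases "Im z = 0")
    case False
    \<comment> \<open>the factor turns \<open>- Im z S j\<close> into \<open>|Im z| S j\<close>\<close>
    define f where "f j = - sgn (Im z) * Im (J j)" for j
    have st: "f (j + 1) - f j = \<bar>Im z\<bar> * S j" for j
    proof -
      have "Im (J (j + 1)) - Im (J j) = - (Im z * S j)"
        using arg_cong[OF step[of j], of Im] by simp
      moreover have "f (j + 1) - f j = - sgn (Im z) * (Im (J (j + 1)) - Im (J j))"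
        by (simp add: f_def algebra_simps)
      ultimately have "f (j + 1) - f j = sgn (Im z) * (Im z * S j)" by simp
      then show ?thesis by (simp add: abs_sgn mult_ac)
    qed
    have "f j = 0" for j
    proof (rule monotone_int_zero)
      show "f j \<le> f (j + 1)" for j
        using st[of j] S0[of j] by (smt (verit) mult_nonneg_nonneg abs_ge_zero)
      show "(\<lambda>n. f (int n)) \<longlonglongrightarrow> 0" "(\<lambda>n. f (- int n)) \<longlonglongrightarrow> 0"
        unfolding f_def using tendsto_Im[OF limits(1)] tendsto_Im[OF limits(2)]
        by (intro tendsto_mult_right_zero; simp)+
    qed
    then show ?thesis using st[of j] False by simp
  next
    case True
    define f where "f j = Re (J j)" for j
    have Rez: "Re z < 0" using z True by simp
    have st: "f (j + 1) - f j = D j + (- Re z) * S j" for j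
      using arg_cong[OF step[of j], of Re] True by (simp add: f_def)
    have "f j = 0" for j
    proof (rule monotone_int_zero)
      show "f j \<le> f (j + 1)" for j
        using st[of j] D0[of j] mult_nonneg_nonneg[of "- Re z" "S j"] S0[of j] Rez by linarith
      show "(\<lambda>n. f (int n)) \<longlonglongrightarrow> 0" "(\<lambda>n. f (- int n)) \<longlonglongrightarrow> 0"
        unfolding f_def using tendsto_Re[OF limits(1)] tendsto_Re[OF limits(2)] by simp_all
    qed
    then have "D j + (- Re z) * S j = 0" using st[of j] by simp
    moreover have "0 \<le> (- Re z) * S j"
      by (rule mult_nonneg_nonneg) (use S0[of j] Rez in simp_all)
    ultimately have "(- Re z) * S j = 0" using D0[of j] by linarith
    then show ?thesis using Rez by simp
  qed
  have S1: "L2_sqnorm 1 (wave z (a j) (b j)) = 0"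
    and S2: "w j / 2 * L2_sqnorm L (wave z (a j) (r j)) = 0"
  proof -
    have "0 \<le> w j / 2 * L2_sqnorm L (wave z (a j) (r j))" using w[of j] by simp
    moreover have "L2_sqnorm 1 (wave z (a j) (b j)) + w j / 2 * L2_sqnorm L (wave z (a j) (r j)) = 0"
      using S[of j] unfolding S_def .
    moreover have "0 \<le> L2_sqnorm 1 (wave z (a j) (b j))" by simp
    ultimately show "L2_sqnorm 1 (wave z (a j) (b j)) = 0" "w j / 2 * L2_sqnorm L (wave z (a j) (r j)) = 0"
      by linarith+
  qed
  have "w j / 2 \<noteq> 0" using w[of j] by simp
  then have "L2_sqnorm L (wave z (a j) (r j)) = 0" using S2 mult_eq_0_iff by blast
  moreover note S1
  moreover obtain K1 K2 where "\<And>A B. (norm A)\<^sup>2 + (norm B)\<^sup>2 \<le> K1 * L2_sqnorm L (wave z A B)"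
      "\<And>A B. (norm A)\<^sup>2 + (norm B)\<^sup>2 \<le> K2 * L2_sqnorm 1 (wave z A B)"
      using wave_coefficients_le[OF L, of z] wave_coefficients_le[of 1 z] by auto
  ultimately have "(norm (a j))\<^sup>2 + (norm (b j))\<^sup>2 \<le> 0" "(norm (a j))\<^sup>2 + (norm (r j))\<^sup>2 \<le> 0"
    by (metis mult_zero_right)+
  then show "a j = 0" "b j = 0" "r j = 0"
    by (simp_all add: sum_power2_le_zero_iff)
qed

lemma zero_of_constant_norm:
  fixes f :: "int \<Rightarrow> complex"
  assumes step: "\<And>j. norm (f (j + 1)) = norm (f j)" and lim: "(\<lambda>n. f (int n)) \<longlonglongrightarrow> 0"
  shows "f j = 0"
proof -
  have up: "norm (f (i + int n)) = norm (f i)" for i n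
  proof (induction n)
    case (Suc n) then show ?case using step[of "i + int n"] by (simp add: add_ac)
  qed simp
  have "(\<lambda>n. norm (f (int n))) = (\<lambda>n. norm (f 0))" using up[of 0] by auto
  then have "f 0 = 0" using tendsto_norm_zero[OF lim] LIMSEQ_const_iff[of "norm (f 0)" 0] by simp
  moreover have "norm (f j) = norm (f 0)"
    using up[of j "nat (- j)"] up[of 0 "nat j"] by (cases "0 \<le> j") auto
  ultimately show ?thesis by simp
qed

text \<open>At energy zero the rungs are constant and the rail slopes are all equal, hence zero by decay; then the
values are all equal, hence zero as well.\<close>

lemma no_bound_state_at_zero:
  assumes bs: "bound_state L \<mu> 0 a b r"
  shows "a j = 0" "b j = 0" "r j = 0"
proof -
  have r: "r j = 0" for j
    using bs by (simp add: bound_state_def fcos_def)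
  have "b j = b (j - 1)" for j
    using bs r by (simp add: bound_state_def wave_def fcos_def)
  then have "b (j + 1) = b j" for j by (metis add_diff_cancel_right')
  then have b: "b j = 0" for j
    using zero_of_constant_norm[OF _ bound_state_tendsto_0(3)[OF bs]] by metis
  have "a (j + 1) = a j" for j
    using bs b by (simp add: bound_state_def wave_def fcos_def)
  then show "a j = 0"
    using zero_of_constant_norm[OF _ bound_state_tendsto_0(1)[OF bs]] by metis
  show "b j = 0" "r j = 0" by (rule b r)+
qed

subsection \<open>Positive energies\<close>

lemma csqrt_of_real_square: "0 < \<omega> \<Longrightarrow> csqrt (of_real (\<omega>\<^sup>2)) = of_real \<omega>"
  using csqrt_square[of "of_real \<omega>"] by simp

lemma fcos_of_real_square: "0 < \<omega> \<Longrightarrow> fcos (of_real (\<omega>\<^sup>2)) t = of_real (cos (\<omega> * t))"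
  unfolding fcos_def csqrt_of_real_square by (simp add: cos_of_real flip: of_real_mult)

lemma fsin_of_real_square: "0 < \<omega> \<Longrightarrow> fsin (of_real (\<omega>\<^sup>2)) t = of_real (sin (\<omega> * t) / \<omega>)"
  unfolding fsin_def csqrt_of_real_square by (simp add: sin_of_real flip: of_real_mult)

text \<open>The two roots of \<open>\<rho>\<^sup>2 - G \<rho> + 1\<close> have product 1.\<close>

lemma quadratic_root_in_unit_disc:
  fixes G :: real
  obtains \<rho> :: complex where "\<rho> \<noteq> 0" "norm \<rho> \<le> 1" "\<rho> + 1 / \<rho> = of_real G"
proof -
  define w where "w = csqrt (of_real (G\<^sup>2 - 4))"
  have w: "w * w = of_real G * of_real G - 4"
    using csqrt_sq[of "of_real (G\<^sup>2 - 4)"] by (simp add: w_def power2_eq_square)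
  define p q where "p = (of_real G + w) / 2" and "q = (of_real G - w) / 2"
  have "p * q = (of_real G * of_real G - w * w) / 4" by (simp add: p_def q_def field_simps)
  then have pq: "p * q = 1" by (simp add: w)
  have sum: "p + q = of_real G" by (simp add: p_def q_def field_simps)
  have nz: "p \<noteq> 0" "q \<noteq> 0" using pq by auto
  have inv: "1 / p = q" "1 / q = p" using pq nz by (simp_all add: divide_eq_eq mult.commute)
  have "norm p * norm q = 1" using pq by (metis norm_mult norm_one)
  then have "norm p \<le> 1 \<or> norm q \<le> 1"
    using less_1_mult[of "norm p" "norm q"] by linarith
  then show ?thesis
    using that[of p] that[of q] inv nz sum by (auto simp: add.commute)
qed

text \<open>Inside the disc, \<open>Im \<rho>\<close> and \<open>Im (1/\<rho>)\<close> can cancel only if both are zero.\<close>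

lemma real_of_quadratic_root:
  fixes \<rho> :: complex
  assumes "\<rho> \<noteq> 0" "norm \<rho> < 1" "\<rho> + 1 / \<rho> = of_real G"
  obtains \<sigma> :: real where "\<rho> = of_real \<sigma>" "\<sigma> \<noteq> 0" "\<bar>\<sigma>\<bar> < 1" "\<sigma> + 1 / \<sigma> = G"
proof -
  have "(norm \<rho>)\<^sup>2 * Im \<rho> - Im \<rho> = 0"
  proof -
    have "Im (\<rho> + 1 / \<rho>) = 0" using assms(3) by simp
    moreover have "1 / \<rho> = cnj \<rho> / of_real ((norm \<rho>)\<^sup>2)"
      using assms(1) by (simp add: complex_norm_square field_simps del: of_real_power)
    ultimately have "Im \<rho> - Im \<rho> / (norm \<rho>)\<^sup>2 = 0" by (simp del: of_real_power)
    then show ?thesis using assms(1) by (simp add: field_simps)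
  qed
  moreover have "(norm \<rho>)\<^sup>2 \<noteq> 1"
    using assms(2) by (smt (verit) norm_ge_zero power2_eq_1_iff)
  ultimately have "Im \<rho> = 0" by (metis eq_iff_diff_eq_0 mult_cancel_right1 mult.commute)
  then have r: "\<rho> = of_real (Re \<rho>)" by (simp add: complex_eq_iff)
  have "of_real (Re \<rho> + 1 / Re \<rho>) = (of_real G :: complex)"
    using assms(3) by (subst (asm) (1 2) r) simp
  then have "Re \<rho> + 1 / Re \<rho> = G" by (simp only: of_real_eq_iff)
  then show ?thesis using that[of "Re \<rho>"] r assms by (metis norm_of_real of_real_0)
qed

text \<open>The combination \<open>f (n + 1) - \<rho> f n\<close> is multiplied by \<open>1/\<rho>\<close> in each step. It does not decrease in modulus but
tends to 0, so it vanishes. On the unit circle, \<open>|f n|\<close> itself is then constant, which leaves only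
\<open>f = 0\<close>.\<close>

lemma decaying_solution_geometric:
  fixes f :: "nat \<Rightarrow> complex"
  assumes rec: "\<And>n. f (n + 2) = (\<rho> + 1 / \<rho>) * f (n + 1) - f n" and lim: "f \<longlonglongrightarrow> 0"
    and \<rho>: "\<rho> \<noteq> 0" "norm \<rho> \<le> 1"
  shows "f n = \<rho> ^ n * f 0" "norm \<rho> = 1 \<Longrightarrow> f 0 = 0"
proof -
  define h where "h n = f (n + 1) - \<rho> * f n" for n
  have h: "h n = (1 / \<rho>) ^ n * h 0" for n
  proof (induction n)
    case (Suc n)
    have "h (Suc n) = (1 / \<rho>) * h n"
      using rec[of n] \<rho> by (simp add: h_def field_simps)
    then show ?case using Suc by simp
  qed simp
  have "h \<longlonglongrightarrow> 0 - \<rho> * 0"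
    unfolding h_def by (intro tendsto_diff tendsto_mult tendsto_const lim LIMSEQ_ignore_initial_segment)
  then have hl: "(\<lambda>n. norm (h n)) \<longlonglongrightarrow> 0" by (simp add: tendsto_norm_zero_iff)
  have "norm (h 0) \<le> norm (h n)" for n
  proof -
    have "1 \<le> norm ((1 / \<rho>) ^ n)"
      using \<rho> by (simp add: norm_power norm_divide)
    then show ?thesis unfolding h[of n] norm_mult
      using mult_right_mono[of 1 "norm ((1 / \<rho>) ^ n)" "norm (h 0)"] by simp
  qed
  then have "norm (h 0) \<le> 0"
    by (intro tendsto_lowerbound[OF hl]) auto
  then have h0: "h n = 0" for n using h[of n] by simp
  have geo: "f n = \<rho> ^ n * f 0" for n
  proof (induction n)
    case (Suc n) then show ?case using h0[of n] by (simp add: h_def)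
  qed simp
  then show "f n = \<rho> ^ n * f 0" .
  assume "norm \<rho> = 1"
  then have "norm (f n) = norm (f 0)" for n using geo[of n] by (simp add: norm_mult norm_power)
  then have "(\<lambda>n. norm (f n)) = (\<lambda>n. norm (f 0))" by (rule ext)
  then show "f 0 = 0"
    using tendsto_norm_zero[OF lim] LIMSEQ_const_iff[of "norm (f 0)" 0] by simp
qed

text \<open>The coefficient with which a rung of weight 1 enters the recurrence for the vertex values.\<close>

definition kappa :: "real \<Rightarrow> real \<Rightarrow> real" where
  "kappa L \<omega> = sin \<omega> * tan (\<omega> * L / 2)"

lemma bound_state_real_iff:
  assumes \<omega>: "0 < \<omega>"
  shows "bound_state L \<mu> (of_real (\<omega>\<^sup>2)) a b r \<longleftrightarrow>
    (\<forall>j. a (j + 1) = of_real (cos \<omega>) * a j + of_real (sin \<omega> / \<omega>) * b j)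
    \<and> (\<forall>j. of_real (cos (\<omega> * L / 2)) * r j = of_real (\<omega> * sin (\<omega> * L / 2)) * a j)
    \<and> (\<forall>j. of_real (weight \<mu> (Rung j)) * r j + b j
         = of_real (cos \<omega>) * b (j - 1) - of_real (\<omega> * sin \<omega>) * a (j - 1))
    \<and> (\<lambda>j. (norm (a j))\<^sup>2 + (norm (b j))\<^sup>2 + (norm (r j))\<^sup>2) summable_on UNIV"
proof -
  have c: "fcos (of_real (\<omega>\<^sup>2)) 1 = of_real (cos \<omega>)" "fsin (of_real (\<omega>\<^sup>2)) 1 = of_real (sin \<omega> / \<omega>)"
    "fcos (of_real (\<omega>\<^sup>2)) (L / 2) = of_real (cos (\<omega> * L / 2))"
    "fsin (of_real (\<omega>\<^sup>2)) (L / 2) = of_real (sin (\<omega> * L / 2) / \<omega>)"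
    using fcos_of_real_square[OF \<omega>, of 1] fsin_of_real_square[OF \<omega>, of 1]
      fcos_of_real_square[OF \<omega>, of "L / 2"] fsin_of_real_square[OF \<omega>, of "L / 2"] by simp_all
  have e1: "wave (of_real (\<omega>\<^sup>2)) x y 1 = of_real (cos \<omega>) * x + of_real (sin \<omega> / \<omega>) * y" for x y
    unfolding wave_def c by (simp add: mult.commute)
  have e2: "y * fcos (of_real (\<omega>\<^sup>2)) (L / 2) = of_real (\<omega>\<^sup>2) * x * fsin (of_real (\<omega>\<^sup>2)) (L / 2) \<longleftrightarrow>
    of_real (cos (\<omega> * L / 2)) * y = of_real (\<omega> * sin (\<omega> * L / 2)) * x" for x y
    unfolding c using \<omega> by (simp add: field_simps power2_eq_square)
  have e3: "wave (of_real (\<omega>\<^sup>2)) y (- (of_real (\<omega>\<^sup>2) * x)) 1 = of_real (cos \<omega>) * y - of_real (\<omega> * sin \<omega>) * x" for x y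
    unfolding e1 using \<omega> by (simp add: field_simps power2_eq_square)
  show ?thesis unfolding bound_state_def e3 unfolding e1 e2 by blast
qed

text \<open>When \<open>sin \<omega>\<close> and \<open>cos (\<omega> L / 2)\<close> are nonzero the vertex values determine the slopes. Eliminating these
gives a three-term recurrence with constant coefficients away from \<open>j = 0\<close>, whose decaying solutions on
either side are geometric. The last relation is the recurrence at \<open>j = 0\<close>, where the weight enters.\<close>

lemma bound_state_nonresonant:
  assumes \<mu>: "0 < \<mu>" and \<omega>: "0 < \<omega>" and bs: "bound_state L \<mu> (of_real (\<omega>\<^sup>2)) a b r"
    and sn: "sin \<omega> \<noteq> 0" and cs: "cos (\<omega> * L / 2) \<noteq> 0"
    and \<rho>: "\<rho> \<noteq> 0" "norm \<rho> \<le> 1" "\<rho> + 1 / \<rho> = of_real (2 * cos \<omega> - kappa L \<omega>)"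
  shows "a j = \<rho> ^ nat \<bar>j\<bar> * a 0" "norm \<rho> = 1 \<Longrightarrow> a 0 = 0"
    "b j = of_real (\<omega> / sin \<omega>) * (a (j + 1) - of_real (cos \<omega>) * a j)"
    "r j = of_real (\<omega> * tan (\<omega> * L / 2)) * a j"
    "(2 * \<rho> - of_real (2 * cos \<omega> - \<mu> * kappa L \<omega>)) * a 0 = 0"
proof -
  define C where "C = complex_of_real (cos \<omega>)"
  define T where "T = complex_of_real (sin \<omega> / \<omega>)"
  define K where "K = complex_of_real (\<omega> * tan (\<omega> * L / 2))"
  have T: "T \<noteq> 0" using sn \<omega> by (simp add: T_def)
  have iT: "of_real (\<omega> / sin \<omega>) = 1 / T" by (simp add: T_def)
  have TK: "T * K = of_real (kappa L \<omega>)" using \<omega> by (simp add: T_def K_def kappa_def)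
  have oS: "of_real (\<omega> * sin \<omega>) * T = 1 - C * C"
  proof -
    have "of_real (\<omega> * sin \<omega>) * T = complex_of_real (sin \<omega> * sin \<omega>)"
      using \<omega> by (simp add: T_def)
    also have "sin \<omega> * sin \<omega> = 1 - cos \<omega> * cos \<omega>"
      using sin_squared_eq[of \<omega>] by (simp add: power2_eq_square)
    also have "complex_of_real (1 - cos \<omega> * cos \<omega>) = 1 - C * C" by (simp add: C_def)
    finally show ?thesis .
  qed
  have a1: "a (j + 1) = C * a j + T * b j"
    and r1: "of_real (cos (\<omega> * L / 2)) * r j = of_real (\<omega> * sin (\<omega> * L / 2)) * a j"
    and k1: "of_real (weight \<mu> (Rung j)) * r j + b j = C * b (j - 1) - of_real (\<omega> * sin \<omega>) * a (j - 1)" for j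
    using bs unfolding bound_state_real_iff[OF \<omega>] C_def T_def by blast+
  show b: "b j = of_real (\<omega> / sin \<omega>) * (a (j + 1) - of_real (cos \<omega>) * a j)" for j
    unfolding iT a1 using T by (simp add: C_def)
  show r: "r j = of_real (\<omega> * tan (\<omega> * L / 2)) * a j" for j
    using r1[of j] cs by (simp add: tan_def field_simps)
  have Tb: "T * b j = a (j + 1) - C * a j" for j using a1[of j] by simp
  have rec: "of_real (weight \<mu> (Rung j)) * (T * K) * a j + a (j + 1) + a (j - 1) = 2 * C * a j" for j
  proof -
    have "T * (of_real (weight \<mu> (Rung j)) * r j + b j) = T * (C * b (j - 1) - of_real (\<omega> * sin \<omega>) * a (j - 1))"
      by (simp only: k1)
    then have "of_real (weight \<mu> (Rung j)) * (T * r j) + T * b j = C * (T * b (j - 1)) - (of_real (\<omega> * sin \<omega>) * T) * a (j - 1)"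
      by (simp add: algebra_simps)
    then show ?thesis
      unfolding Tb oS r[of j] K_def[symmetric] by (simp add: algebra_simps)
  qed
  have w1: "weight \<mu> (Rung j) = 1" if "j \<noteq> 0" for j using that by (simp add: weight_def)
  have G: "\<rho> + 1 / \<rho> = 2 * C - T * K" unfolding \<rho>(3) TK by (simp add: C_def)
  note t = bound_state_tendsto_0[OF bs]
  have up: "a (int (n + 2)) = (\<rho> + 1 / \<rho>) * a (int (n + 1)) - a (int n)" for n
  proof -
    have "int n + 1 + 1 = int (n + 2)" "int n + 1 - 1 = int n" "int n + 1 = int (n + 1)" by simp_all
    then show ?thesis using rec[of "int n + 1"] w1[of "int n + 1"] by (simp add: G algebra_simps)
  qed
  have down: "a (- int (n + 2)) = (\<rho> + 1 / \<rho>) * a (- int (n + 1)) - a (- int n)" for n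
  proof -
    define k where "k = - int n - 1"
    have e: "- int (n + 2) = k - 1" "- int (n + 1) = k" "- int n = k + 1" and k: "k \<noteq> 0"
      by (simp_all add: k_def)
    show ?thesis unfolding e using rec[of k] w1[OF k] by (simp add: G algebra_simps)
  qed
  have p: "a (int n) = \<rho> ^ n * a 0" "norm \<rho> = 1 \<Longrightarrow> a 0 = 0" for n
    using decaying_solution_geometric[of "\<lambda>n. a (int n)", OF up t(1) \<rho>(1,2)] by simp_all
  have m: "a (- int n) = \<rho> ^ n * a 0" for n
    using decaying_solution_geometric(1)[of "\<lambda>n. a (- int n)", OF down t(2) \<rho>(1,2)] by simp
  show aj: "a j = \<rho> ^ nat \<bar>j\<bar> * a 0" for j
    using p(1)[of "nat j"] m[of "nat (- j)"] by (cases "0 \<le> j") auto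
  show "norm \<rho> = 1 \<Longrightarrow> a 0 = 0" using p(2) by simp
  have "of_real \<mu> * (T * K) * a 0 + \<rho> * a 0 + \<rho> * a 0 = 2 * C * a 0"
    using rec[of 0] aj[of 1] aj[of "-1"] by (simp add: weight_def)
  then show "(2 * \<rho> - of_real (2 * cos \<omega> - \<mu> * kappa L \<omega>)) * a 0 = 0"
    unfolding TK by (simp add: C_def algebra_simps)
qed

lemma summable_sq_add:
  fixes f g :: "'a \<Rightarrow> complex"
  assumes "(\<lambda>j. (norm (f j))\<^sup>2) summable_on A" "(\<lambda>j. (norm (g j))\<^sup>2) summable_on A"
  shows "(\<lambda>j. (norm (f j + g j))\<^sup>2) summable_on A"
  by (rule summable_on_comparison_test[OF summable_on_cmult_right[OF summable_on_add[OF assms], of 2]])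
    (rule norm_square_sum_le, simp)

lemma summable_sq_cmult:
  fixes f :: "'a \<Rightarrow> complex"
  assumes "(\<lambda>j. (norm (f j))\<^sup>2) summable_on A"
  shows "(\<lambda>j. (norm (c * f j))\<^sup>2) summable_on A"
  using summable_on_cmult_right[OF assms, of "(norm c)\<^sup>2"] by (simp add: norm_mult power_mult_distrib)

lemma summable_sq_shift:
  fixes f :: "int \<Rightarrow> complex"
  assumes "(\<lambda>j. (norm (f j))\<^sup>2) summable_on UNIV"
  shows "(\<lambda>j. (norm (f (j + 1)))\<^sup>2) summable_on UNIV"
proof -
  have "bij (\<lambda>j :: int. j + 1)" by (rule bij_betw_byWitness[of _ "\<lambda>j. j - 1"]) auto
  from summable_on_reindex_bij_betw[OF this, of "\<lambda>j. (norm (f j))\<^sup>2"] assms show ?thesis by simp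
qed

lemma summable_sq_geometric:
  fixes \<rho> :: complex
  assumes "norm \<rho> < 1"
  shows "(\<lambda>j :: int. (norm (\<rho> ^ nat \<bar>j\<bar>))\<^sup>2) summable_on UNIV"
proof -
  define f where "f j = (norm (\<rho> ^ nat \<bar>j\<bar>))\<^sup>2" for j :: int
  have "(norm \<rho>)\<^sup>2 < 1" using assms by (simp add: power_less_one_iff)
  then have "summable (\<lambda>n. ((norm \<rho>)\<^sup>2) ^ n)" by (intro summable_geometric) simp
  then have *: "(\<lambda>n. ((norm \<rho>)\<^sup>2) ^ n) summable_on UNIV"
    by (subst summable_on_UNIV_nonneg_real_iff) auto
  have "f summable_on range h" if "inj h" "\<And>n. \<bar>h n\<bar> = int n" for h :: "nat \<Rightarrow> int"
    using * by (simp add: summable_on_reindex[OF that(1)] o_def f_def that(2) norm_power power_even_eq mult.commute flip: power_mult)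
  from this[of int] this[of "\<lambda>n. - int n"]
  have "f summable_on (range int \<union> range (\<lambda>n. - int n))"
    by (intro summable_on_union) (auto simp: inj_def)
  moreover have "range int \<union> range (\<lambda>n. - int n) = UNIV"
  proof -
    have "j \<in> range int \<union> range (\<lambda>n. - int n)" for j
      by (cases j rule: int_cases2) auto
    then show ?thesis by blast
  qed
  ultimately show ?thesis by (simp add: f_def[abs_def])
qed

text \<open>Converse of \<open>bound_state_nonresonant\<close>: the geometric sequence satisfies the recurrence by the choice of
\<open>\<rho>\<close> at \<open>j \<noteq> 0\<close> and by the eigenvalue equation at \<open>j = 0\<close>.\<close>

lemma bound_state_geometric:
  assumes \<omega>: "0 < \<omega>" and sn: "sin \<omega> \<noteq> 0" and cs: "cos (\<omega> * L / 2) \<noteq> 0"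
    and \<rho>: "\<rho> \<noteq> 0" "norm \<rho> < 1" "\<rho> + 1 / \<rho> = of_real (2 * cos \<omega> - kappa L \<omega>)"
    and eig: "2 * \<rho> = of_real (2 * cos \<omega> - \<mu> * kappa L \<omega>)"
  shows "bound_state L \<mu> (of_real (\<omega>\<^sup>2)) (\<lambda>j. \<rho> ^ nat \<bar>j\<bar>)
    (\<lambda>j. of_real (\<omega> / sin \<omega>) * (\<rho> ^ nat \<bar>j + 1\<bar> - of_real (cos \<omega>) * \<rho> ^ nat \<bar>j\<bar>))
    (\<lambda>j. of_real (\<omega> * tan (\<omega> * L / 2)) * \<rho> ^ nat \<bar>j\<bar>)"
  unfolding bound_state_real_iff[OF \<omega>]
proof (intro conjI allI)
  define C where "C = complex_of_real (cos \<omega>)"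
  define U where "U = complex_of_real (\<omega> / sin \<omega>)"
  define K where "K = complex_of_real (\<omega> * tan (\<omega> * L / 2))"
  define k where "k = complex_of_real (kappa L \<omega>)"
  define a where "a j = \<rho> ^ nat \<bar>j\<bar>" for j :: int
  have K: "K = U * k" using sn by (simp add: K_def U_def k_def kappa_def)
  have oS: "of_real (\<omega> * sin \<omega>) = U * (1 - C * C)"
  proof -
    have "1 - cos \<omega> * cos \<omega> = sin \<omega> * sin \<omega>"
      using sin_squared_eq[of \<omega>] by (simp add: power2_eq_square)
    then have "\<omega> * sin \<omega> = \<omega> / sin \<omega> * (1 - cos \<omega> * cos \<omega>)" using sn by simp
    then show ?thesis by (simp only: U_def C_def of_real_mult of_real_diff of_real_1)
  qed
  have rr: "\<rho> * \<rho> + 1 = (2 * C - k) * \<rho>"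
  proof -
    have "\<rho> * (\<rho> + 1 / \<rho>) = \<rho> * (2 * C - k)" unfolding \<rho>(3) by (simp add: C_def k_def)
    then show ?thesis using \<rho>(1) by (simp add: distrib_left mult.commute)
  qed
  have eig': "2 * \<rho> = 2 * C - of_real \<mu> * k" using eig by (simp add: C_def k_def)
  fix j :: int
  show "\<rho> ^ nat \<bar>j + 1\<bar> = of_real (cos \<omega>) * \<rho> ^ nat \<bar>j\<bar>
    + of_real (sin \<omega> / \<omega>) * (of_real (\<omega> / sin \<omega>) * (\<rho> ^ nat \<bar>j + 1\<bar> - of_real (cos \<omega>) * \<rho> ^ nat \<bar>j\<bar>))"
    using \<omega> sn by simp
  show "of_real (cos (\<omega> * L / 2)) * (of_real (\<omega> * tan (\<omega> * L / 2)) * \<rho> ^ nat \<bar>j\<bar>)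
    = of_real (\<omega> * sin (\<omega> * L / 2)) * \<rho> ^ nat \<bar>j\<bar>"
    using cs by (simp add: tan_def)
  have rec: "of_real (weight \<mu> (Rung j)) * k * a j + a (j + 1) + a (j - 1) = 2 * C * a j"
  proof -
    have w1: "weight \<mu> (Rung j) = 1" if "j \<noteq> 0" using that by (simp add: weight_def)
    consider "j = 0" | "0 < j" | "j < 0" by linarith
    then show ?thesis
    proof cases
      case 1
      then show ?thesis using eig' by (simp add: a_def weight_def algebra_simps)
    next
      case 2
      define n where "n = nat (j - 1)"
      have 2: "j = int n + 1" using 2 by (simp add: n_def)
      have "a j = \<rho> ^ n * \<rho>" "a (j + 1) = \<rho> ^ n * (\<rho> * \<rho>)" "a (j - 1) = \<rho> ^ n"
        using 2 by (simp_all add: a_def nat_add_distrib)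
      moreover have "k * (\<rho> ^ n * \<rho>) + \<rho> ^ n * (\<rho> * \<rho>) + \<rho> ^ n = 2 * C * (\<rho> ^ n * \<rho>)"
        using arg_cong[OF rr, of "\<lambda>x. \<rho> ^ n * x"] by (simp add: algebra_simps)
      ultimately show ?thesis using w1 2 by simp
    next
      case 3
      define n where "n = nat (- j - 1)"
      have 3: "j = - int n - 1" using 3 by (simp add: n_def)
      have "nat \<bar>j\<bar> = n + 1" "nat \<bar>j + 1\<bar> = n" "nat \<bar>j - 1\<bar> = n + 2" using 3 by simp_all
      then have "a j = \<rho> ^ n * \<rho>" "a (j - 1) = \<rho> ^ n * (\<rho> * \<rho>)" "a (j + 1) = \<rho> ^ n"
        by (simp_all add: a_def)
      moreover have "k * (\<rho> ^ n * \<rho>) + \<rho> ^ n * (\<rho> * \<rho>) + \<rho> ^ n = 2 * C * (\<rho> ^ n * \<rho>)"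
        using arg_cong[OF rr, of "\<lambda>x. \<rho> ^ n * x"] by (simp add: algebra_simps)
      ultimately show ?thesis using w1 3 by (simp add: add_ac)
    qed
  qed
  have "of_real (weight \<mu> (Rung j)) * (K * a j) + U * (a (j + 1) - C * a j)
    = C * (U * (a (j - 1 + 1) - C * a (j - 1))) - (U * (1 - C * C)) * a (j - 1)"
    using arg_cong[OF rec, of "\<lambda>x. U * x"] unfolding K by (simp add: algebra_simps)
  then show "of_real (weight \<mu> (Rung j)) * (of_real (\<omega> * tan (\<omega> * L / 2)) * \<rho> ^ nat \<bar>j\<bar>)
      + of_real (\<omega> / sin \<omega>) * (\<rho> ^ nat \<bar>j + 1\<bar> - of_real (cos \<omega>) * \<rho> ^ nat \<bar>j\<bar>)
    = of_real (cos \<omega>) * (of_real (\<omega> / sin \<omega>) * (\<rho> ^ nat \<bar>j - 1 + 1\<bar> - of_real (cos \<omega>) * \<rho> ^ nat \<bar>j - 1\<bar>))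
      - of_real (\<omega> * sin \<omega>) * \<rho> ^ nat \<bar>j - 1\<bar>"
    unfolding oS a_def K_def U_def C_def .
next
  note s = summable_sq_geometric[OF \<rho>(2)]
  have "(\<lambda>j. (norm (of_real (\<omega> / sin \<omega>) * (\<rho> ^ nat \<bar>j + 1\<bar> + (- of_real (cos \<omega>)) * \<rho> ^ nat \<bar>j\<bar>)))\<^sup>2) summable_on UNIV"
    by (intro summable_sq_cmult summable_sq_add summable_sq_shift[of "\<lambda>j. \<rho> ^ nat \<bar>j\<bar>"] s)
  then have s2: "(\<lambda>j. (norm (of_real (\<omega> / sin \<omega>) * (\<rho> ^ nat \<bar>j + 1\<bar> - of_real (cos \<omega>) * \<rho> ^ nat \<bar>j\<bar>)))\<^sup>2) summable_on UNIV"
    by simp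
  show "(\<lambda>j. (norm (\<rho> ^ nat \<bar>j\<bar>))\<^sup>2
      + (norm (of_real (\<omega> / sin \<omega>) * (\<rho> ^ nat \<bar>j + 1\<bar> - of_real (cos \<omega>) * \<rho> ^ nat \<bar>j\<bar>)))\<^sup>2
      + (norm (of_real (\<omega> * tan (\<omega> * L / 2)) * \<rho> ^ nat \<bar>j\<bar>))\<^sup>2) summable_on UNIV"
    by (intro summable_on_add s s2 summable_sq_cmult[OF s])
qed

lemma ladder_wave_scale:
  "ladder_wave L z (\<lambda>j. c * a j) (\<lambda>j. c * b j) (\<lambda>j. c * r j) p = c * ladder_wave L z a b r p"
  by (cases p) (simp add: ladder_wave_def wave_scale)

lemma ladder_wave_zero: "ladder_wave L z (\<lambda>j. 0) (\<lambda>j. 0) (\<lambda>j. 0) = (\<lambda>p. 0)"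
  by (simp add: ladder_wave_def fun_eq_iff)

lemma ladder_wave_vertex: "0 < L \<Longrightarrow> ladder_wave L z a b r (of_int j, L / 2) = a j"
  by (simp add: ladder_wave_def)

lemma ladder_wave_eq_zero:
  assumes "\<And>j. a j = 0" "\<And>j. b j = 0" "\<And>j. r j = 0"
  shows "ladder_wave L z a b r = (\<lambda>p. 0)"
proof -
  have "a = (\<lambda>j. 0)" "b = (\<lambda>j. 0)" "r = (\<lambda>j. 0)" using assms by auto
  then show ?thesis by (simp add: ladder_wave_zero)
qed

lemma nonresonant_eigenvalueE:
  assumes L: "0 < L" and \<mu>: "0 < \<mu>" and \<omega>: "0 < \<omega>" and sn: "sin \<omega> \<noteq> 0" and cs: "cos (\<omega> * L / 2) \<noteq> 0"
    and ev: "is_eigenvalue (ladder_op_sym L \<mu>) (of_real (\<omega>\<^sup>2))"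
  obtains \<sigma> :: real where "\<sigma> \<noteq> 0" "\<bar>\<sigma>\<bar> < 1" "\<sigma> + 1 / \<sigma> = 2 * cos \<omega> - kappa L \<omega>"
    "2 * \<sigma> = 2 * cos \<omega> - \<mu> * kappa L \<omega>"
proof -
  obtain u where u: "u \<in> eigenspace (ladder_op_sym L \<mu>) (of_real (\<omega>\<^sup>2))" "u \<noteq> (\<lambda>p. 0)"
    using ev by (auto simp: is_eigenvalue_def)
  obtain a b r where bs: "bound_state L \<mu> (of_real (\<omega>\<^sup>2)) a b r" and ua: "u = ladder_wave L (of_real (\<omega>\<^sup>2)) a b r"
    using bound_state_of_eigenfunction[OF L \<mu> u(1)] by blast
  obtain \<rho> :: complex where \<rho>: "\<rho> \<noteq> 0" "norm \<rho> \<le> 1" "\<rho> + 1 / \<rho> = of_real (2 * cos \<omega> - kappa L \<omega>)"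
    by (rule quadratic_root_in_unit_disc)
  note f = bound_state_nonresonant[OF \<mu> \<omega> bs sn cs \<rho>]
  have a0: "a 0 \<noteq> 0"
  proof
    assume "a 0 = 0"
    then have "a j = 0" for j using f(1)[of j] by simp
    moreover from this have "b j = 0" "r j = 0" for j using f(3)[of j] f(4)[of j] by simp_all
    ultimately show False using ladder_wave_eq_zero u(2) ua by metis
  qed
  then have "norm \<rho> < 1" using f(2) \<rho>(2) by fastforce
  then obtain \<sigma> where \<sigma>: "\<rho> = of_real \<sigma>" "\<sigma> \<noteq> 0" "\<bar>\<sigma>\<bar> < 1" "\<sigma> + 1 / \<sigma> = 2 * cos \<omega> - kappa L \<omega>"
    by (rule real_of_quadratic_root[OF \<rho>(1) _ \<rho>(3)])
  have "of_real (2 * \<sigma>) = complex_of_real (2 * cos \<omega> - \<mu> * kappa L \<omega>)"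
    using f(5) a0 \<sigma>(1) by simp
  then have "2 * \<sigma> = 2 * cos \<omega> - \<mu> * kappa L \<omega>" by (simp only: of_real_eq_iff)
  with \<sigma> that show ?thesis by blast
qed

text \<open>By \<open>bound_state_nonresonant\<close>, every bound state is \<open>a 0\<close> times the normalised one.\<close>

lemma nonresonant_simple_eigenvalue:
  fixes \<sigma> :: real
  assumes L: "0 < L" and \<mu>: "0 < \<mu>" and \<omega>: "0 < \<omega>" and sn: "sin \<omega> \<noteq> 0" and cs: "cos (\<omega> * L / 2) \<noteq> 0"
    and \<sigma>: "\<sigma> \<noteq> 0" "\<bar>\<sigma>\<bar> < 1" "\<sigma> + 1 / \<sigma> = 2 * cos \<omega> - kappa L \<omega>"
    "2 * \<sigma> = 2 * cos \<omega> - \<mu> * kappa L \<omega>"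
  shows "simple_eigenvalue (ladder_op_sym L \<mu>) (of_real (\<omega>\<^sup>2))"
proof -
  define z where "z = complex_of_real (\<omega>\<^sup>2)"
  define \<rho> where "\<rho> = complex_of_real \<sigma>"
  have \<rho>: "\<rho> \<noteq> 0" "norm \<rho> < 1" "\<rho> + 1 / \<rho> = of_real (2 * cos \<omega> - kappa L \<omega>)"
    "2 * \<rho> = of_real (2 * cos \<omega> - \<mu> * kappa L \<omega>)"
    using \<sigma>(1,2) unfolding \<sigma>(3,4)[symmetric] by (simp_all add: \<rho>_def)
  define a where "a j = \<rho> ^ nat \<bar>j\<bar>" for j :: int
  define b where "b j = of_real (\<omega> / sin \<omega>) * (a (j + 1) - of_real (cos \<omega>) * a j)" for j
  define r where "r j = of_real (\<omega> * tan (\<omega> * L / 2)) * a j" for j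
  have bs: "bound_state L \<mu> z a b r"
    using bound_state_geometric[OF \<omega> sn cs \<rho>] unfolding a_def b_def r_def z_def .
  define v where "v = ladder_wave L z a b r"
  let ?E = "eigenspace (ladder_op_sym L \<mu>) z"
  have v: "v \<in> ?E" unfolding v_def by (rule eigenfunction_of_bound_state[OF L \<mu> bs])
  have "v (0, L / 2) = 1" using ladder_wave_vertex[OF L, of z a b r 0] by (simp add: v_def a_def)
  then have v0: "v \<noteq> (\<lambda>p. 0)" by (auto dest: fun_cong)
  have "u \<in> cfun.span {v}" if u: "u \<in> ?E" for u
  proof -
    obtain a' b' r' where bs': "bound_state L \<mu> z a' b' r'" and ua: "u = ladder_wave L z a' b' r'"
      using bound_state_of_eigenfunction[OF L \<mu> u] by blast
    note f = bound_state_nonresonant[OF \<mu> \<omega> bs'[unfolded z_def] sn cs \<rho>(1) less_imp_le[OF \<rho>(2)] \<rho>(3)]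
    have a': "a' j = a' 0 * a j" for j using f(1)[of j] by (simp add: a_def mult.commute)
    have b': "b' j = a' 0 * b j" for j
      unfolding f(3) b_def using a' by (metis (no_types, opaque_lifting) mult.left_commute right_diff_distrib')
    have r': "r' j = a' 0 * r j" for j
      unfolding f(4) r_def using a'[of j] by (metis mult.left_commute)
    have "a' = (\<lambda>j. a' 0 * a j)" "b' = (\<lambda>j. a' 0 * b j)" "r' = (\<lambda>j. a' 0 * r j)"
      using a' b' r' by blast+
    then have "u = ladder_wave L z (\<lambda>j. a' 0 * a j) (\<lambda>j. a' 0 * b j) (\<lambda>j. a' 0 * r j)"
      using ua by metis
    then have "u = (\<lambda>p. a' 0 * v p)" by (auto simp: ladder_wave_scale v_def)
    then show ?thesis using cfun.span_scale[OF cfun.span_base, of v "{v}" "a' 0"] by simp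
  qed
  then have "?E \<subseteq> cfun.span {v}" by blast
  moreover have "\<not> cfun.dependent {v}" using v0 by (simp add: zero_fun_def)
  ultimately have "cfun.dim ?E = 1" using v by (intro cfun.dim_unique[of "{v}"]) auto
  then show ?thesis using v v0 by (auto simp: simple_eigenvalue_def is_eigenvalue_def z_def)
qed

subsection \<open>Resonant energies\<close>

text \<open>If \<open>sin \<omega> = 0\<close> then \<open>cos \<omega> = \<plusminus>1\<close>, so the vertex values have constant modulus along the rail.\<close>

lemma resonant_vertices_vanish:
  assumes \<omega>: "0 < \<omega>" and bs: "bound_state L \<mu> (of_real (\<omega>\<^sup>2)) a b r" and sn: "sin \<omega> = 0"
  shows "a j = 0"
proof (rule zero_of_constant_norm[OF _ bound_state_tendsto_0(1)[OF bs]])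
  fix j
  have "a (j + 1) = of_real (cos \<omega>) * a j"
  proof -
    have "a (j + 1) = of_real (cos \<omega>) * a j + of_real (sin \<omega> / \<omega>) * b j"
      using bs unfolding bound_state_real_iff[OF \<omega>] by blast
    then show ?thesis by (simp only: sn) simp
  qed
  then show "norm (a (j + 1)) = norm (a j)"
    using sin_zero_abs_cos_one[OF sn] by (simp add: norm_mult)
qed

text \<open>If only \<open>sin \<omega>\<close> vanishes, the vertices and the rungs are at rest, and the rail slopes have constant modulus
and so do not decay. If only \<open>cos (\<omega> L / 2)\<close> vanishes, the vertices are at rest; no nonzero rail wave vanishes
at both ends, and then the Kirchhoff condition stops the rungs.\<close>

lemma eigenvalue_resonance_iff:
  assumes L: "0 < L" and \<mu>: "0 < \<mu>" and \<omega>: "0 < \<omega>"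
    and ev: "is_eigenvalue (ladder_op_sym L \<mu>) (of_real (\<omega>\<^sup>2))"
  shows "sin \<omega> = 0 \<longleftrightarrow> cos (\<omega> * L / 2) = 0"
proof -
  obtain u where u: "u \<in> eigenspace (ladder_op_sym L \<mu>) (of_real (\<omega>\<^sup>2))" "u \<noteq> (\<lambda>p. 0)"
    using ev by (auto simp: is_eigenvalue_def)
  obtain a b r where bs: "bound_state L \<mu> (of_real (\<omega>\<^sup>2)) a b r" and ua: "u = ladder_wave L (of_real (\<omega>\<^sup>2)) a b r"
    using bound_state_of_eigenfunction[OF L \<mu> u(1)] by blast
  note B = bs[unfolded bound_state_real_iff[OF \<omega>]]
  have contra: False if "\<And>j. a j = 0" "\<And>j. b j = 0" "\<And>j. r j = 0"
  proof -
    have "u = (\<lambda>p. 0)" unfolding ua by (rule ladder_wave_eq_zero) (rule that)+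
    then show False using u(2) by blast
  qed
  show ?thesis
  proof
    assume sn: "sin \<omega> = 0"
    have a: "a j = 0" for j by (rule resonant_vertices_vanish[OF \<omega> bs sn])
    show "cos (\<omega> * L / 2) = 0"
    proof (rule ccontr)
      assume cs: "cos (\<omega> * L / 2) \<noteq> 0"
      have r: "r j = 0" for j
      proof -
        have "of_real (cos (\<omega> * L / 2)) * r j = of_real (\<omega> * sin (\<omega> * L / 2)) * a j" using B by blast
        then have "of_real (cos (\<omega> * L / 2)) * r j = 0" by (simp only: a) simp
        then show ?thesis using cs by simp
      qed
      have b1: "b j = of_real (cos \<omega>) * b (j - 1)" for j
      proof -
        have "of_real (weight \<mu> (Rung j)) * r j + b j
          = of_real (cos \<omega>) * b (j - 1) - of_real (\<omega> * sin \<omega>) * a (j - 1)" using B by blast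
        then show ?thesis by (simp only: a r) simp
      qed
      have "norm (b (j + 1)) = norm (b j)" for j
        using b1[of "j + 1"] sin_zero_abs_cos_one[OF sn] by (simp add: norm_mult)
      then have "b j = 0" for j by (rule zero_of_constant_norm[OF _ bound_state_tendsto_0(3)[OF bs]])
      then show False using contra a r by blast
    qed
  next
    assume cs: "cos (\<omega> * L / 2) = 0"
    show "sin \<omega> = 0"
    proof (rule ccontr)
      assume sn: "sin \<omega> \<noteq> 0"
      have "sin (\<omega> * L / 2) \<noteq> 0" using sin_zero_abs_cos_one[of "\<omega> * L / 2"] cs by auto
      moreover have "of_real (\<omega> * sin (\<omega> * L / 2)) * a j = 0" for j
      proof -
        have "of_real (cos (\<omega> * L / 2)) * r j = of_real (\<omega> * sin (\<omega> * L / 2)) * a j" using B by blast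
        then show ?thesis by (simp only: cs) simp
      qed
      ultimately have a: "a j = 0" for j using \<omega> by simp
      have b: "b j = 0" for j
      proof -
        have "a (j + 1) = of_real (cos \<omega>) * a j + of_real (sin \<omega> / \<omega>) * b j" using B by blast
        then have "of_real (sin \<omega> / \<omega>) * b j = 0" by (simp only: a) simp
        then show ?thesis using sn \<omega> by simp
      qed
      have "r j = 0" for j
      proof -
        have "of_real (weight \<mu> (Rung j)) * r j + b j
          = of_real (cos \<omega>) * b (j - 1) - of_real (\<omega> * sin \<omega>) * a (j - 1)" using B by blast
        then have "of_real (weight \<mu> (Rung j)) * r j = 0" by (simp only: a b) simp
        then show ?thesis using weight_pos[OF \<mu>, of "Rung j"] by simp
      qed
      then show False using contra a b by blast
    qed
  qed
qed

text \<open>Evaluating a linear relation at \<open>p k\<close> isolates the coefficient of \<open>v k\<close>.\<close>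

lemma separated_functions_independent:
  fixes v :: "nat \<Rightarrow> 'p \<Rightarrow> complex"
  assumes sep: "\<And>i k. v i (p k) \<noteq> 0 \<longleftrightarrow> i = k"
  shows "inj v" "\<not> cfun.dependent (range v)"
proof -
  show "inj v"
  proof (rule injI)
    fix i k assume "v i = v k"
    then have "v i (p k) \<noteq> 0" using sep[of k k] by simp
    then show "i = k" using sep[of i k] by simp
  qed
  show "\<not> cfun.dependent (range v)"
  proof
    assume "cfun.dependent (range v)"
    then obtain t u where t: "finite t" "t \<subseteq> range v" "(\<Sum>w\<in>t. (\<lambda>p. u w * w p)) = 0"
      and nz: "\<exists>w\<in>t. u w \<noteq> 0"
      unfolding cfun.dependent_explicit by blast
    obtain k where k: "v k \<in> t" "u (v k) \<noteq> 0" using nz t(2) by blast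
    have "(\<Sum>w\<in>s. (\<lambda>p. u w * w p)) q = (\<Sum>w\<in>s. u w * w q)" if "finite s" for s q
      using that by induction auto
    from this[OF t(1), of "p k"] have "(\<Sum>w\<in>t. u w * w (p k)) = 0" unfolding t(3) by simp
    moreover have "(\<Sum>w\<in>t. u w * w (p k)) = (\<Sum>w\<in>{v k}. u w * w (p k))"
    proof (rule sum.mono_neutral_right[OF t(1)])
      show "{v k} \<subseteq> t" using k by simp
      show "\<forall>w\<in>t - {v k}. u w * w (p k) = 0"
      proof
        fix w assume w: "w \<in> t - {v k}"
        then obtain i where i: "w = v i" using t(2) by blast
        then have "i \<noteq> k" using w by blast
        then show "u w * w (p k) = 0" using sep[of i k] i by simp
      qed
    qed
    ultimately have "u (v k) * v k (p k) = 0" by simp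
    then show False using k(2) sep[of k k] by simp
  qed
qed

text \<open>Each cell \<open>[k + 1, k + 2]\<close> carries an eigenfunction that vanishes at all vertices and is supported on the
two rails and the two rungs of the cell, with slopes chosen to balance at its corners. Cells with
\<open>k \<ge> 0\<close> avoid the rung of weight \<open>\<mu>\<close>.\<close>

lemma resonant_infinite_multiplicity:
  assumes L: "0 < L" and \<mu>: "0 < \<mu>" and \<omega>: "0 < \<omega>"
    and sn: "sin \<omega> = 0" and cs: "cos (\<omega> * L / 2) = 0"
  shows "\<not> finite_multiplicity (ladder_op_sym L \<mu>) (of_real (\<omega>\<^sup>2))"
proof
  define z where "z = complex_of_real (\<omega>\<^sup>2)"
  assume "finite_multiplicity (ladder_op_sym L \<mu>) (of_real (\<omega>\<^sup>2))"
  then obtain B where B: "finite B" "eigenspace (ladder_op_sym L \<mu>) z \<subseteq> cfun.span B"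
    by (auto simp: finite_multiplicity_def z_def)
  \<comment> \<open>unit slope on the rails of the cell, and rung slopes that restore balance at its left and right corners\<close>
  define b where "b k j = (if j = int k + 1 then 1 else 0 :: complex)" for k :: nat and j
  define r where "r k j = (if j = int k + 1 then - 1 else if j = int k + 2 then of_real (cos \<omega>) else 0 :: complex)"
    for k :: nat and j
  have bs: "bound_state L \<mu> z (\<lambda>j. 0) (b k) (r k)" for k
    unfolding z_def bound_state_real_iff[OF \<omega>]
  proof (intro conjI allI)
    fix j
    show "of_real (weight \<mu> (Rung j)) * r k j + b k j = of_real (cos \<omega>) * b k (j - 1) - of_real (\<omega> * sin \<omega>) * 0"
      by (auto simp: r_def b_def weight_def)
  next
    have fin: "finite {int k + 1, int k + 2}" by simp
    have "(\<lambda>j. (norm (0 :: complex))\<^sup>2 + (norm (b k j))\<^sup>2 + (norm (r k j))\<^sup>2) summable_on {int k + 1, int k + 2}"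
      by (rule summable_on_finite[OF fin])
    then show "(\<lambda>j. (norm (0 :: complex))\<^sup>2 + (norm (b k j))\<^sup>2 + (norm (r k j))\<^sup>2) summable_on UNIV"
      by (subst summable_on_cong_neutral[where T = "{int k + 1, int k + 2}"]) (auto simp: b_def r_def)
  qed (use sn cs in simp_all)
  obtain t where t: "0 < t" "t < 1" "fsin z t \<noteq> 0"
    using fsin_nonzero_somewhere[of 1 z] by auto
  define v where "v k = ladder_wave L z (\<lambda>j. 0) (b k) (r k)" for k
  have "\<lfloor>real i + 1 + t\<rfloor> = int i + 1" for i
    using t by (simp add: floor_eq_iff)
  then have "v k (real i + 1 + t, L / 2) = b k (int i + 1) * fsin z t" for k i
    using L by (simp add: v_def ladder_wave_def wave_def)
  then have "v k (real i + 1 + t, L / 2) \<noteq> 0 \<longleftrightarrow> k = i" for k i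
    using t(3) by (auto simp: b_def)
  note ind = separated_functions_independent[of v "\<lambda>i. (real i + 1 + t, L / 2)", OF this]
  have "range v \<subseteq> cfun.span B"
    using B(2) eigenfunction_of_bound_state[OF L \<mu> bs] by (auto simp: v_def)
  then have "finite (range v)" using cfun.independent_span_bound[OF B(1) ind(2)] by blast
  then show False using ind(1) finite_imageD by blast
qed

text \<open>The sign that decides the problem. If \<open>\<sigma> > 0\<close> then \<open>\<sigma> + 1/\<sigma> > 2 \<ge> 2 C\<close>, so \<open>k < 0\<close>, and \<open>\<sigma> < 1/\<sigma>\<close>. If
\<open>\<sigma> < 0\<close>, all signs are reversed.\<close>

lemma root_difference_sign:
  fixes \<sigma> C k :: real
  assumes "\<sigma> \<noteq> 0" "\<bar>\<sigma>\<bar> < 1" "\<bar>C\<bar> \<le> 1" "\<sigma> + 1 / \<sigma> = 2 * C - k"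
  shows "0 < (\<sigma> - 1 / \<sigma>) * k"
proof -
  have sq: "\<sigma> * \<sigma> < 1"
    using assms(2) abs_square_less_1[of \<sigma>] by (simp add: power2_eq_square)
  show ?thesis
  proof (cases "0 < \<sigma>")
    case True
    have "0 < (1 - \<sigma>) * (1 - \<sigma>) / \<sigma>" using True assms(2) by (intro divide_pos_pos mult_pos_pos) auto
    also have "\<dots> = \<sigma> + 1 / \<sigma> - 2" using True by (simp add: field_simps)
    finally have "k < 0" using assms(3,4) by linarith
    moreover have "\<sigma> < 1 / \<sigma>" using True sq by (simp add: less_divide_eq)
    ultimately show ?thesis by (intro mult_neg_neg) auto
  next
    case False
    then have n: "0 < - \<sigma>" using assms(1) by simp
    have "0 < (1 + \<sigma>) * (1 + \<sigma>) / (- \<sigma>)" using n assms(2) by (intro divide_pos_pos mult_pos_pos) auto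
    also have "\<dots> = - (\<sigma> + 1 / \<sigma>) - 2" using n by (simp add: field_simps)
    finally have "0 < k" using assms(3,4) by linarith
    moreover have "1 / \<sigma> < \<sigma>" using n sq by (simp add: divide_less_eq)
    ultimately show ?thesis by (intro mult_pos_pos) auto
  qed
qed

text \<open>A nonresonant eigenvalue would give \<open>\<sigma> - 1/\<sigma> = (1 - \<mu>) k\<close>, which contradicts the sign of
\<open>(\<sigma> - 1/\<sigma>) k\<close> when \<open>\<mu> \<ge> 1\<close>. A resonant one has infinite multiplicity.\<close>

lemma discrete_spectrum_empty:
  assumes L: "0 < L" and \<mu>: "1 \<le> \<mu>"
  shows "disc_spec_sym L \<mu> = {}"
proof -
  have \<mu>0: "0 < \<mu>" using \<mu> by simp
  have "z \<notin> disc_spec_sym L \<mu>" for z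
  proof
    assume "z \<in> disc_spec_sym L \<mu>"
    then have ev: "is_eigenvalue (ladder_op_sym L \<mu>) z"
      and fm: "finite_multiplicity (ladder_op_sym L \<mu>) z"
      by (simp_all add: disc_spec_sym_def discrete_spectrum_def)
    obtain u where u: "u \<in> eigenspace (ladder_op_sym L \<mu>) z" "u \<noteq> (\<lambda>p. 0)"
      using ev by (auto simp: is_eigenvalue_def)
    obtain a b r where bs: "bound_state L \<mu> z a b r" and ua: "u = ladder_wave L z a b r"
      using bound_state_of_eigenfunction[OF L \<mu>0 u(1)] by blast
    have z0: "Im z = 0 \<and> 0 \<le> Re z"
    proof (rule ccontr)
      assume "\<not> ?thesis"
      then have "u = (\<lambda>p. 0)"
        unfolding ua by (intro ladder_wave_eq_zero no_bound_state_off_half_line[OF L \<mu>0 bs])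
      then show False using u(2) by blast
    qed
    have "z \<noteq> 0"
    proof
      assume "z = 0"
      with bs have "bound_state L \<mu> 0 a b r" by simp
      then have "u = (\<lambda>p. 0)" unfolding ua by (intro ladder_wave_eq_zero no_bound_state_at_zero)
      then show False using u(2) by blast
    qed
    define \<omega> where "\<omega> = sqrt (Re z)"
    have \<omega>: "0 < \<omega>" using z0 \<open>z \<noteq> 0\<close> by (auto simp: \<omega>_def complex_eq_iff)
    have z: "z = of_real (\<omega>\<^sup>2)" using z0 by (simp add: \<omega>_def complex_eq_iff)
    have res: "sin \<omega> = 0 \<longleftrightarrow> cos (\<omega> * L / 2) = 0"
      using eigenvalue_resonance_iff[OF L \<mu>0 \<omega>] ev z by simp
    show False
    proof (cases "sin \<omega> = 0")
      case True
      then show False using resonant_infinite_multiplicity[OF L \<mu>0 \<omega>] res fm z by simp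
    next
      case False
      obtain \<sigma> where \<sigma>: "\<sigma> \<noteq> 0" "\<bar>\<sigma>\<bar> < 1" "\<sigma> + 1 / \<sigma> = 2 * cos \<omega> - kappa L \<omega>"
        "2 * \<sigma> = 2 * cos \<omega> - \<mu> * kappa L \<omega>"
        using nonresonant_eigenvalueE[OF L \<mu>0 \<omega> False] False res ev z by metis
      have "0 < (\<sigma> - 1 / \<sigma>) * kappa L \<omega>"
        by (rule root_difference_sign[OF \<sigma>(1,2) abs_cos_le_one \<sigma>(3)])
      moreover have "\<sigma> - 1 / \<sigma> = (1 - \<mu>) * kappa L \<omega>" using \<sigma>(3,4) by (simp add: algebra_simps)
      ultimately have "0 < (1 - \<mu>) * (kappa L \<omega> * kappa L \<omega>)" by (simp add: mult.assoc)
      then show False using \<mu> by (simp add: zero_less_mult_iff)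
    qed
  qed
  then show ?thesis by blast
qed

section \<open>Counting the eigenvalues in a gap\<close>

lemma phi_kappa:
  assumes "cos (\<omega> * L / 2) \<noteq> 0" "sin (\<omega> * L / 2) \<noteq> 0"
  shows "phi L \<omega> * kappa L \<omega> = 2 * sin \<omega>" "phi L \<omega> \<noteq> 0"
  using assms by (simp_all add: phi_def kappa_def tan_def)

text \<open>Substituting \<open>k = 2 S / p\<close> and \<open>C\<^sup>2 + S\<^sup>2 = 1\<close>, the difference of the two sides of the first equation is
\<open>4 S\<^sup>2 / p\<^sup>2\<close> times that of the second.\<close>

lemma dispersion_algebra:
  fixes C S p k m :: real
  assumes "p * k = 2 * S" "S \<noteq> 0" "p \<noteq> 0" "C * C + S * S = 1"
  shows "(m * k)\<^sup>2 = (2 * C - k)\<^sup>2 - 4 \<longleftrightarrow> p\<^sup>2 + 2 * (C / S) * p = 1 - m\<^sup>2"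
proof -
  define q where "q = S / p"
  have k: "k = 2 * q" using assms(1,3) by (simp add: q_def field_simps)
  have "(m * k)\<^sup>2 - ((2 * C - k)\<^sup>2 - 4) = 4 * (S * S) + 8 * C * q - 4 * q * q * (1 - m\<^sup>2)"
    using assms(4) unfolding k by algebra
  also have "\<dots> = 4 * (S / p) * (S / p) * (p\<^sup>2 + 2 * (C / S) * p - (1 - m\<^sup>2))"
    using assms(2,3) by (simp add: q_def field_simps power2_eq_square)
  finally have "(m * k)\<^sup>2 - ((2 * C - k)\<^sup>2 - 4) = 4 * (S / p) * (S / p) * (p\<^sup>2 + 2 * (C / S) * p - (1 - m\<^sup>2))" .
  moreover have "4 * (S / p) * (S / p) \<noteq> 0" using assms(2,3) by simp
  ultimately show ?thesis by (metis eq_iff_diff_eq_0 mult_eq_0_iff)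
qed

text \<open>The eigenvalue equation reads \<open>\<sigma> - 1/\<sigma> = (1 - \<mu>) k\<close>. Both sides have the sign of \<open>k\<close>, so it is equivalent to
its square, which involves \<open>\<sigma>\<close> only through \<open>(\<sigma> + 1/\<sigma>)\<^sup>2 - 4 = G\<^sup>2 - 4\<close>. If the squared equation holds then
\<open>G\<^sup>2 > 4\<close>, which puts a root strictly inside the unit disc.\<close>

lemma gap_eigenvalue_iff:
  assumes L: "0 < L" and \<mu>: "0 < \<mu>" "\<mu> < 1" and \<omega>: "0 < \<omega>"
    and sn: "sin \<omega> \<noteq> 0" and sL: "sin (\<omega> * L / 2) \<noteq> 0"
  shows "is_eigenvalue (ladder_op_sym L \<mu>) (of_real (\<omega>\<^sup>2))
      \<longleftrightarrow> (phi L \<omega>)\<^sup>2 + 2 * cot \<omega> * phi L \<omega> = 1 - (1 - \<mu>)\<^sup>2"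
    and "is_eigenvalue (ladder_op_sym L \<mu>) (of_real (\<omega>\<^sup>2)) \<Longrightarrow>
      simple_eigenvalue (ladder_op_sym L \<mu>) (of_real (\<omega>\<^sup>2))"
proof -
  let ?E = "is_eigenvalue (ladder_op_sym L \<mu>) (of_real (\<omega>\<^sup>2))"
  let ?Q = "(phi L \<omega>)\<^sup>2 + 2 * cot \<omega> * phi L \<omega> = 1 - (1 - \<mu>)\<^sup>2"
  have one: "cos \<omega> * cos \<omega> + sin \<omega> * sin \<omega> = 1"
    using sin_cos_squared_add3[of \<omega>] .
  have Q_iff: "((1 - \<mu>) * kappa L \<omega>)\<^sup>2 = (2 * cos \<omega> - kappa L \<omega>)\<^sup>2 - 4 \<longleftrightarrow> ?Q" if cs: "cos (\<omega> * L / 2) \<noteq> 0"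
    using dispersion_algebra[OF phi_kappa(1)[OF cs sL] sn phi_kappa(2)[OF cs sL] one, of "1 - \<mu>"]
    by (simp add: cot_def)
  have root_square: "(\<sigma> - 1 / \<sigma>)\<^sup>2 = (\<sigma> + 1 / \<sigma>)\<^sup>2 - 4" if "\<sigma> \<noteq> 0" for \<sigma> :: real
    using that by (simp add: field_simps power2_eq_square)
  have data: "\<exists>\<sigma>. \<sigma> \<noteq> 0 \<and> \<bar>\<sigma>\<bar> < 1 \<and> \<sigma> + 1 / \<sigma> = 2 * cos \<omega> - kappa L \<omega> \<and> 2 * \<sigma> = 2 * cos \<omega> - \<mu> * kappa L \<omega>"
    and cs: "cos (\<omega> * L / 2) \<noteq> 0" if ?E
  proof -
    show cs: "cos (\<omega> * L / 2) \<noteq> 0"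
      using eigenvalue_resonance_iff[OF L \<mu>(1) \<omega> that] sn by simp
    show "\<exists>\<sigma>. \<sigma> \<noteq> 0 \<and> \<bar>\<sigma>\<bar> < 1 \<and> \<sigma> + 1 / \<sigma> = 2 * cos \<omega> - kappa L \<omega> \<and> 2 * \<sigma> = 2 * cos \<omega> - \<mu> * kappa L \<omega>"
      by (rule nonresonant_eigenvalueE[OF L \<mu>(1) \<omega> sn cs that]) blast
  qed
  show simple: "simple_eigenvalue (ladder_op_sym L \<mu>) (of_real (\<omega>\<^sup>2))" if ?E
    using data[OF that] nonresonant_simple_eigenvalue[OF L \<mu>(1) \<omega> sn cs[OF that]] by blast
  show "?E \<longleftrightarrow> ?Q"
  proof
    assume E: ?E
    obtain \<sigma> where \<sigma>: "\<sigma> \<noteq> 0" "\<bar>\<sigma>\<bar> < 1" "\<sigma> + 1 / \<sigma> = 2 * cos \<omega> - kappa L \<omega>"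
      "2 * \<sigma> = 2 * cos \<omega> - \<mu> * kappa L \<omega>"
      using data[OF E] by blast
    have "\<sigma> - 1 / \<sigma> = (1 - \<mu>) * kappa L \<omega>" using \<sigma>(3,4) by (simp add: algebra_simps)
    then show ?Q using root_square[OF \<sigma>(1)] Q_iff[OF cs[OF E]] \<sigma>(3) by simp
  next
    assume Q: ?Q
    have "(1 - \<mu>)\<^sup>2 < 1" using \<mu> by (simp add: abs_square_less_1)
    then have "phi L \<omega> \<noteq> 0" using Q by auto
    then have cs: "cos (\<omega> * L / 2) \<noteq> 0" by (auto simp: phi_def tan_def)
    let ?k = "kappa L \<omega>"
    have k: "?k \<noteq> 0" using phi_kappa(1)[OF cs sL] sn by auto
    have G: "((1 - \<mu>) * ?k)\<^sup>2 = (2 * cos \<omega> - ?k)\<^sup>2 - 4" using Q_iff[OF cs] Q by blast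
    have pos: "0 < ((1 - \<mu>) * ?k)\<^sup>2" using k \<mu> by simp
    obtain \<rho> :: complex where \<rho>: "\<rho> \<noteq> 0" "norm \<rho> \<le> 1" "\<rho> + 1 / \<rho> = of_real (2 * cos \<omega> - ?k)"
      by (rule quadratic_root_in_unit_disc)
    have "norm \<rho> \<noteq> 1"
    proof
      assume n: "norm \<rho> = 1"
      then have "\<rho> * cnj \<rho> = 1" using complex_norm_square[of \<rho>] by simp
      then have "1 / \<rho> = cnj \<rho>" using \<rho>(1) by (simp add: divide_eq_eq mult.commute)
      then have "of_real (2 * Re \<rho>) = (of_real (2 * cos \<omega> - ?k) :: complex)"
        using \<rho>(3) complex_add_cnj[of \<rho>] by simp
      then have "2 * Re \<rho> = 2 * cos \<omega> - ?k" by (simp only: of_real_eq_iff)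
      moreover have "\<bar>Re \<rho>\<bar> \<le> 1" using abs_Re_le_cmod[of \<rho>] n by simp
      then have "(2 * Re \<rho>)\<^sup>2 \<le> 4" by (simp add: power_mult_distrib abs_square_le_1)
      ultimately show False using G pos by simp
    qed
    then have "norm \<rho> < 1" using \<rho>(2) by simp
    then obtain \<sigma> where \<sigma>: "\<sigma> \<noteq> 0" "\<bar>\<sigma>\<bar> < 1" "\<sigma> + 1 / \<sigma> = 2 * cos \<omega> - ?k"
      using real_of_quadratic_root[OF \<rho>(1) _ \<rho>(3)] by metis
    have "(\<sigma> - 1 / \<sigma>)\<^sup>2 = ((1 - \<mu>) * ?k)\<^sup>2" using root_square[OF \<sigma>(1)] \<sigma>(3) G by simp
    moreover have "\<sigma> - 1 / \<sigma> \<noteq> - ((1 - \<mu>) * ?k)"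
    proof
      assume "\<sigma> - 1 / \<sigma> = - ((1 - \<mu>) * ?k)"
      then have "(\<sigma> - 1 / \<sigma>) * ?k = - ((1 - \<mu>) * (?k * ?k))" by simp
      moreover have "0 < (\<sigma> - 1 / \<sigma>) * ?k"
        by (rule root_difference_sign[OF \<sigma>(1,2) abs_cos_le_one \<sigma>(3)])
      moreover have "0 \<le> (1 - \<mu>) * (?k * ?k)" using \<mu> by simp
      ultimately show False by linarith
    qed
    ultimately have "\<sigma> - 1 / \<sigma> = (1 - \<mu>) * ?k" by (simp add: power2_eq_iff)
    then have "2 * \<sigma> = 2 * cos \<omega> - \<mu> * ?k" using \<sigma>(3) by (simp add: algebra_simps)
    with nonresonant_simple_eigenvalue[OF L \<mu>(1) \<omega> sn cs \<sigma>]
    show ?E by (simp add: simple_eigenvalue_def)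
  qed
qed

text \<open>The roots of \<open>p\<^sup>2 + 2 p cot \<omega> = c\<close>, the larger for \<open>s = 1\<close> and the smaller for \<open>s = - 1\<close>.\<close>

definition branch :: "real \<Rightarrow> real \<Rightarrow> real \<Rightarrow> real" where
  "branch s c \<omega> = - cot \<omega> + s * sqrt ((cot \<omega>)\<^sup>2 + c)"

lemma quadratic_iff_branch:
  assumes "0 < c"
  shows "p\<^sup>2 + 2 * cot \<omega> * p = c \<longleftrightarrow> p = branch 1 c \<omega> \<or> p = branch (- 1) c \<omega>"
proof -
  have "p\<^sup>2 + 2 * cot \<omega> * p = c \<longleftrightarrow> (p + cot \<omega>)\<^sup>2 = (sqrt ((cot \<omega>)\<^sup>2 + c))\<^sup>2"
    using assms by (simp add: power2_sum algebra_simps add_nonneg_pos less_imp_le)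
  also have "\<dots> \<longleftrightarrow> p + cot \<omega> = sqrt ((cot \<omega>)\<^sup>2 + c) \<or> p + cot \<omega> = - sqrt ((cot \<omega>)\<^sup>2 + c)"
    by (rule power2_eq_iff)
  also have "\<dots> \<longleftrightarrow> p = branch 1 c \<omega> \<or> p = branch (- 1) c \<omega>" by (auto simp: branch_def)
  finally show ?thesis .
qed

lemma branch_bounds:
  assumes "0 < c"
  shows "0 < branch 1 c \<omega>" "branch (- 1) c \<omega> < 0" "- cot \<omega> < branch 1 c \<omega>" "branch (- 1) c \<omega> < - cot \<omega>"
proof -
  have "\<bar>cot \<omega>\<bar> < sqrt ((cot \<omega>)\<^sup>2 + c)" by (rule real_less_rsqrt) (use assms in simp)
  then show "0 < branch 1 c \<omega>" "branch (- 1) c \<omega> < 0" "- cot \<omega> < branch 1 c \<omega>" "branch (- 1) c \<omega> < - cot \<omega>"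
    unfolding branch_def by linarith+
qed

lemma branch_less:
  assumes "c < d" "0 < c"
  shows "branch 1 c \<omega> < branch 1 d \<omega>" "branch (- 1) d \<omega> < branch (- 1) c \<omega>"
proof -
  have "sqrt ((cot \<omega>)\<^sup>2 + c) < sqrt ((cot \<omega>)\<^sup>2 + d)" using assms by simp
  then show "branch 1 c \<omega> < branch 1 d \<omega>" "branch (- 1) d \<omega> < branch (- 1) c \<omega>"
    by (auto simp: branch_def)
qed

lemma sin_nonzero_between:
  fixes n :: int
  assumes "pi * n < x" "x < pi * (of_int n + 1)"
  shows "sin x \<noteq> 0"
proof
  assume "sin x = 0"
  then obtain i :: int where i: "x = of_int i * pi" using sin_zero_iff_int2 by blast
  have "real_of_int n < of_int i" "real_of_int i < of_int n + 1"
    using assms by (simp_all add: i mult.commute)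
  then have "n < i" "i < n + 1" by linarith+
  then show False by simp
qed

lemma cot_strict_decreasing:
  assumes xy: "x < y" and s: "\<And>t. x \<le> t \<Longrightarrow> t \<le> y \<Longrightarrow> sin t \<noteq> (0 :: real)"
  shows "cot y < cot x"
proof (rule DERIV_neg_imp_decreasing[OF xy])
  fix t assume "x \<le> t" "t \<le> y"
  then have "sin t \<noteq> 0" using s by blast
  then show "\<exists>d. (cot has_real_derivative d) (at t) \<and> d < 0" 
    by (intro exI[of _ "- inverse ((sin t)\<^sup>2)"]) simp
qed

text \<open>The map \<open>x \<mapsto> sqrt (x\<^sup>2 + c)\<close> is a strict contraction for \<open>c > 0\<close>, so its contribution of either sign cannot
offset the growth of \<open>- cot\<close>.\<close>

lemma branch_strict_increasing:
  assumes c: "0 < c" and s: "\<bar>s\<bar> = 1" and xy: "cot y < cot x"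
  shows "branch s c x < branch s c y"
proof -
  define p q where "p = sqrt ((cot x)\<^sup>2 + c)" and "q = sqrt ((cot y)\<^sup>2 + c)"
  have pq: "p\<^sup>2 = (cot x)\<^sup>2 + c" "q\<^sup>2 = (cot y)\<^sup>2 + c" using c by (simp_all add: p_def q_def add_nonneg_pos less_imp_le)
  have "\<bar>cot x\<bar> < p" "\<bar>cot y\<bar> < q" unfolding p_def q_def by (rule real_less_rsqrt, use c in simp)+
  then have sum: "\<bar>cot x + cot y\<bar> < p + q" by linarith
  have diff: "(p - q) * (p + q) = (cot x - cot y) * (cot x + cot y)"
    using pq by (simp add: algebra_simps power2_eq_square)
  have "\<bar>p - q\<bar> * (p + q) = (cot x - cot y) * \<bar>cot x + cot y\<bar>"
    using arg_cong[OF diff, of abs] sum xy by (simp add: abs_mult)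
  also have "\<dots> < (cot x - cot y) * (p + q)" using sum xy by simp
  finally have "\<bar>p - q\<bar> < cot x - cot y" using sum by (simp add: mult_less_cancel_right)
  moreover have "s = 1 \<or> s = - 1" using s by linarith
  ultimately show ?thesis by (auto simp: branch_def p_def q_def)
qed

lemma avoids_poles_sin:
  assumes "0 < L" "avoids_poles L x y" "x \<le> t" "t \<le> y"
  shows "sin (t * L / 2) \<noteq> 0"
proof
  assume "sin (t * L / 2) = 0"
  then obtain k :: int where "t * L / 2 = of_int k * pi" using sin_zero_iff_int2 by blast
  then have "t = 2 * pi / L * of_int k" using assms(1) by (simp add: field_simps)
  then show False using assms unfolding avoids_poles_def by auto
qed

lemma phi_cot: "phi L x = 2 * cot (x * L / 2)"
  unfolding phi_def cot_altdef divide_inverse by (rule refl)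

lemma phi_strict_decreasing:
  assumes L: "0 < L" and xy: "x < y" and ap: "\<And>t. x \<le> t \<Longrightarrow> t \<le> y \<Longrightarrow> sin (t * L / 2) \<noteq> 0"
  shows "phi L y < phi L x"
proof -
  have "cot (y * L / 2) < cot (x * L / 2)"
  proof (rule cot_strict_decreasing)
    show "x * L / 2 < y * L / 2" using L xy by simp
    fix t assume "x * L / 2 \<le> t" "t \<le> y * L / 2"
    then have "x \<le> t * 2 / L" "t * 2 / L \<le> y" using L by (simp_all add: field_simps)
    then show "sin t \<noteq> 0" using ap[of "t * 2 / L"] L by simp
  qed
  then show ?thesis by (simp add: phi_cot)
qed

lemma mismatch_decreasing:
  assumes L: "0 < L" and c: "0 < c" and s: "\<bar>s\<bar> = 1" and xy: "x < y"
    and reg: "\<And>t. x \<le> t \<Longrightarrow> t \<le> y \<Longrightarrow> sin t \<noteq> 0 \<and> sin (t * L / 2) \<noteq> 0"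
  shows "phi L y - branch s c y < phi L x - branch s c x"
proof -
  have "phi L y < phi L x" by (rule phi_strict_decreasing[OF L xy]) (use reg in blast)
  moreover have "branch s c x < branch s c y"
    by (intro branch_strict_increasing[OF c s] cot_strict_decreasing[OF xy]) (use reg in blast)
  ultimately show ?thesis by linarith
qed

lemma branch_crossed:
  assumes L: "0 < L" and c: "0 < c" and xy: "x < y"
    and reg: "\<And>t. x \<le> t \<Longrightarrow> t \<le> y \<Longrightarrow> sin t \<noteq> 0 \<and> sin (t * L / 2) \<noteq> 0"
    and x: "branch s c x < phi L x" and y: "phi L y < branch s c y"
  shows "\<exists>t. x < t \<and> t < y \<and> phi L t = branch s c t"
proof -
  define f where "f t = phi L t - branch s c t" for t
  have "continuous_on {x..y} f"
    unfolding f_def phi_cot branch_def by (intro continuous_intros) (use reg in simp_all)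
  moreover have "f y \<le> 0" "0 \<le> f x" "x \<le> y" using x y xy by (simp_all add: f_def)
  ultimately obtain t where t: "x \<le> t" "t \<le> y" "f t = 0"
    using IVT2'[of f y 0 x] by blast
  have "t \<noteq> x" "t \<noteq> y" using t(3) x y by (auto simp: f_def)
  then show ?thesis using t by (intro exI[of _ t]) (simp add: f_def)
qed

lemma cot_add_int_pi: "cot (x + of_int n * pi) = cot (x :: real)"
proof -
  have "sin (of_int n * pi) = (0 :: real)" using sin_zero_iff_int2 by blast
  moreover from this have "cos (of_int n * pi) \<noteq> (0 :: real)"
    using sin_zero_abs_cos_one[of "of_int n * pi"] by auto
  ultimately show ?thesis unfolding cot_def sin_add cos_add by simp
qed

text \<open>Half-angle formulas: \<open>tan (\<theta>/2)\<close> and \<open>- 1 / tan (\<theta>/2)\<close> have product \<open>- 1\<close> and sum \<open>- 2 cot \<theta>\<close>.\<close>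

lemma f_plus_f_minus_branch:
  fixes n :: int
  assumes "pi * n < x" "x < pi * (of_int n + 1)"
  shows "f_plus x = branch 1 1 x" "f_minus x = branch (- 1) 1 x"
proof -
  define \<theta> where "\<theta> = x - pi * n"
  have \<theta>: "0 < \<theta>" "\<theta> < pi" using assms by (auto simp: \<theta>_def algebra_simps)
  have "real_of_int n < x / pi" "x / pi < real_of_int n + 1"
    using assms by (simp_all add: field_simps)
  then have fl: "\<lfloor>x / pi\<rfloor> = n" by linarith
  have sp: "0 < sin (\<theta> / 2)" "0 < cos (\<theta> / 2)" using \<theta> by (auto intro: sin_gt_zero cos_gt_zero)
  have cot: "cot x = cos \<theta> / sin \<theta>"
    using cot_add_int_pi[of \<theta> n] by (simp add: \<theta>_def cot_def mult.commute)
  have "sin \<theta> = 2 * sin (\<theta> / 2) * cos (\<theta> / 2)" "cos \<theta> = (cos (\<theta> / 2))\<^sup>2 - (sin (\<theta> / 2))\<^sup>2"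
    using sin_double[of "\<theta> / 2"] cos_double[of "\<theta> / 2"] by simp_all
  then have cot2: "cot x = (1 / tan (\<theta> / 2) - tan (\<theta> / 2)) / 2"
    unfolding cot using sp by (simp add: tan_def field_simps power2_eq_square)
  have t: "0 < tan (\<theta> / 2)" using sp by (simp add: tan_def)
  have "(cot x)\<^sup>2 + 1 = ((1 / tan (\<theta> / 2) + tan (\<theta> / 2)) / 2)\<^sup>2"
    unfolding cot2 using t by (simp add: field_simps power2_eq_square)
  then have sq: "sqrt ((cot x)\<^sup>2 + 1) = (1 / tan (\<theta> / 2) + tan (\<theta> / 2)) / 2"
    using t by (simp add: real_sqrt_unique)
  show "f_plus x = branch 1 1 x" "f_minus x = branch (- 1) 1 x"
    unfolding f_plus_def f_minus_def fl branch_def sq unfolding cot2 \<theta>_def[symmetric]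
    by (simp_all add: field_simps)
qed

lemma cot_large_right:
  fixes n :: int
  assumes "pi * n < y"
  shows "\<exists>x. pi * n < x \<and> x < y \<and> x < pi * (of_int n + 1) \<and> K < cot x"
proof -
  define h where "h = arctan (1 / (\<bar>K\<bar> + 1))"
  have h: "0 < h" "h < pi / 2" "tan h = 1 / (\<bar>K\<bar> + 1)"
    unfolding h_def by (simp add: zero_less_arctan_iff, rule arctan_ubound, rule tan_arctan)
  \<comment> \<open>the first bound makes the cotangent at least \<open>|K| + 1\<close>, the second keeps the point below \<open>y\<close>\<close>
  define \<delta> where "\<delta> = min h ((y - pi * n) / 2)"
  have "0 < (y - pi * n) / 2" using assms by simp
  then have \<delta>: "0 < \<delta>" "\<delta> \<le> h" "\<delta> \<le> (y - pi * n) / 2"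
    using h(1) unfolding \<delta>_def by linarith+
  have tp: "0 < tan \<delta>" using \<delta> h by (intro tan_gt_zero) linarith+
  have "tan \<delta> \<le> tan h"
    using \<delta> h by (intro tan_mono_le) linarith+
  then have "tan \<delta> \<le> 1 / (\<bar>K\<bar> + 1)" unfolding h(3) .
  then have "inverse (1 / (\<bar>K\<bar> + 1)) \<le> inverse (tan \<delta>)" using tp by (rule le_imp_inverse_le)
  then have "\<bar>K\<bar> + 1 \<le> cot \<delta>" unfolding cot_altdef by simp
  then have "K < cot (\<delta> + of_int n * pi)" unfolding cot_add_int_pi by linarith
  moreover have "pi * n < \<delta> + of_int n * pi" using \<delta>(1) by (simp add: mult.commute)
  moreover have "\<delta> + of_int n * pi < y"
    using \<delta>(3) \<open>0 < (y - pi * n) / 2\<close> by (simp add: mult.commute)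
  moreover have "\<delta> + of_int n * pi < pi * (of_int n + 1)"
  proof -
    have "\<delta> < pi" using \<delta>(2) h(2) pi_gt_zero by linarith
    then show ?thesis by (simp add: distrib_left mult.commute)
  qed
  ultimately show ?thesis by blast
qed

lemma cot_large_left:
  fixes n :: int
  assumes "y < pi * (of_int n + 1)"
  shows "\<exists>x. y < x \<and> pi * n < x \<and> x < pi * (of_int n + 1) \<and> cot x < - K"
proof -
  define m where "m = - (n + 1)"
  have e: "real_of_int n + 1 = - of_int m" "real_of_int m + 1 = - of_int n" by (simp_all add: m_def)
  have "pi * m < - y" using assms unfolding e mult_minus_right by linarith
  from cot_large_right[OF this, of K] obtain x where
    x: "pi * m < x" "x < - y" "x < pi * (of_int m + 1)" "K < cot x"
    by blast
  have "y < - x" "cot (- x) < - K" using x(2,4) cot_minus[of x] by linarith+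
  moreover have "- x < pi * (of_int n + 1)" using x(1) unfolding e mult_minus_right by linarith
  moreover have "pi * n < - x" using x(3) unfolding e mult_minus_right by linarith
  ultimately show ?thesis by blast
qed
lemma gap_eigenvalue_iff_branch:
  assumes L: "0 < L" and \<mu>: "0 < \<mu>" "\<mu> < 1" and \<omega>: "0 < \<omega>"
    and reg: "sin \<omega> \<noteq> 0" "sin (\<omega> * L / 2) \<noteq> 0"
  shows "is_eigenvalue (ladder_op_sym L \<mu>) (of_real (\<omega>\<^sup>2)) \<longleftrightarrow>
    phi L \<omega> = branch 1 (1 - (1 - \<mu>)\<^sup>2) \<omega> \<or> phi L \<omega> = branch (- 1) (1 - (1 - \<mu>)\<^sup>2) \<omega>"
proof -
  have "0 < 1 - (1 - \<mu>)\<^sup>2" using \<mu> by (simp add: abs_square_less_1)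
  then show ?thesis
    unfolding gap_eigenvalue_iff(1)[OF L \<mu> \<omega> reg] by (rule quadratic_iff_branch)
qed

text \<open>Existence is the intermediate value theorem on \<open>[p, q]\<close>, uniqueness the monotonicity of \<open>phi L - branch s c\<close> on
the possibly larger interval \<open>(l, u)\<close>. The two intervals differ when the branch blows up at an end of the
gap.\<close>

lemma branch_crossed_once:
  assumes L: "0 < L" and c: "0 < c" and s: "\<bar>s\<bar> = 1"
    and reg: "\<And>t. l < t \<Longrightarrow> t < u \<Longrightarrow> sin t \<noteq> 0 \<and> sin (t * L / 2) \<noteq> 0"
    and pq: "l \<le> p" "p < q" "q \<le> u"
    and reg': "\<And>t. p \<le> t \<Longrightarrow> t \<le> q \<Longrightarrow> sin t \<noteq> 0 \<and> sin (t * L / 2) \<noteq> 0"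
    and sign: "branch s c p < phi L p" "phi L q < branch s c q"
  shows "\<exists>\<omega>. l < \<omega> \<and> \<omega> < u \<and> {t. l < t \<and> t < u \<and> phi L t = branch s c t} = {\<omega>}"
proof -
  obtain \<omega> where \<omega>: "p < \<omega>" "\<omega> < q" "phi L \<omega> = branch s c \<omega>"
    using branch_crossed[OF L c pq(2) reg' sign] by blast
  have lu: "l < \<omega>" "\<omega> < u" using \<omega> pq by linarith+
  have "t = \<omega>" if t: "l < t" "t < u" "phi L t = branch s c t" for t
  proof (rule ccontr)
    assume "t \<noteq> \<omega>"
    then consider "t < \<omega>" | "\<omega> < t" by linarith
    then show False
    proof cases
      case 1
      have "phi L \<omega> - branch s c \<omega> < phi L t - branch s c t"
        by (rule mismatch_decreasing[OF L c s 1]) (rule reg; use t lu in linarith)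
      then show False using t \<omega> by simp
    next
      case 2
      have "phi L t - branch s c t < phi L \<omega> - branch s c \<omega>"
        by (rule mismatch_decreasing[OF L c s 2]) (rule reg; use t lu in linarith)
      then show False using t \<omega> by simp
    qed
  qed
  then have "{t. l < t \<and> t < u \<and> phi L t = branch s c t} = {\<omega>}" using lu \<omega>(3) by blast
  then show ?thesis using lu by blast
qed

text \<open>At the bottom \<open>phi\<close> equals the upper branch for parameter 1 and lies above both branches for \<open>c\<close>; at the top
it equals the lower branch for parameter 1 and lies below both. The upper branch is positive and the lower one
negative, so the decreasing function \<open>phi\<close> meets the upper one first.\<close>

lemma type_i_crossings:
  assumes L: "0 < L" and c: "0 < c" "c < 1" and gap: "gap_type_i L \<omega>b \<omega>t"
  shows "\<exists>\<omega>1 \<omega>2. \<omega>b < \<omega>1 \<and> \<omega>1 < \<omega>2 \<and> \<omega>2 < \<omega>t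
    \<and> {t. \<omega>b < t \<and> t < \<omega>t \<and> phi L t = branch 1 c t} = {\<omega>1}
    \<and> {t. \<omega>b < t \<and> t < \<omega>t \<and> phi L t = branch (- 1) c t} = {\<omega>2}"
proof -
  obtain n :: int where ap: "avoids_poles L \<omega>b \<omega>t" and bt: "\<omega>b < \<omega>t"
    and n: "pi * n < \<omega>b" "\<omega>t < pi * (of_int n + 1)" "phi L \<omega>b = f_plus \<omega>b" "phi L \<omega>t = f_minus \<omega>t"
    using gap unfolding gap_type_i_def by (elim conjE exE) (rule that)
  have reg: "sin t \<noteq> 0 \<and> sin (t * L / 2) \<noteq> 0" if t: "\<omega>b \<le> t" "t \<le> \<omega>t" for t
  proof
    show "sin t \<noteq> 0" by (rule sin_nonzero_between[of n]) (use t n in linarith)+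
    show "sin (t * L / 2) \<noteq> 0" by (rule avoids_poles_sin[OF L ap t])
  qed
  have b: "phi L \<omega>b = branch 1 1 \<omega>b"
    unfolding n(3) by (rule f_plus_f_minus_branch(1)[of n]) (use n bt in linarith)+
  have t: "phi L \<omega>t = branch (- 1) 1 \<omega>t"
    unfolding n(4) by (rule f_plus_f_minus_branch(2)[of n]) (use n bt in linarith)+
  have up: "branch 1 c \<omega>b < phi L \<omega>b" "branch (- 1) c \<omega>b < phi L \<omega>b"
    using b branch_less(1)[OF c(2,1), of \<omega>b] branch_bounds(1,2)[OF c(1), of \<omega>b] by linarith+
  have dn: "phi L \<omega>t < branch 1 c \<omega>t" "phi L \<omega>t < branch (- 1) c \<omega>t"
    using t branch_less(2)[OF c(2,1), of \<omega>t] branch_bounds(1,2)[OF c(1), of \<omega>t] by linarith+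
  have "\<exists>\<omega>. \<omega>b < \<omega> \<and> \<omega> < \<omega>t \<and> {t. \<omega>b < t \<and> t < \<omega>t \<and> phi L t = branch 1 c t} = {\<omega>}"
  proof (rule branch_crossed_once[OF L c(1), where p = "\<omega>b" and q = "\<omega>t"])
    show "sin t \<noteq> 0 \<and> sin (t * L / 2) \<noteq> 0" if "\<omega>b < t" "t < \<omega>t" for t
      by (rule reg) (use that in linarith)+
    show "sin t \<noteq> 0 \<and> sin (t * L / 2) \<noteq> 0" if "\<omega>b \<le> t" "t \<le> \<omega>t" for t
      by (rule reg) (use that bt in linarith)+
  qed (use bt up dn in simp_all)
  then obtain \<omega>1 where \<omega>1: "\<omega>b < \<omega>1" "\<omega>1 < \<omega>t" "{t. \<omega>b < t \<and> t < \<omega>t \<and> phi L t = branch 1 c t} = {\<omega>1}"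
    by (elim exE conjE) (rule that)
  have "\<exists>\<omega>. \<omega>b < \<omega> \<and> \<omega> < \<omega>t \<and> {t. \<omega>b < t \<and> t < \<omega>t \<and> phi L t = branch (- 1) c t} = {\<omega>}"
  proof (rule branch_crossed_once[OF L c(1), where p = "\<omega>b" and q = "\<omega>t"])
    show "sin t \<noteq> 0 \<and> sin (t * L / 2) \<noteq> 0" if "\<omega>b < t" "t < \<omega>t" for t
      by (rule reg) (use that in linarith)+
    show "sin t \<noteq> 0 \<and> sin (t * L / 2) \<noteq> 0" if "\<omega>b \<le> t" "t \<le> \<omega>t" for t
      by (rule reg) (use that bt in linarith)+
  qed (use bt up dn in simp_all)
  then obtain \<omega>2 where \<omega>2: "\<omega>b < \<omega>2" "\<omega>2 < \<omega>t" "{t. \<omega>b < t \<and> t < \<omega>t \<and> phi L t = branch (- 1) c t} = {\<omega>2}"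
    by (elim exE conjE) (rule that)
  have "\<omega>1 \<in> {t. \<omega>b < t \<and> t < \<omega>t \<and> phi L t = branch 1 c t}"
    "\<omega>2 \<in> {t. \<omega>b < t \<and> t < \<omega>t \<and> phi L t = branch (- 1) c t}"
    unfolding \<omega>1(3) \<omega>2(3) by simp_all
  then have "phi L \<omega>1 = branch 1 c \<omega>1" "phi L \<omega>2 = branch (- 1) c \<omega>2" by simp_all
  then have "phi L \<omega>2 < phi L \<omega>1"
    using branch_bounds(1)[OF c(1), of \<omega>1] branch_bounds(2)[OF c(1), of \<omega>2] by linarith
  have "\<omega>1 < \<omega>2"
  proof (rule ccontr)
    assume "\<not> \<omega>1 < \<omega>2"
    moreover have "\<omega>1 \<noteq> \<omega>2" using \<open>phi L \<omega>2 < phi L \<omega>1\<close> by auto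
    ultimately have lt: "\<omega>2 < \<omega>1" by linarith
    have "phi L \<omega>1 < phi L \<omega>2"
    proof (rule phi_strict_decreasing[OF L lt])
      fix t assume "\<omega>2 \<le> t" "t \<le> \<omega>1"
      then have "\<omega>b \<le> t" "t \<le> \<omega>t" using \<omega>1(2) \<omega>2(1) by linarith+
      then show "sin (t * L / 2) \<noteq> 0" using reg by blast
    qed
    then show False using \<open>phi L \<omega>2 < phi L \<omega>1\<close> by linarith
  qed
  then show ?thesis
    by (intro exI[of _ \<omega>1] exI[of _ \<omega>2] conjI \<omega>1 \<omega>2)
qed

text \<open>At the bottom \<open>\<pi> n\<close> of the gap \<open>cot\<close> tends to \<open>\<infinity>\<close>, so the lower branch tends to \<open>- \<infinity>\<close> and starts below
\<open>phi\<close>; it ends above \<open>phi\<close>. Since \<open>phi\<close> is negative throughout, the positive upper branch is never met.\<close>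

lemma type_ii_crossings:
  assumes L: "0 < L" and c: "0 < c" "c < 1" and gap: "gap_type_ii L \<omega>b \<omega>t"
  shows "\<exists>\<omega>. \<omega>b < \<omega> \<and> \<omega> < \<omega>t
    \<and> {t. \<omega>b < t \<and> t < \<omega>t \<and> phi L t = branch (- 1) c t} = {\<omega>}"
    and "{t. \<omega>b < t \<and> t < \<omega>t \<and> phi L t = branch 1 c t} = {}"
proof -
  obtain n :: int where ap: "avoids_poles L \<omega>b \<omega>t" and bt: "\<omega>b < \<omega>t"
    and n: "pi * n = \<omega>b" "\<omega>t < pi * (of_int n + 1)" "phi L \<omega>b \<le> 0" "phi L \<omega>t = f_minus \<omega>t"
    using gap unfolding gap_type_ii_def by (elim conjE exE) (rule that)
  have regL: "sin (t * L / 2) \<noteq> 0" if t: "\<omega>b \<le> t" "t \<le> \<omega>t" for t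
    by (rule avoids_poles_sin[OF L ap t])
  have reg: "sin t \<noteq> 0 \<and> sin (t * L / 2) \<noteq> 0" if t: "\<omega>b < t" "t \<le> \<omega>t" for t
  proof
    show "sin t \<noteq> 0" by (rule sin_nonzero_between[of n]) (use t n in linarith)+
    show "sin (t * L / 2) \<noteq> 0" by (rule regL) (use t in simp_all)
  qed
  have "phi L \<omega>t = branch (- 1) 1 \<omega>t"
    unfolding n(4) by (rule f_plus_f_minus_branch(2)[of n]) (use n bt in linarith)+
  then have dn: "phi L \<omega>t < branch (- 1) c \<omega>t" using branch_less(2)[OF c(2,1), of \<omega>t] by linarith
  have "pi * n < \<omega>t" using n(1) bt by linarith
  from cot_large_right[OF this, of "- phi L \<omega>t"] obtain x where
    x: "\<omega>b < x" "x < \<omega>t" "- phi L \<omega>t < cot x" unfolding n(1) by blast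
  have "phi L \<omega>t < phi L x"
    by (rule phi_strict_decreasing[OF L x(2)], rule regL) (use x in linarith)+
  then have up: "branch (- 1) c x < phi L x"
    using branch_bounds(4)[OF c(1), of x] x(3) by linarith
  show "\<exists>\<omega>. \<omega>b < \<omega> \<and> \<omega> < \<omega>t \<and> {t. \<omega>b < t \<and> t < \<omega>t \<and> phi L t = branch (- 1) c t} = {\<omega>}"
  proof (rule branch_crossed_once[OF L c(1), where p = "x" and q = "\<omega>t"])
    show "sin t \<noteq> 0 \<and> sin (t * L / 2) \<noteq> 0" if "\<omega>b < t" "t < \<omega>t" for t
      by (rule reg) (use that in linarith)+
    show "sin t \<noteq> 0 \<and> sin (t * L / 2) \<noteq> 0" if "x \<le> t" "t \<le> \<omega>t" for t
      by (rule reg) (use that x in linarith)+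
  qed (use x up dn in simp_all)
  have "phi L t < branch 1 c t" if t: "\<omega>b < t" "t < \<omega>t" for t
  proof -
    have "phi L t < phi L \<omega>b"
      by (rule phi_strict_decreasing[OF L t(1)], rule regL) (use t in linarith)+
    then show ?thesis using n(3) branch_bounds(1)[OF c(1), of t] by linarith
  qed
  then show "{t. \<omega>b < t \<and> t < \<omega>t \<and> phi L t = branch 1 c t} = {}" by fastforce
qed

text \<open>Mirror image of type (ii): at the top of the gap \<open>- cot\<close> tends to \<open>\<infinity>\<close>, and with it the upper branch, while
\<open>phi\<close> is positive throughout and stays away from the lower branch.\<close>

lemma type_iii_crossings:
  assumes L: "0 < L" and c: "0 < c" "c < 1" and gap: "gap_type_iii L \<omega>b \<omega>t"
  shows "\<exists>\<omega>. \<omega>b < \<omega> \<and> \<omega> < \<omega>t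
    \<and> {t. \<omega>b < t \<and> t < \<omega>t \<and> phi L t = branch 1 c t} = {\<omega>}"
    and "{t. \<omega>b < t \<and> t < \<omega>t \<and> phi L t = branch (- 1) c t} = {}"
proof -
  obtain n :: int where ap: "avoids_poles L \<omega>b \<omega>t" and bt: "\<omega>b < \<omega>t"
    and n: "pi * n < \<omega>b" "\<omega>t = pi * (of_int n + 1)" "phi L \<omega>b = f_plus \<omega>b" "phi L \<omega>t \<ge> 0"
    using gap unfolding gap_type_iii_def by (elim conjE exE) (rule that)
  have regL: "sin (t * L / 2) \<noteq> 0" if t: "\<omega>b \<le> t" "t \<le> \<omega>t" for t
    by (rule avoids_poles_sin[OF L ap t])
  have reg: "sin t \<noteq> 0 \<and> sin (t * L / 2) \<noteq> 0" if t: "\<omega>b \<le> t" "t < \<omega>t" for t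
  proof
    show "sin t \<noteq> 0" by (rule sin_nonzero_between[of n]) (use t n in linarith)+
    show "sin (t * L / 2) \<noteq> 0" by (rule regL) (use t in simp_all)
  qed
  have "phi L \<omega>b = branch 1 1 \<omega>b"
    unfolding n(3) by (rule f_plus_f_minus_branch(1)[of n]) (use n bt in linarith)+
  then have up: "branch 1 c \<omega>b < phi L \<omega>b" using branch_less(1)[OF c(2,1), of \<omega>b] by linarith
  have "\<omega>b < pi * (of_int n + 1)" using n(2) bt by linarith
  from cot_large_left[OF this, of "phi L \<omega>b"] obtain x where
    x: "\<omega>b < x" "x < \<omega>t" "cot x < - phi L \<omega>b" unfolding n(2)[symmetric] by blast
  have "phi L x < phi L \<omega>b"
    by (rule phi_strict_decreasing[OF L x(1)], rule regL) (use x in linarith)+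
  then have dn: "phi L x < branch 1 c x"
    using branch_bounds(3)[OF c(1), of x] x(3) by linarith
  show "\<exists>\<omega>. \<omega>b < \<omega> \<and> \<omega> < \<omega>t \<and> {t. \<omega>b < t \<and> t < \<omega>t \<and> phi L t = branch 1 c t} = {\<omega>}"
  proof (rule branch_crossed_once[OF L c(1), where p = "\<omega>b" and q = "x"])
    show "sin t \<noteq> 0 \<and> sin (t * L / 2) \<noteq> 0" if "\<omega>b < t" "t < \<omega>t" for t
      by (rule reg) (use that in linarith)+
    show "sin t \<noteq> 0 \<and> sin (t * L / 2) \<noteq> 0" if "\<omega>b \<le> t" "t \<le> x" for t
      by (rule reg) (use that x in linarith)+
  qed (use x up dn in simp_all)
  have "branch (- 1) c t < phi L t" if t: "\<omega>b < t" "t < \<omega>t" for t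
  proof -
    have "phi L \<omega>t < phi L t"
      by (rule phi_strict_decreasing[OF L t(2)], rule regL) (use t in linarith)+
    then show ?thesis using n(4) branch_bounds(2)[OF c(1), of t] by linarith
  qed
  then show "{t. \<omega>b < t \<and> t < \<omega>t \<and> phi L t = branch (- 1) c t} = {}" by fastforce
qed

lemma gap_regular:
  assumes L: "0 < L" and gap: "gap_type_i L \<omega>b \<omega>t \<or> gap_type_ii L \<omega>b \<omega>t \<or> gap_type_iii L \<omega>b \<omega>t"
    and t: "\<omega>b < t" "t < \<omega>t"
  shows "sin t \<noteq> 0" "sin (t * L / 2) \<noteq> 0"
proof -
  have "\<exists>n :: int. pi * n \<le> \<omega>b \<and> \<omega>t \<le> pi * (of_int n + 1) \<and> avoids_poles L \<omega>b \<omega>t"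
    using gap unfolding gap_type_i_def gap_type_ii_def gap_type_iii_def
  proof (elim disjE conjE exE)
    fix n :: int
    assume "avoids_poles L \<omega>b \<omega>t" "pi * of_int n < \<omega>b" "\<omega>t < pi * (of_int n + 1)"
    then show "\<exists>n :: int. pi * n \<le> \<omega>b \<and> \<omega>t \<le> pi * (of_int n + 1) \<and> avoids_poles L \<omega>b \<omega>t" by (intro exI[of _ n]) simp
  next
    fix n :: int
    assume "avoids_poles L \<omega>b \<omega>t" "pi * of_int n = \<omega>b" "\<omega>t < pi * (of_int n + 1)"
    then show "\<exists>n :: int. pi * n \<le> \<omega>b \<and> \<omega>t \<le> pi * (of_int n + 1) \<and> avoids_poles L \<omega>b \<omega>t" by (intro exI[of _ n]) simp
  next
    fix n :: int
    assume "avoids_poles L \<omega>b \<omega>t" "pi * of_int n < \<omega>b" "\<omega>t = pi * (of_int n + 1)"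
    then show "\<exists>n :: int. pi * n \<le> \<omega>b \<and> \<omega>t \<le> pi * (of_int n + 1) \<and> avoids_poles L \<omega>b \<omega>t" by (intro exI[of _ n]) simp
  qed
  then obtain n :: int where n: "pi * n \<le> \<omega>b" "\<omega>t \<le> pi * (of_int n + 1)" and ap: "avoids_poles L \<omega>b \<omega>t"
    by (elim conjE exE) (rule that)
  show "sin t \<noteq> 0" by (rule sin_nonzero_between[of n]) (use t n in linarith)+
  show "sin (t * L / 2) \<noteq> 0" by (rule avoids_poles_sin[OF L ap]) (use t in simp_all)
qed

lemma eigenvalues_between:
  assumes "0 \<le> \<omega>b" and lt: "\<omega>b < \<omega>t"
  shows "{\<nu>::real. \<omega>b\<^sup>2 < \<nu> \<and> \<nu> < \<omega>t\<^sup>2 \<and> P \<nu>} = power2 ` {\<omega>. \<omega>b < \<omega> \<and> \<omega> < \<omega>t \<and> P (\<omega>\<^sup>2)}"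
proof (intro equalityI subsetI)
  fix \<nu> assume "\<nu> \<in> {\<nu>. \<omega>b\<^sup>2 < \<nu> \<and> \<nu> < \<omega>t\<^sup>2 \<and> P \<nu>}"
  then have \<nu>: "\<omega>b\<^sup>2 < \<nu>" "\<nu> < \<omega>t\<^sup>2" "P \<nu>" by simp_all
  have n: "0 \<le> \<nu>" using \<nu>(1) zero_le_power2[of \<omega>b] by linarith
  have "\<omega>b < sqrt \<nu>" using \<nu>(1) by (rule real_less_rsqrt)
  moreover have "sqrt \<nu> < \<omega>t" using real_sqrt_less_mono[OF \<nu>(2)] assms by simp
  moreover have "\<nu> = (sqrt \<nu>)\<^sup>2" using n by simp
  ultimately show "\<nu> \<in> power2 ` {\<omega>. \<omega>b < \<omega> \<and> \<omega> < \<omega>t \<and> P (\<omega>\<^sup>2)}"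
    using \<nu>(3) by (intro image_eqI[of _ _ "sqrt \<nu>"]) simp_all
next
  fix \<nu> assume "\<nu> \<in> power2 ` {\<omega>. \<omega>b < \<omega> \<and> \<omega> < \<omega>t \<and> P (\<omega>\<^sup>2)}"
  then obtain \<omega> where \<omega>: "\<nu> = \<omega>\<^sup>2" "\<omega>b < \<omega>" "\<omega> < \<omega>t" "P (\<omega>\<^sup>2)" by blast
  have "\<omega>b\<^sup>2 < \<omega>\<^sup>2" "\<omega>\<^sup>2 < \<omega>t\<^sup>2" using assms \<omega> by (simp_all add: power_strict_mono)
  then show "\<nu> \<in> {\<nu>. \<omega>b\<^sup>2 < \<nu> \<and> \<nu> < \<omega>t\<^sup>2 \<and> P \<nu>}" using \<omega> by simp
qed

lemma gap_eigenvalues: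
  assumes L: "0 < L" and \<mu>: "0 < \<mu>" "\<mu> < 1" and b: "0 \<le> \<omega>b" "\<omega>b < \<omega>t"
    and gap: "gap_type_i L \<omega>b \<omega>t \<or> gap_type_ii L \<omega>b \<omega>t \<or> gap_type_iii L \<omega>b \<omega>t"
  defines "B s \<equiv> {t. \<omega>b < t \<and> t < \<omega>t \<and> phi L t = branch s (1 - (1 - \<mu>)\<^sup>2) t}"
  shows "{\<nu>::real. \<omega>b\<^sup>2 < \<nu> \<and> \<nu> < \<omega>t\<^sup>2 \<and> is_eigenvalue (ladder_op_sym L \<mu>) (complex_of_real \<nu>)}
      = power2 ` (B 1 \<union> B (- 1))"
    and "\<omega> \<in> B 1 \<union> B (- 1) \<Longrightarrow> simple_eigenvalue (ladder_op_sym L \<mu>) (complex_of_real (\<omega>\<^sup>2))"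
proof -
  have iff: "is_eigenvalue (ladder_op_sym L \<mu>) (complex_of_real (t\<^sup>2)) \<longleftrightarrow> t \<in> B 1 \<union> B (- 1)"
    and simple: "is_eigenvalue (ladder_op_sym L \<mu>) (complex_of_real (t\<^sup>2)) \<Longrightarrow>
      simple_eigenvalue (ladder_op_sym L \<mu>) (complex_of_real (t\<^sup>2))"
    if t: "\<omega>b < t" "t < \<omega>t" for t
  proof -
    have t0: "0 < t" using t(1) b(1) by linarith
    note reg = gap_regular[OF L gap t]
    show "is_eigenvalue (ladder_op_sym L \<mu>) (complex_of_real (t\<^sup>2)) \<longleftrightarrow> t \<in> B 1 \<union> B (- 1)"
      unfolding gap_eigenvalue_iff_branch[OF L \<mu> t0 reg] B_def using t by blast
    show "is_eigenvalue (ladder_op_sym L \<mu>) (complex_of_real (t\<^sup>2)) \<Longrightarrow>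
      simple_eigenvalue (ladder_op_sym L \<mu>) (complex_of_real (t\<^sup>2))"
      by (rule gap_eigenvalue_iff(2)[OF L \<mu> t0 reg])
  qed
  have "{\<omega>. \<omega>b < \<omega> \<and> \<omega> < \<omega>t \<and> is_eigenvalue (ladder_op_sym L \<mu>) (complex_of_real (\<omega>\<^sup>2))} = B 1 \<union> B (- 1)"
  proof (intro equalityI subsetI)
    fix t assume "t \<in> {\<omega>. \<omega>b < \<omega> \<and> \<omega> < \<omega>t \<and> is_eigenvalue (ladder_op_sym L \<mu>) (complex_of_real (\<omega>\<^sup>2))}"
    then show "t \<in> B 1 \<union> B (- 1)" using iff[of t] by blast
  next
    fix t assume t: "t \<in> B 1 \<union> B (- 1)"
    then have "\<omega>b < t" "t < \<omega>t" by (auto simp: B_def)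
    then show "t \<in> {\<omega>. \<omega>b < \<omega> \<and> \<omega> < \<omega>t \<and> is_eigenvalue (ladder_op_sym L \<mu>) (complex_of_real (\<omega>\<^sup>2))}"
      using iff[of t] t by blast
  qed
  then show "{\<nu>::real. \<omega>b\<^sup>2 < \<nu> \<and> \<nu> < \<omega>t\<^sup>2 \<and> is_eigenvalue (ladder_op_sym L \<mu>) (complex_of_real \<nu>)}
      = power2 ` (B 1 \<union> B (- 1))"
    using eigenvalues_between[OF b, of "\<lambda>\<nu>. is_eigenvalue (ladder_op_sym L \<mu>) (complex_of_real \<nu>)"] by simp
  assume w: "\<omega> \<in> B 1 \<union> B (- 1)"
  then have "\<omega>b < \<omega>" "\<omega> < \<omega>t" by (auto simp: B_def)
  then show "simple_eigenvalue (ladder_op_sym L \<mu>) (complex_of_real (\<omega>\<^sup>2))"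
    using iff[of \<omega>] simple[of \<omega>] w by blast
qed

theorem theorem1:
  fixes L \<mu> :: real
  assumes "L > 0" and "\<mu> > 0"
  shows "(\<mu> \<ge> 1 \<longrightarrow> disc_spec_sym L \<mu> = {})
    \<and> (\<mu> < 1 \<longrightarrow> (\<forall>\<omega>b \<omega>t :: real. 0 \<le> \<omega>b \<and> \<omega>b < \<omega>t \<and> is_gap L \<mu> {\<omega>b\<^sup>2<..<\<omega>t\<^sup>2} \<longrightarrow>
        (gap_type_i L \<omega>b \<omega>t \<longrightarrow>
          (\<exists>\<omega>1 \<omega>2 :: real. \<omega>b < \<omega>1 \<and> \<omega>1 < \<omega>2 \<and> \<omega>2 < \<omega>t
            \<and> {\<nu>::real. \<omega>b\<^sup>2 < \<nu> \<and> \<nu> < \<omega>t\<^sup>2 \<and> is_eigenvalue (ladder_op_sym L \<mu>) (complex_of_real \<nu>)}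
                = {\<omega>1\<^sup>2, \<omega>2\<^sup>2}
            \<and> simple_eigenvalue (ladder_op_sym L \<mu>) (complex_of_real (\<omega>1\<^sup>2))
            \<and> simple_eigenvalue (ladder_op_sym L \<mu>) (complex_of_real (\<omega>2\<^sup>2))))
        \<and> (gap_type_ii L \<omega>b \<omega>t \<or> gap_type_iii L \<omega>b \<omega>t \<longrightarrow>
          (\<exists>\<omega>1 :: real. \<omega>b < \<omega>1 \<and> \<omega>1 < \<omega>t
            \<and> {\<nu>::real. \<omega>b\<^sup>2 < \<nu> \<and> \<nu> < \<omega>t\<^sup>2 \<and> is_eigenvalue (ladder_op_sym L \<mu>) (complex_of_real \<nu>)}
                = {\<omega>1\<^sup>2}
            \<and> simple_eigenvalue (ladder_op_sym L \<mu>) (complex_of_real (\<omega>1\<^sup>2))))))"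
proof (intro conjI impI allI)
  assume "\<mu> \<ge> 1"
  then show "disc_spec_sym L \<mu> = {}" by (rule discrete_spectrum_empty[OF assms(1)])
next
  fix \<omega>b \<omega>t
  assume \<mu>: "\<mu> < 1" and "0 \<le> \<omega>b \<and> \<omega>b < \<omega>t \<and> is_gap L \<mu> {\<omega>b\<^sup>2<..<\<omega>t\<^sup>2}"
  then have b: "0 \<le> \<omega>b" "\<omega>b < \<omega>t" by simp_all
  assume gap: "gap_type_i L \<omega>b \<omega>t"
  define c where "c = 1 - (1 - \<mu>)\<^sup>2"
  have c: "0 < c" "c < 1" using assms(2) \<mu> by (simp_all add: c_def abs_square_less_1)
  obtain \<omega>1 \<omega>2 where \<omega>: "\<omega>b < \<omega>1" "\<omega>1 < \<omega>2" "\<omega>2 < \<omega>t"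
    and B: "{t. \<omega>b < t \<and> t < \<omega>t \<and> phi L t = branch 1 c t} = {\<omega>1}"
      "{t. \<omega>b < t \<and> t < \<omega>t \<and> phi L t = branch (- 1) c t} = {\<omega>2}"
    using type_i_crossings[OF assms(1) c gap] by blast
  note ev = gap_eigenvalues[OF assms \<mu> b disjI1[OF gap], folded c_def, unfolded B]
  show "\<exists>\<omega>1 \<omega>2 :: real. \<omega>b < \<omega>1 \<and> \<omega>1 < \<omega>2 \<and> \<omega>2 < \<omega>t
      \<and> {\<nu>::real. \<omega>b\<^sup>2 < \<nu> \<and> \<nu> < \<omega>t\<^sup>2 \<and> is_eigenvalue (ladder_op_sym L \<mu>) (complex_of_real \<nu>)} = {\<omega>1\<^sup>2, \<omega>2\<^sup>2}
      \<and> simple_eigenvalue (ladder_op_sym L \<mu>) (complex_of_real (\<omega>1\<^sup>2))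
      \<and> simple_eigenvalue (ladder_op_sym L \<mu>) (complex_of_real (\<omega>2\<^sup>2))"
  proof (rule exI[of _ \<omega>1], rule exI[of _ \<omega>2], intro conjI \<omega>)
    show "{\<nu>::real. \<omega>b\<^sup>2 < \<nu> \<and> \<nu> < \<omega>t\<^sup>2 \<and> is_eigenvalue (ladder_op_sym L \<mu>) (complex_of_real \<nu>)} = {\<omega>1\<^sup>2, \<omega>2\<^sup>2}"
      unfolding ev(1) by blast
  qed (rule ev(2), blast)+
next
  fix \<omega>b \<omega>t
  assume \<mu>: "\<mu> < 1" and "0 \<le> \<omega>b \<and> \<omega>b < \<omega>t \<and> is_gap L \<mu> {\<omega>b\<^sup>2<..<\<omega>t\<^sup>2}"
  then have b: "0 \<le> \<omega>b" "\<omega>b < \<omega>t" by simp_all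
  assume gap: "gap_type_ii L \<omega>b \<omega>t \<or> gap_type_iii L \<omega>b \<omega>t"
  define c where "c = 1 - (1 - \<mu>)\<^sup>2"
  have c: "0 < c" "c < 1" using assms(2) \<mu> by (simp_all add: c_def abs_square_less_1)
  obtain \<omega>1 where \<omega>: "\<omega>b < \<omega>1" "\<omega>1 < \<omega>t"
    and B: "{t. \<omega>b < t \<and> t < \<omega>t \<and> phi L t = branch 1 c t}
      \<union> {t. \<omega>b < t \<and> t < \<omega>t \<and> phi L t = branch (- 1) c t} = {\<omega>1}"
    using gap
  proof
    assume ii: "gap_type_ii L \<omega>b \<omega>t"
    obtain \<omega> where \<omega>: "\<omega>b < \<omega>" "\<omega> < \<omega>t" "{t. \<omega>b < t \<and> t < \<omega>t \<and> phi L t = branch (- 1) c t} = {\<omega>}"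
      using type_ii_crossings(1)[OF assms(1) c ii] by blast
    show ?thesis
      by (rule that[OF \<omega>(1,2)]) (simp only: type_ii_crossings(2)[OF assms(1) c ii] \<omega>(3) Un_empty_left Un_empty_right)
  next
    assume iii: "gap_type_iii L \<omega>b \<omega>t"
    obtain \<omega> where \<omega>: "\<omega>b < \<omega>" "\<omega> < \<omega>t" "{t. \<omega>b < t \<and> t < \<omega>t \<and> phi L t = branch 1 c t} = {\<omega>}"
      using type_iii_crossings(1)[OF assms(1) c iii] by blast
    show ?thesis
      by (rule that[OF \<omega>(1,2)]) (simp only: type_iii_crossings(2)[OF assms(1) c iii] \<omega>(3) Un_empty_left Un_empty_right)
  qed
  note ev = gap_eigenvalues[OF assms \<mu> b disjI2[OF gap], folded c_def, unfolded B]
  show "\<exists>\<omega>1 :: real. \<omega>b < \<omega>1 \<and> \<omega>1 < \<omega>t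
      \<and> {\<nu>::real. \<omega>b\<^sup>2 < \<nu> \<and> \<nu> < \<omega>t\<^sup>2 \<and> is_eigenvalue (ladder_op_sym L \<mu>) (complex_of_real \<nu>)} = {\<omega>1\<^sup>2}
      \<and> simple_eigenvalue (ladder_op_sym L \<mu>) (complex_of_real (\<omega>1\<^sup>2))"
  proof (intro exI[of _ \<omega>1] conjI \<omega>)
    show "{\<nu>::real. \<omega>b\<^sup>2 < \<nu> \<and> \<nu> < \<omega>t\<^sup>2 \<and> is_eigenvalue (ladder_op_sym L \<mu>) (complex_of_real \<nu>)} = {\<omega>1\<^sup>2}"
      unfolding ev(1) by blast
  qed (rule ev(2), blast)
qed

end
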